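(* Let $c>0$ and $\alpha>-1$ be real numbers and let $n\ge0$ be an integer. The function $\psi_{n,c}^{(\alpha)}$ has an analytic extension to $\mathbb R$ given by $$\psi_{n,c}^{(\alpha)}(x)=\frac{\sqrt\pi\,2^{\alpha+1/2}}{|\mu_n^{(\alpha)}(c)|}\sum_{k\ge0}i^{k-n}\beta_k^n\,\frac{\Gamma(k+\alpha+1)}{\sqrt{h_k}\,k!}\,\frac{J_{k+\alpha+1/2}(cx)}{(cx)^{\alpha+1/2}},\qquad x\neq0,$$ and the eigenvalue $\mu_n^{(\alpha)}(c)$ is given by $$\mu_n^{(\alpha)}(c)=i^n\sqrt\pi\left(\frac2c\right)^{\alpha+1/2}\ \frac{\displaystyle\sum_{k\ge0}i^{k-n}\beta_k^n\,\frac{\Gamma(k+\alpha+1)}{\sqrt{h_k}\,k!}\,J_{k+\alpha+1/2}(c)}{\displaystyle\sum_{k\ge0}\frac{\beta_k^n}{\sqrt{h_k}}\,\frac{\Gamma(k+\alpha+1)}{k!\,\Gamma(\alpha+1)}} .$$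
   Context: Let $I=[-1,1]$ and $\omega_\alpha(y)=(1-y^2)^\alpha$. The weighted finite Fourier transform on $L^2(I,\omega_\alpha)$ is $\mathcal F_c^{(\alpha)}f(x)=\int_{-1}^1e^{icxy}f(y)\omega_\alpha(y)\,dy$. It commutes with $\mathcal L_c^{(\alpha,\alpha)}\varphi(x)=(1-x^2)\varphi''(x)-(2\alpha+2)x\varphi'(x)-c^2x^2\varphi(x)$ on $C^2([-1,1])$. The GPSWFs $\psi_{n,c}^{(\alpha)}$, $n\ge0$, are the real-valued $C^2([-1,1])$ eigenfunctions of $-\mathcal L_c^{(\alpha,\alpha)}$, numbered by increasing eigenvalues $\chi_0(c)<\chi_1(c)<\cdots$ and normalized by $\int_{-1}^1(\psi_{n,c}^{(\alpha)})^2\omega_\alpha\,dt=1$; and $\mu_n^{(\alpha)}(c)$ is defined by $\mathcal F_c^{(\alpha)}\psi_{n,c}^{(\alpha)}=\mu_n^{(\alpha)}(c)\psi_{n,c}^{(\alpha)}$ on $I$. $P_k^{(\alpha,\alpha)}$ is the classical Jacobi polynomial (so $P_k^{(\alpha,\alpha)}(1)=\frac{\Gamma(k+\alpha+1)}{k!\,\Gamma(\alpha+1)}$), $h_k=\int_{-1}^1(P_k^{(\alpha,\alpha)})^2\omega_\alpha\,dy$, $\widetilde P_k^{(\alpha,\alpha)}=P_k^{(\alpha,\alpha)}/\sqrt{h_k}$, and $\beta_k^n=\int_{-1}^1\widetilde P_k^{(\alpha,\alpha)}\,\psi_{n,c}^{(\alpha)}\,\omega_\alpha\,dx$. $J_\nu$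 is the Bessel function of the first kind, and $J_{k+\alpha+1/2}(z)/z^{\alpha+1/2}$ denotes the entire function $\sum_{m\ge0}\frac{(-1)^m}{m!\,\Gamma(m+k+\alpha+3/2)}\,\frac{z^{2m+k}}{2^{2m+k+\alpha+1/2}}$ (this gives its meaning for $z<0$). *)

theory Defs
  imports "HOL-Analysis.Analysis"
begin

(* At y = -1 and y = 1 this is 0 whatever the exponent, since 0 powr a = 0; it only
   enters through Lebesgue integrals, which do not see these two points. *)
definition omega :: "real \<Rightarrow> real \<Rightarrow> real" where
  "omega \<alpha> y = (1 - y\<^sup>2) powr \<alpha>"

definition weighted_Fourier :: "real \<Rightarrow> real \<Rightarrow> (real \<Rightarrow> complex) \<Rightarrow> real \<Rightarrow> complex" where
  "weighted_Fourier c \<alpha> f x =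
     (LBINT y:{-1..1}. exp (\<i> * complex_of_real (c * x * y)) * f y * complex_of_real (omega \<alpha> y))"

(* One-sided at the end points, as usual for C^2([-1,1]). *)
definition deriv_I :: "(real \<Rightarrow> real) \<Rightarrow> real \<Rightarrow> real" where
  "deriv_I f x = vector_derivative f (at x within {-1..1})"

definition C2_I :: "(real \<Rightarrow> real) \<Rightarrow> bool" where
  "C2_I f \<longleftrightarrow> f differentiable_on {-1..1} \<and> deriv_I f differentiable_on {-1..1} \<and>
     continuous_on {-1..1} (deriv_I (deriv_I f))"

definition gpswf_operator :: "real \<Rightarrow> real \<Rightarrow> (real \<Rightarrow> real) \<Rightarrow> real \<Rightarrow> real" where
  "gpswf_operator c \<alpha> \<phi> x =
     (1 - x\<^sup>2) * deriv_I (deriv_I \<phi>) x - (2 * \<alpha> + 2) * x * deriv_I \<phi> x - c\<^sup>2 * x\<^sup>2 * \<phi> x"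

definition gpswf_eigenfunction :: "real \<Rightarrow> real \<Rightarrow> real \<Rightarrow> (real \<Rightarrow> real) \<Rightarrow> bool" where
  "gpswf_eigenfunction c \<alpha> ev \<phi> \<longleftrightarrow>
     C2_I \<phi> \<and> (\<exists>x\<in>{-1..1}. \<phi> x \<noteq> 0) \<and>
     (\<forall>x\<in>{-1..1}. - gpswf_operator c \<alpha> \<phi> x = ev * \<phi> x)"

(* The values of \<psi> outside [-1,1] are unconstrained. The sequence ev enumerates all the
   eigenvalues increasingly, and is thereby unique; \<psi> is determined up to its sign. *)
definition is_gpswf :: "real \<Rightarrow> real \<Rightarrow> nat \<Rightarrow> (real \<Rightarrow> real) \<Rightarrow> bool" where
  "is_gpswf c \<alpha> n \<psi> \<longleftrightarrow>
     (\<exists>ev :: nat \<Rightarrow> real. strict_mono ev \<and>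
        range ev = {l. \<exists>\<phi>. gpswf_eigenfunction c \<alpha> l \<phi>} \<and>
        gpswf_eigenfunction c \<alpha> (ev n) \<psi>) \<and>
     (LBINT t:{-1..1}. (\<psi> t)\<^sup>2 * omega \<alpha> t) = 1"

(* Szego, Orthogonal Polynomials, (4.3.2); the value at 1 is (k + a) gchoose k. *)
definition jacobi_P :: "nat \<Rightarrow> real \<Rightarrow> real \<Rightarrow> real \<Rightarrow> real" where
  "jacobi_P k a b x =
     (\<Sum>s\<le>k. ((real k + a) gchoose (k - s)) * ((real k + b) gchoose s) *
        ((x - 1) / 2) ^ s * ((x + 1) / 2) ^ (k - s))"

definition jacobi_h :: "real \<Rightarrow> nat \<Rightarrow> real" where
  "jacobi_h \<alpha> k = (LBINT y:{-1..1}. (jacobi_P k \<alpha> \<alpha> y)\<^sup>2 * omega \<alpha> y)"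

definition jacobi_normalized :: "real \<Rightarrow> nat \<Rightarrow> real \<Rightarrow> real" where
  "jacobi_normalized \<alpha> k x = jacobi_P k \<alpha> \<alpha> x / sqrt (jacobi_h \<alpha> k)"

definition jacobi_coeff :: "real \<Rightarrow> (real \<Rightarrow> real) \<Rightarrow> nat \<Rightarrow> real" where
  "jacobi_coeff \<alpha> \<psi> k = (LBINT x:{-1..1}. jacobi_normalized \<alpha> k x * \<psi> x * omega \<alpha> x)"

(* Only meaningful for z > 0, because of the real power. *)
definition bessel_J :: "real \<Rightarrow> real \<Rightarrow> real" where
  "bessel_J \<nu> z = (\<Sum>m. (-1) ^ m / fact m * rGamma (real m + \<nu> + 1) * (z / 2) powr (2 * real m + \<nu>))"

(* The entire function written J_{k+\<alpha>+1/2}(z) / z^(\<alpha>+1/2), here on the whole real line. *)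
definition bessel_J_quot :: "real \<Rightarrow> nat \<Rightarrow> real \<Rightarrow> real" where
  "bessel_J_quot \<alpha> k z =
     (\<Sum>m. (-1) ^ m / (fact m * Gamma (real m + real k + \<alpha> + 3/2)) *
        (z ^ (2 * m + k) / 2 powr (2 * real m + real k + \<alpha> + 1/2)))"

definition real_analytic_on :: "(real \<Rightarrow> real) \<Rightarrow> real set \<Rightarrow> bool" where
  "real_analytic_on f S \<longleftrightarrow> (\<forall>x\<in>S. \<exists>F. (\<lambda>h. f (x + h)) has_fps_expansion F)"

(* The common coefficient i^(k-n) \<beta>_k^n \<Gamma>(k+\<alpha>+1) / (sqrt h_k k!). *)
definition series_coeff :: "real \<Rightarrow> nat \<Rightarrow> (real \<Rightarrow> real) \<Rightarrow> nat \<Rightarrow> complex" where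
  "series_coeff \<alpha> n \<psi> k =
     \<i> powi (int k - int n) * complex_of_real
       (jacobi_coeff \<alpha> \<psi> k * (Gamma (real k + \<alpha> + 1) / (sqrt (jacobi_h \<alpha> k) * fact k)))"

end

(*
  Idea. Expanding e^{icxy} in powers of y, and y^m in the Jacobi polynomials of degree at most m,
  turns both formulas into interchanges of triangular double sums: the first uses the Rodrigues
  formula in the form <f, P_k> = 1/(2^k k!) * int f^{(k)} omega_{alpha+k}, which produces the Bessel
  functions; the second expands psi at the end point x = 1, where the terms of
  1 = sum_{k<=m} <y^m, P_k> P_k(1) (P_k normalized) are nonnegative and hence at most 1.

  What remains is mu = i^n |mu| and mu <> 0. Let u(., l) be the solution of the differential equation
  with parameter l that is regular at 1, normalized by u(1, l) = 1. By the Wronskian identity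
    A(l) B(l') - B(l) A(l') = (l' - l) int_0^1 u(., l) u(., l') omega,  A = u(0, .), B = u'(0, .),
  the curve A + iB turns strictly counterclockwise; it lies in the fourth quadrant for l <= 0, and the
  eigenvalues are exactly its crossings with the coordinate axes. So psi(0) + i psi'(0) is a positive
  multiple of i^n psi(1). On the imaginary axis the equation is no longer oscillatory, so
  g(t) = int e^{cty} psi(y) omega(y) dy does not vanish for t > 0; as g has the sign of psi(1) for
  large t, this gives the sign of g(0) = mu psi(0), respectively g'(0) = -i mu psi'(0).
*)

theory Submission
  imports Defs
begin

section \<open>The weight\<close>

text \<open>For -1 < \<alpha> < 0 the weight is unbounded at the end points. Two devices absorb
  this: as a finite measure the weight integrates every bounded measurable function, and integration
  by parts only differentiates \<open>omega (\<alpha> + 1)\<close>, which is continuous and vanishes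
  at -1 and 1, so that boundary terms there disappear.

  The index n is defined only by the order of the eigenvalues, and \<psi> only up to sign. The value
  \<psi>(1) serves as common reference: regularity at 1 ties the data of \<psi> at 0 to it, the
  Laplace transform ties the low moments of \<psi> to it, and the sign cancels in \<mu>. As \<mu> =
  0 is excluded only at that point, the facts about the transform are derived from a moment
  recurrence and not by continuing \<psi> analytically.

  The series in the denominator is a pointwise value at the end point, out of reach of mean-square
  arguments; its convergence is deduced from the power series of \<psi>, which is available once
  \<mu> is known to be nonzero.\<close>

definition weight_measure :: "real \<Rightarrow> real measure" where
  "weight_measure \<alpha> = density (restrict_space lborel {-1..1}) (\<lambda>y. ennreal (omega \<alpha> y))"

lemma omega_nonneg: "0 \<le> omega \<alpha> y"
  by (simp add: omega_def)

lemma omega_pos: "-1 < y \<Longrightarrow> y < 1 \<Longrightarrow> 0 < omega \<alpha> y"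
  using abs_square_less_1[of y] by (auto simp: omega_def abs_less_iff)

lemma borel_measurable_omega [measurable]: "omega \<alpha> \<in> borel_measurable borel"
  unfolding omega_def by measurable

text \<open>The substitution t = (x + 1) / 2 turns 4 t (1 - t) into 1 - x^2, hence the factor
  4^\<alpha>; the factor 2 is dx/dt.\<close>

lemma omega_has_integral:
  assumes "\<alpha> > -1"
  shows "(omega \<alpha> has_integral (2 * 4 powr \<alpha> * Beta (\<alpha> + 1) (\<alpha> + 1))) {-1..1}"
proof -
  let ?f = "\<lambda>t::real. t powr (\<alpha> + 1 - 1) * (1 - t) powr (\<alpha> + 1 - 1)"
  have "(?f has_integral Beta (\<alpha> + 1) (\<alpha> + 1)) {0..1}"
    by (rule has_integral_Beta_real) (use assms in auto)
  then have "(?f has_integral Beta (\<alpha> + 1) (\<alpha> + 1)) (cbox 0 1)"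
    by simp
  from has_integral_affinity[OF this, of "1/2" "1/2"]
  have "((\<lambda>x. ?f (x / 2 + 1 / 2)) has_integral 2 * Beta (\<alpha> + 1) (\<alpha> + 1))
          ((\<lambda>x. 2 * x - 1) ` {0..1})"
    by simp
  also have "(\<lambda>x. 2 * x - 1) ` {0..1} = {-1..1::real}"
  proof safe
    fix x :: real assume "x \<in> {-1..1}"
    then show "x \<in> (\<lambda>x. 2 * x - 1) ` {0..1}"
      by (intro image_eqI[of _ _ "(x + 1) / 2"]) (auto simp: field_simps)
  qed auto
  finally have "((\<lambda>x. 4 powr \<alpha> * ?f (x / 2 + 1 / 2)) has_integral
      4 powr \<alpha> * (2 * Beta (\<alpha> + 1) (\<alpha> + 1))) {-1..1}"
    by (rule has_integral_mult_right)
  moreover have "4 powr \<alpha> * ?f (x / 2 + 1 / 2) = omega \<alpha> x" if "x \<in> {-1..1}" for x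
  proof -
    have "?f (x / 2 + 1 / 2) = ((x / 2 + 1 / 2) * (1 - (x / 2 + 1 / 2))) powr \<alpha>"
      using that by (simp add: powr_mult)
    also have "4 powr \<alpha> * \<dots> = (4 * ((x / 2 + 1 / 2) * (1 - (x / 2 + 1 / 2)))) powr \<alpha>"
      using that by (subst powr_mult) auto
    also have "4 * ((x / 2 + 1 / 2) * (1 - (x / 2 + 1 / 2))) = 1 - x\<^sup>2"
      by (simp add: algebra_simps power2_eq_square)
    finally show ?thesis by (simp add: omega_def)
  qed
  ultimately show ?thesis
    by (subst (asm) has_integral_cong[where g = "omega \<alpha>"]) (auto simp: mult_ac)
qed

lemma omega_set_integrable:
  assumes "\<alpha> > -1"
  shows "set_integrable lborel {-1..1} (omega \<alpha>)"
proof -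
  have "omega \<alpha> absolutely_integrable_on {-1..1}"
    using omega_has_integral[OF assms]
    by (intro nonnegative_absolutely_integrable_1) (auto simp: omega_nonneg has_integral_iff)
  then show ?thesis
    unfolding set_integrable_def by (subst (asm) integrable_completion) auto
qed

lemma space_weight_measure [simp]: "space (weight_measure \<alpha>) = {-1..1}"
  by (simp add: weight_measure_def space_restrict_space)

lemma sets_weight_measure: "sets (weight_measure \<alpha>) = sets (restrict_space borel {-1..1})"
  by (simp add: weight_measure_def sets_restrict_space)

lemma borel_measurable_weight_iff:
  "f \<in> borel_measurable (weight_measure \<alpha>) \<longleftrightarrow> f \<in> borel_measurable (restrict_space lborel {-1..1})"
  by (intro arg_cong2[where f = "(\<in>)"] measurable_cong_sets refl)
     (auto simp: sets_weight_measure sets_restrict_space)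

lemma borel_measurable_weight [intro]:
  fixes f :: "real \<Rightarrow> 'a::topological_space"
  assumes "continuous_on {-1..1} f"
  shows "f \<in> borel_measurable (weight_measure \<alpha>)"
  using borel_measurable_continuous_on_restrict[OF assms]
  by (subst measurable_cong_sets[OF sets_weight_measure refl])

lemma finite_measure_weight:
  assumes "\<alpha> > -1"
  shows "finite_measure (weight_measure \<alpha>)"
proof
  have "emeasure (weight_measure \<alpha>) (space (weight_measure \<alpha>)) =
      (\<integral>\<^sup>+y\<in>{-1..1}. ennreal (omega \<alpha> y) \<partial>lborel)"
    unfolding weight_measure_def
    by (subst emeasure_density)
       (auto simp: nn_integral_restrict_space space_restrict_space measurable_restrict_space1
             sets_restrict_space intro!: nn_integral_cong split: split_indicator)
  also have "\<dots> = (\<integral>\<^sup>+y. ennreal (indicator {-1..1} y * omega \<alpha> y) \<partial>lborel)"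
    by (intro nn_integral_cong) (auto split: split_indicator)
  also have "\<dots> < \<infinity>"
    using omega_set_integrable[OF assms] unfolding set_integrable_def
    by (subst (asm) integrable_iff_bounded) (auto simp: abs_mult omega_nonneg)
  finally show "emeasure (weight_measure \<alpha>) (space (weight_measure \<alpha>)) \<noteq> \<infinity>" by simp
qed

lemma integrable_weight_bounded:
  fixes f :: "real \<Rightarrow> 'a::{banach, second_countable_topology}"
  assumes "\<alpha> > -1" "f \<in> borel_measurable (weight_measure \<alpha>)" "\<And>y. y \<in> {-1..1} \<Longrightarrow> norm (f y) \<le> B"
  shows "integrable (weight_measure \<alpha>) f"
proof -
  interpret finite_measure "weight_measure \<alpha>" by (rule finite_measure_weight) fact
  show ?thesis by (rule integrable_const_bound[of f B]) (use assms in auto)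
qed

lemma integrable_weight [intro]:
  fixes f :: "real \<Rightarrow> 'a::{banach, second_countable_topology}"
  assumes "\<alpha> > -1" "continuous_on {-1..1} f"
  shows "integrable (weight_measure \<alpha>) f"
proof -
  have "bounded (f ` {-1..1})"
    by (intro compact_imp_bounded compact_continuous_image assms) auto
  then obtain B where "\<forall>y\<in>{-1..1}. norm (f y) \<le> B"
    by (auto simp: bounded_iff)
  then show ?thesis using assms by (intro integrable_weight_bounded[of _ _ B]) auto
qed

lemma integral_weight:
  fixes f :: "real \<Rightarrow> 'a::{banach, second_countable_topology}"
  assumes "f \<in> borel_measurable (weight_measure \<alpha>)"
  shows "integral\<^sup>L (weight_measure \<alpha>) f = (LBINT y:{-1..1}. omega \<alpha> y *\<^sub>R f y)"
  using assms unfolding weight_measure_def borel_measurable_weight_iff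
  by (subst integral_density)
     (auto simp: omega_nonneg integral_restrict_space set_lebesgue_integral_def
        borel_measurable_weight_iff[unfolded weight_measure_def] measurable_restrict_space1)

text \<open>Positivity is asked on a subinterval only, because the applications control f just near
  the end point 1. The weight is positive inside [-1,1], so a vanishing integral would make (a, b) a
  null set.\<close>

lemma integral_weight_pos:
  fixes f :: "real \<Rightarrow> real"
  assumes "integrable (weight_measure \<alpha>) f" "\<And>y. y \<in> {-1..1} \<Longrightarrow> 0 \<le> f y"
    and "-1 \<le> a" "a < b" "b \<le> 1" "\<And>y. a < y \<Longrightarrow> y < b \<Longrightarrow> 0 < f y"
  shows "0 < integral\<^sup>L (weight_measure \<alpha>) f"
proof -
  let ?M = "weight_measure \<alpha>"
  have nn: "AE y in ?M. 0 \<le> f y"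
    using assms by (intro AE_I2) auto
  have "integral\<^sup>L ?M f \<noteq> 0"
  proof
    assume "integral\<^sup>L ?M f = 0"
    then have "AE y in ?M. f y = 0"
      using integral_nonneg_eq_0_iff_AE[OF assms(1) nn] by simp
    then have "AE y in restrict_space lborel {-1..1}. ennreal (omega \<alpha> y) > 0 \<longrightarrow> f y = 0"
      unfolding weight_measure_def by (subst (asm) AE_density) (auto simp: measurable_restrict_space1)
    then have "AE y in lborel. y \<in> {-1..1} \<longrightarrow> omega \<alpha> y > 0 \<longrightarrow> f y = 0"
      by (subst (asm) AE_restrict_space_iff) auto
    then have "AE y in lborel. y \<notin> {a<..<b}"
      by eventually_elim (use assms(3-6) omega_pos in fastforce)
    then have "emeasure lborel {a<..<b} = 0"
      by (subst (asm) AE_iff_measurable[of "{a<..<b}"]) auto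
    then show False using \<open>a < b\<close> by simp
  qed
  moreover have "integral\<^sup>L ?M f \<ge> 0"
    by (rule integral_nonneg_AE) fact
  ultimately show ?thesis by simp
qed

text \<open>Differentiability is required inside (a, b) only: a primitive such as
  \<open>omega (\<alpha> + 1)\<close> has infinite slope at -1 and 1 when \<alpha> < 0. The
  indicator admits the half interval [0,1] as a domain.\<close>

lemma integral_weight_FTC:
  fixes f F :: "real \<Rightarrow> real"
  assumes \<alpha>: "\<alpha> > -1" and ab: "-1 \<le> a" "a \<le> b" "b \<le> 1"
    and f: "continuous_on {a..b} f" and F: "continuous_on {a..b} F"
    and deriv: "\<And>x. a < x \<Longrightarrow> x < b \<Longrightarrow> (F has_real_derivative f x * omega \<alpha> x) (at x)"
  shows "(\<integral>y. indicator {a..b} y * f y \<partial>weight_measure \<alpha>) = F b - F a"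
proof -
  let ?g = "\<lambda>y. indicator {a..b} y * f y"
  have meas: "?g \<in> borel_measurable borel"
    using borel_measurable_continuous_on_indicator[OF _ f] by simp
  have "bounded (f ` {a..b})"
    by (intro compact_imp_bounded compact_continuous_image f) auto
  then obtain B where B: "\<forall>y\<in>{a..b}. \<bar>f y\<bar> \<le> B" by (auto simp: bounded_iff)
  then have B0: "0 \<le> B" using ab by force
  have meas': "?g \<in> borel_measurable (weight_measure \<alpha>)"
    unfolding borel_measurable_weight_iff using meas by (intro measurable_restrict_space1) simp
  have int: "integrable (weight_measure \<alpha>) ?g"
    by (rule integrable_weight_bounded[OF \<alpha> meas', of B]) (use B B0 in \<open>auto split: split_indicator\<close>)
  have eq: "(\<integral>y. ?g y \<partial>weight_measure \<alpha>) = (LBINT y:{a..b}. f y * omega \<alpha> y)"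
    unfolding integral_weight[OF meas'] set_lebesgue_integral_def
    using ab by (intro Bochner_Integration.integral_cong) (auto split: split_indicator)
  have "set_integrable lborel {a..b} (\<lambda>y. f y * omega \<alpha> y)"
    unfolding set_integrable_def
  proof (rule Bochner_Integration.integrable_bound)
    show "integrable lborel (\<lambda>y. B * (indicator {-1..1} y *\<^sub>R omega \<alpha> y))"
      using omega_set_integrable[OF \<alpha>] unfolding set_integrable_def by auto
    show "(\<lambda>x. indicator {a..b} x *\<^sub>R (f x * omega \<alpha> x)) \<in> borel_measurable lborel"
      using borel_measurable_times[OF meas borel_measurable_omega[of \<alpha>]] by (simp add: mult.assoc)
    show "AE x in lborel. norm (indicator {a..b} x *\<^sub>R (f x * omega \<alpha> x))
        \<le> norm (B * (indicator {-1..1} x *\<^sub>R omega \<alpha> x))"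
      using B B0 ab by (intro AE_I2) (auto simp: abs_mult omega_nonneg mult_right_mono split: split_indicator)
  qed
  from set_borel_integral_eq_integral(2)[OF this]
  have "(LBINT y:{a..b}. f y * omega \<alpha> y) = integral {a..b} (\<lambda>y. f y * omega \<alpha> y)" .
  also have "\<dots> = F b - F a"
    by (intro integral_unique fundamental_theorem_of_calculus_interior ab F)
       (use deriv in \<open>auto simp: has_real_derivative_iff_has_vector_derivative\<close>)
  finally show ?thesis using eq by simp
qed

lemma integral_weight_FTC_full:
  fixes f F :: "real \<Rightarrow> real"
  assumes "\<alpha> > -1" "continuous_on {-1..1} f" "continuous_on {-1..1} F"
    and "\<And>x. -1 < x \<Longrightarrow> x < 1 \<Longrightarrow> (F has_real_derivative f x * omega \<alpha> x) (at x)"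
  shows "(\<integral>y. f y \<partial>weight_measure \<alpha>) = F 1 - F (-1)"
proof -
  have "(\<integral>y. f y \<partial>weight_measure \<alpha>) = (\<integral>y. indicator {-1..1} y * f y \<partial>weight_measure \<alpha>)"
    by (intro Bochner_Integration.integral_cong) auto
  also have "\<dots> = F 1 - F (-1)"
    by (rule integral_weight_FTC) (use assms in auto)
  finally show ?thesis .
qed

lemma continuous_on_omega_Suc:
  assumes "\<alpha> > -1" "S \<subseteq> {-1..1}"
  shows "continuous_on S (omega (\<alpha> + 1))"
  unfolding omega_def
  using assms by (intro continuous_on_powr' continuous_intros)
    (auto simp: abs_square_le_1 abs_le_iff subset_iff)

lemma omega_Suc: "-1 \<le> x \<Longrightarrow> x \<le> 1 \<Longrightarrow> omega (\<alpha> + 1) x = (1 - x\<^sup>2) * omega \<alpha> x"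
  using powr_mult_base[of "1 - x\<^sup>2" \<alpha>]
  by (simp add: omega_def abs_square_le_1 abs_le_iff add.commute)

text \<open>True for every exponent by the convention \<open>0 powr a = 0\<close>. It is meant for
  the exponent \<alpha> + 1 > 0, where it is the continuous value.\<close>

lemma omega_Suc_endpoint [simp]: "omega \<alpha> 1 = 0" "omega \<alpha> (-1) = 0"
  by (simp_all add: omega_def)

lemma has_real_derivative_omega_Suc:
  assumes "-1 < x" "x < 1"
  shows "(omega (\<alpha> + 1) has_real_derivative - 2 * (\<alpha> + 1) * x * omega \<alpha> x) (at x)"
proof -
  have "1 - x\<^sup>2 > 0" using assms by (simp add: abs_square_less_1 abs_less_iff)
  then have "((\<lambda>x. (1 - x\<^sup>2) powr (\<alpha> + 1)) has_real_derivative
      (\<alpha> + 1) * (1 - x\<^sup>2) powr (\<alpha> + 1 - 1) * (- 2 * x)) (at x)"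
    by (intro DERIV_chain2[OF has_real_derivative_powr]) (auto intro!: derivative_eq_intros)
  then show ?thesis unfolding omega_def by (rule DERIV_cong) (simp add: algebra_simps)
qed

lemma integral_weight_Suc:
  fixes f :: "real \<Rightarrow> real"
  assumes "\<alpha> > -1" "continuous_on {-1..1} f"
  shows "(\<integral>y. f y \<partial>weight_measure (\<alpha> + 1)) = (\<integral>y. (1 - y\<^sup>2) * f y \<partial>weight_measure \<alpha>)"
proof -
  have "f \<in> borel_measurable (weight_measure (\<alpha> + 1))"
    "(\<lambda>y. (1 - y\<^sup>2) * f y) \<in> borel_measurable (weight_measure \<alpha>)"
    using assms by (auto intro!: borel_measurable_weight continuous_intros)
  then show ?thesis
    unfolding integral_weight[OF \<open>f \<in> _\<close>] integral_weight[OF \<open>(\<lambda>y. (1 - y\<^sup>2) * f y) \<in> _\<close>]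
    by (intro set_lebesgue_integral_cong) (auto simp: omega_Suc)
qed

section \<open>Moments of the weight\<close>

definition moment :: "real \<Rightarrow> nat \<Rightarrow> real" where
  "moment \<alpha> m = (\<integral>y. y ^ m \<partial>weight_measure \<alpha>)"

text \<open>Integrates the derivative of y^(m+1) (1 - y^2)^(\<alpha>+1), whose boundary values
  vanish.\<close>

lemma moment_recurrence:
  assumes \<alpha>: "\<alpha> > -1"
  shows "(real m + 2 * \<alpha> + 3) * moment \<alpha> (m + 2) = (real m + 1) * moment \<alpha> m"
proof -
  let ?f = "\<lambda>y. (real m + 1) * y ^ m - (real m + 2 * \<alpha> + 3) * y ^ (m + 2)"
  have "(\<integral>y. ?f y \<partial>weight_measure \<alpha>) = 1 ^ (m + 1) * omega (\<alpha> + 1) 1 - (-1) ^ (m + 1) * omega (\<alpha> + 1) (-1)"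
  proof (rule integral_weight_FTC_full[OF \<alpha>])
    show "continuous_on {- 1..1} (\<lambda>a. a ^ (m + 1) * omega (\<alpha> + 1) a)"
      by (intro continuous_intros continuous_on_omega_Suc \<alpha>) auto
    fix x :: real assume x: "-1 < x" "x < 1"
    show "((\<lambda>a. a ^ (m + 1) * omega (\<alpha> + 1) a) has_real_derivative ?f x * omega \<alpha> x) (at x)"
      by (rule derivative_eq_intros has_real_derivative_omega_Suc x refl)+
         (use x in \<open>simp add: omega_Suc, simp add: algebra_simps power2_eq_square\<close>)
  qed (auto intro!: continuous_intros)
  also have "\<dots> = 0" by simp
  also have "(\<integral>y. ?f y \<partial>weight_measure \<alpha>) =
      (real m + 1) * moment \<alpha> m - (real m + 2 * \<alpha> + 3) * moment \<alpha> (m + 2)"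
    unfolding moment_def
    by (subst Bochner_Integration.integral_diff) (auto intro!: integrable_weight continuous_intros \<alpha>)
  finally show ?thesis by simp
qed

lemma moment_1:
  assumes \<alpha>: "\<alpha> > -1"
  shows "moment \<alpha> 1 = 0"
proof -
  have "(\<integral>y. - 2 * (\<alpha> + 1) * y \<partial>weight_measure \<alpha>) = omega (\<alpha> + 1) 1 - omega (\<alpha> + 1) (-1)"
    by (rule integral_weight_FTC_full[OF \<alpha>])
       (auto intro!: continuous_intros continuous_on_omega_Suc \<alpha>
          has_real_derivative_omega_Suc[THEN DERIV_cong])
  then show ?thesis using \<alpha> by (simp add: moment_def)
qed

text \<open>Legendre duplication trades Gamma(2\<alpha> + 2) for Gamma(\<alpha> + 1) Gamma(\<alpha>
  + 3/2); the shift by 3/2 is the one in the coefficients of the Bessel series.\<close>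

lemma moment_0:
  assumes \<alpha>: "\<alpha> > -1"
  shows "moment \<alpha> 0 = sqrt pi * Gamma (\<alpha> + 1) / Gamma (\<alpha> + 3/2)"
proof -
  have "moment \<alpha> 0 = (LBINT y:{-1..1}. omega \<alpha> y)"
    unfolding moment_def by (subst integral_weight) auto
  also have "\<dots> = integral {-1..1} (omega \<alpha>)"
    by (rule set_borel_integral_eq_integral(2)[OF omega_set_integrable[OF \<alpha>]])
  also have "\<dots> = 2 * 4 powr \<alpha> * Beta (\<alpha> + 1) (\<alpha> + 1)"
    by (intro integral_unique omega_has_integral \<alpha>)
  finally have *: "moment \<alpha> 0 = 2 * 4 powr \<alpha> * Gamma (\<alpha> + 1) * Gamma (\<alpha> + 1) / Gamma (2 * \<alpha> + 2)"
    by (simp add: Beta_def add_ac)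
  have "complex_of_real (\<alpha> + 1) \<notin> \<int>\<^sub>\<le>\<^sub>0" "complex_of_real (\<alpha> + 1) + 1/2 \<notin> \<int>\<^sub>\<le>\<^sub>0"
    using \<alpha> by (auto elim!: nonpos_Ints_cases simp: complex_eq_iff)
  from Gamma_legendre_duplication[OF this]
  have "complex_of_real (Gamma (\<alpha> + 1) * Gamma (\<alpha> + 1 + 1/2)) =
      complex_of_real (exp ((1 - 2 * (\<alpha> + 1)) * ln 2) * sqrt pi * Gamma (2 * (\<alpha> + 1)))"
    by (simp flip: exp_of_real Gamma_complex_of_real)
  then have "Gamma (\<alpha> + 1) * Gamma (\<alpha> + 1 + 1/2) =
      exp ((1 - 2 * (\<alpha> + 1)) * ln 2) * sqrt pi * Gamma (2 * (\<alpha> + 1))"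
    unfolding of_real_eq_iff .
  moreover have "exp ((1 - 2 * (\<alpha> + 1)) * ln 2) = 1 / (2 * 4 powr \<alpha>)"
  proof -
    have "exp ((1 - 2 * (\<alpha> + 1)) * ln 2) = 2 powr (1 - 2 * (\<alpha> + 1))" by (simp add: powr_def)
    also have "\<dots> = 2 powr - (1 + 2 * \<alpha>)" by simp
    also have "\<dots> = inverse (2 powr (1 + 2 * \<alpha>))"
      by (rule powr_minus)
    also have "2 powr (1 + 2 * \<alpha>) = 2 * (2 powr 2) powr \<alpha>"
      unfolding powr_powr powr_add by simp
    also have "inverse \<dots> = 1 / (2 * 4 powr \<alpha>)" by (simp add: inverse_eq_divide)
    finally show ?thesis .
  qed
  ultimately have "Gamma (\<alpha> + 1) * Gamma (\<alpha> + 3/2) * (2 * 4 powr \<alpha>) = sqrt pi * Gamma (2 * \<alpha> + 2)"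
    by (simp add: add_ac)
  moreover have "Gamma (\<alpha> + 3/2) > 0" "Gamma (2 * \<alpha> + 2) > 0" "Gamma (\<alpha> + 1) > 0"
    using \<alpha> by (auto intro!: Gamma_real_pos)
  ultimately show ?thesis
    unfolding * by (simp add: field_simps)
qed

lemma moment_odd:
  assumes \<alpha>: "\<alpha> > -1"
  shows "moment \<alpha> (2 * j + 1) = 0"
proof (induction j)
  case (Suc j)
  have "(real (2 * j + 1) + 2 * \<alpha> + 3) * moment \<alpha> (2 * j + 1 + 2) = 0"
    using moment_recurrence[OF \<alpha>, of "2 * j + 1"] Suc by simp
  moreover have "real (2 * j + 1) + 2 * \<alpha> + 3 > 0" using \<alpha> by simp
  ultimately show ?case by simp
qed (use moment_1[OF \<alpha>] in simp)

lemma moment_even: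
  assumes \<alpha>: "\<alpha> > -1"
  shows "moment \<alpha> (2 * j) =
    fact (2 * j) / (4 ^ j * fact j) * sqrt pi * Gamma (\<alpha> + 1) / Gamma (real j + \<alpha> + 3/2)"
proof (induction j)
  case (Suc j)
  have pos: "real j + \<alpha> + 3/2 > 0" using \<alpha> by simp
  then have G: "Gamma (real (Suc j) + \<alpha> + 3/2) = (real j + \<alpha> + 3/2) * Gamma (real j + \<alpha> + 3/2)"
    using Gamma_plus1[of "real j + \<alpha> + 3/2"] by (force simp: add_ac elim!: nonpos_Ints_cases)
  have "Gamma (real j + \<alpha> + 3/2) > 0" using pos by (rule Gamma_real_pos)
  have *: "(2 * (real j + \<alpha> + 3/2)) * moment \<alpha> (2 * Suc j) = (2 * real j + 1) * moment \<alpha> (2 * j)"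
    using moment_recurrence[OF \<alpha>, of "2 * j"] by (simp add: algebra_simps)
  have "moment \<alpha> (2 * Suc j) = (2 * real j + 1) * moment \<alpha> (2 * j) / (2 * (real j + \<alpha> + 3/2))"
    using pos by (subst *[symmetric]) simp
  also have "\<dots> = fact (2 * Suc j) / (4 ^ Suc j * fact (Suc j)) * sqrt pi * Gamma (\<alpha> + 1)
      / Gamma (real (Suc j) + \<alpha> + 3/2)"
    unfolding Suc G using pos \<open>Gamma (real j + \<alpha> + 3/2) > 0\<close>
    by (simp add: divide_simps) (simp add: algebra_simps)?
  finally show ?case .
qed (use moment_0[OF \<alpha>] in simp)

lemma moment_nonneg:
  assumes "\<alpha> > -1"
  shows "0 \<le> moment \<alpha> m"
proof (cases "even m")
  case True
  then have "AE y in weight_measure \<alpha>. 0 \<le> y ^ m" by (intro AE_I2) (simp add: zero_le_even_power)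
  then show "0 \<le> moment \<alpha> m" unfolding moment_def by (rule integral_nonneg_AE)
qed (use moment_odd[OF assms] in \<open>metis oddE order_refl\<close>)

section \<open>Jacobi polynomials\<close>

lemma gbinomial_absorb_real:
  "(real j + 1) * (a gchoose Suc j) = (a - real j) * (a gchoose j)" for a :: real
  using gbinomial_mult_1[of a j] by (simp add: algebra_simps)

lemma gbinomial_pos:
  fixes a :: real
  assumes "a > real j - 1"
  shows "0 < a gchoose j"
  unfolding gbinomial_prod_rev using assms by (intro divide_pos_pos prod_pos) auto

lemma jacobi_P_at_1: "jacobi_P k a b 1 = (real k + a) gchoose k"
proof -
  have "jacobi_P k a b 1 = (\<Sum>s\<le>k. if s = 0 then (real k + a) gchoose k else 0)"
    unfolding jacobi_P_def by (intro sum.cong) auto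
  then show ?thesis by (simp add: sum.delta)
qed

lemma jacobi_P_at_1_pos: "a > -1 \<Longrightarrow> 0 < jacobi_P k a b 1"
  unfolding jacobi_P_at_1 by (intro gbinomial_pos) auto

definition jacobi_poly :: "real \<Rightarrow> nat \<Rightarrow> real poly" where
  "jacobi_poly \<alpha> k = (\<Sum>s\<le>k. smult (((real k + \<alpha>) gchoose (k - s)) * ((real k + \<alpha>) gchoose s))
     ([:- (1/2), 1/2:] ^ s * [:1/2, 1/2:] ^ (k - s)))"

lemma poly_jacobi_poly: "poly (jacobi_poly \<alpha> k) x = jacobi_P k \<alpha> \<alpha> x"
  unfolding jacobi_poly_def jacobi_P_def
  by (auto simp: poly_sum mult.assoc diff_divide_distrib add_divide_distrib add_ac intro!: sum.cong)

lemma continuous_on_jacobi_P [continuous_intros]: "continuous_on S (jacobi_P k \<alpha> \<alpha>)"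
  unfolding poly_jacobi_poly[abs_def, symmetric] by (intro continuous_intros)

lemma degree_jacobi_term: "degree ([:- (1/2), 1/2:] ^ s * [:1/2, 1/2::real:] ^ t) = s + t"
  by (subst degree_mult_eq) (auto simp: degree_power_eq)

lemma degree_jacobi_poly: "degree (jacobi_poly \<alpha> k) \<le> k"
  unfolding jacobi_poly_def
  by (intro degree_sum_le order.trans[OF degree_smult_le]) (auto simp: degree_jacobi_term)

text \<open>Each of the k + 1 products in the definition has degree k and leading coefficient 2^-k.
  For \<alpha> > -1 the binomial factors are positive, so nothing cancels.\<close>

lemma coeff_jacobi_poly_pos:
  assumes "\<alpha> > -1"
  shows "0 < coeff (jacobi_poly \<alpha> k) k"
proof -
  have "coeff ([:- (1/2), 1/2:] ^ s * [:1/2, 1/2::real:] ^ (k - s)) k = (1/2) ^ k" if "s \<le> k" for s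
  proof -
    have "coeff ([:- (1/2), 1/2:] ^ s * [:1/2, 1/2::real:] ^ (k - s)) k =
        lead_coeff ([:- (1/2), 1/2:] ^ s * [:1/2, 1/2::real:] ^ (k - s))"
      unfolding degree_jacobi_term using that by simp
    also have "\<dots> = (1/2) ^ s * (1/2) ^ (k - s)"
      by (simp add: lead_coeff_mult lead_coeff_power)
    finally show ?thesis using that by (simp flip: power_add)
  qed
  then have "coeff (jacobi_poly \<alpha> k) k = (\<Sum>s\<le>k. ((real k + \<alpha>) gchoose (k - s)) * ((real k + \<alpha>) gchoose s) * (1/2) ^ k)"
    unfolding jacobi_poly_def by (simp add: coeff_sum)
  also have "\<dots> > 0"
    using assms by (intro sum_pos mult_pos_pos gbinomial_pos) (auto simp: of_nat_diff)
  finally show ?thesis .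
qed

text \<open>One step of the Rodrigues formula. Both polynomials have the same upper binomial entry k
  + 1 + \<alpha>, so the claim reduces to comparing coefficients in X = (x - 1) / 2 and Y = (x + 1)
  / 2.\<close>

lemma has_real_derivative_omega_jacobi_P:
  assumes x: "-1 < x" "x < 1"
  shows "((\<lambda>y. omega (\<alpha> + 1) y * jacobi_P k (\<alpha> + 1) (\<alpha> + 1) y) has_real_derivative
     - 2 * (real k + 1) * jacobi_P (Suc k) \<alpha> \<alpha> x * omega \<alpha> x) (at x)"
proof -
  define N where "N = real k + 1 + \<alpha>"
  define X Y where "X = (x - 1) / 2" and "Y = (x + 1) / 2"
  define a where "a = (\<lambda>s. (N gchoose (k - s)) * (N gchoose s))"
  define b where "b = (\<lambda>s. (N gchoose (Suc k - s)) * (N gchoose s))"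
  define Q' where "Q' = (\<Sum>s\<le>k. a s * ((real s * X ^ (s - 1)) / 2 * Y ^ (k - s) +
      X ^ s * (real (k - s) * Y ^ (k - s - 1) / 2)))"
  have Peq: "jacobi_P k (\<alpha> + 1) (\<alpha> + 1) y = (\<Sum>s\<le>k. a s * ((y - 1) / 2) ^ s * ((y + 1) / 2) ^ (k - s))" for y
    unfolding jacobi_P_def a_def N_def by (simp add: add_ac)
  have Peq': "jacobi_P (Suc k) \<alpha> \<alpha> x = (\<Sum>s\<le>Suc k. b s * X ^ s * Y ^ (Suc k - s))"
    unfolding jacobi_P_def b_def N_def X_def Y_def by (simp add: add_ac)
  have deriv: "(jacobi_P k (\<alpha> + 1) (\<alpha> + 1) has_real_derivative Q') (at x)"
    unfolding Peq[abs_def] Q'_def X_def Y_def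
    by (rule derivative_eq_intros refl | simp)+ (simp add: algebra_simps)
  \<comment> \<open>The absorption identities express both contributions to a coefficient of degree
    k + 1 by the coefficients b of \<open>jacobi_P (Suc k)\<close>.\<close>
  have ba: "(real k + 1 - real s) * b s = (real s + \<alpha> + 1) * a s" if "s \<le> k" for s
  proof -
    have "(real (k - s) + 1) * (N gchoose Suc (k - s)) = (N - real (k - s)) * (N gchoose (k - s))"
      by (rule gbinomial_absorb_real)
    then have "(real (k - s) + 1) * b s = (N - real (k - s)) * a s"
      unfolding a_def b_def Suc_diff_le[OF that] by (simp add: mult.assoc[symmetric])
    then show ?thesis
      using that by (simp add: N_def of_nat_diff algebra_simps)
  qed
  have ba': "(real s + 1) * b (Suc s) = (real k + 1 + \<alpha> - real s) * a s" if "s \<le> k" for s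
    using gbinomial_absorb_real[of s N] that by (simp add: a_def b_def N_def)
  \<comment> \<open>In these variables every term becomes homogeneous of degree k + 1.\<close>
  have XY: "1 - x\<^sup>2 = - 4 * X * Y" "x = X + Y"
    by (simp_all add: X_def Y_def power2_eq_square field_simps)
  have pw: "real s * X ^ (s - 1) * X = real s * X ^ s" "real s * Y ^ (s - 1) * Y = real s * Y ^ s" for s
    by (cases s; simp)+
  have "(1 - x\<^sup>2) * Q' = (\<Sum>s\<le>k. - 2 * a s * (real s * X ^ s * Y ^ Suc (k - s) + real (k - s) * X ^ Suc s * Y ^ (k - s)))"
    unfolding XY(1) Q'_def sum_distrib_left
  proof (intro sum.cong refl)
    fix s
    have "- 4 * X * Y * (a s * (real s * X ^ (s - 1) / 2 * Y ^ (k - s) + X ^ s * (real (k - s) * Y ^ (k - s - 1) / 2)))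
      = - 2 * a s * ((real s * X ^ (s - 1) * X) * Y ^ Suc (k - s) + (real (k - s) * Y ^ (k - s - 1) * Y) * X ^ Suc s)"
      by (simp add: algebra_simps)
    then show "- 4 * X * Y * (a s * (real s * X ^ (s - 1) / 2 * Y ^ (k - s) + X ^ s * (real (k - s) * Y ^ (k - s - 1) / 2)))
      = - 2 * a s * (real s * X ^ s * Y ^ Suc (k - s) + real (k - s) * X ^ Suc s * Y ^ (k - s))"
      unfolding pw by (simp add: mult_ac)
  qed
  moreover have "- 2 * (\<alpha> + 1) * x * jacobi_P k (\<alpha> + 1) (\<alpha> + 1) x =
      (\<Sum>s\<le>k. - 2 * (\<alpha> + 1) * a s * (X ^ Suc s * Y ^ (k - s) + X ^ s * Y ^ Suc (k - s)))"
    unfolding Peq X_def[symmetric] Y_def[symmetric] sum_distrib_left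
    by (intro sum.cong refl) (simp add: XY(2) algebra_simps)
  ultimately have "- 2 * (\<alpha> + 1) * x * jacobi_P k (\<alpha> + 1) (\<alpha> + 1) x + (1 - x\<^sup>2) * Q' =
      (\<Sum>s\<le>k. - 2 * ((real s + \<alpha> + 1) * a s) * X ^ s * Y ^ Suc (k - s)
        - 2 * ((real k + 1 + \<alpha> - real s) * a s) * X ^ Suc s * Y ^ (k - s))"
    by (simp only: sum.distrib[symmetric]) (rule sum.cong, auto simp: algebra_simps of_nat_diff)
  also have "\<dots> = (\<Sum>s\<le>k. - 2 * ((real k + 1 - real s) * b s) * X ^ s * Y ^ Suc (k - s))
        + (\<Sum>s\<le>k. - 2 * ((real s + 1) * b (Suc s)) * X ^ Suc s * Y ^ (k - s))"
    unfolding sum.distrib[symmetric] by (intro sum.cong refl) (simp add: ba ba')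
  \<comment> \<open>The added term s = k + 1 carries the factor k + 1 - s = 0.\<close>
  also have "(\<Sum>s\<le>k. - 2 * ((real k + 1 - real s) * b s) * X ^ s * Y ^ Suc (k - s)) =
      (\<Sum>s\<le>Suc k. - 2 * ((real k + 1 - real s) * b s) * X ^ s * Y ^ (Suc k - s))"
    by (simp add: Suc_diff_le)
  \<comment> \<open>The shift adds a term s = 0, which vanishes because of the factor s. The weights
    k + 1 - s and s then add up to k + 1.\<close>
  also have "(\<Sum>s\<le>k. - 2 * ((real s + 1) * b (Suc s)) * X ^ Suc s * Y ^ (k - s)) =
      (\<Sum>s\<le>Suc k. - 2 * (real s * b s) * X ^ s * Y ^ (Suc k - s))"
    by (subst sum.atMost_Suc_shift) (simp add: add_ac)
  also have "(\<Sum>s\<le>Suc k. - 2 * ((real k + 1 - real s) * b s) * X ^ s * Y ^ (Suc k - s)) + \<dots> =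
      - 2 * (real k + 1) * jacobi_P (Suc k) \<alpha> \<alpha> x"
    unfolding Peq' sum_distrib_left sum.distrib[symmetric]
    by (intro sum.cong refl) (simp add: algebra_simps)
  finally have key: "- 2 * (\<alpha> + 1) * x * jacobi_P k (\<alpha> + 1) (\<alpha> + 1) x + (1 - x\<^sup>2) * Q' =
      - 2 * (real k + 1) * jacobi_P (Suc k) \<alpha> \<alpha> x" .
  have "((\<lambda>y. omega (\<alpha> + 1) y * jacobi_P k (\<alpha> + 1) (\<alpha> + 1) y) has_real_derivative
      - 2 * (\<alpha> + 1) * x * omega \<alpha> x * jacobi_P k (\<alpha> + 1) (\<alpha> + 1) x + Q' * omega (\<alpha> + 1) x) (at x)"
    by (rule DERIV_mult has_real_derivative_omega_Suc x deriv)+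
  also have "- 2 * (\<alpha> + 1) * x * omega \<alpha> x * jacobi_P k (\<alpha> + 1) (\<alpha> + 1) x + Q' * omega (\<alpha> + 1) x =
      (- 2 * (\<alpha> + 1) * x * jacobi_P k (\<alpha> + 1) (\<alpha> + 1) x + (1 - x\<^sup>2) * Q') * omega \<alpha> x"
    using x by (simp add: omega_Suc) (simp add: algebra_simps)
  finally show ?thesis unfolding key .
qed

text \<open>Integration by parts k times. Each step differentiates f, lowers the degree of the
  Jacobi polynomial and raises the exponent of the weight by one, which is why the induction
  generalizes over \<alpha>.\<close>

lemma integral_poly_jacobi_P:
  assumes "\<alpha> > -1"
  shows "(\<integral>y. poly f y * jacobi_P k \<alpha> \<alpha> y \<partial>weight_measure \<alpha>) =
    (\<integral>y. poly ((pderiv ^^ k) f) y \<partial>weight_measure (\<alpha> + real k)) / (2 ^ k * fact k)"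
  using assms
proof (induction k arbitrary: f \<alpha>)
  case 0
  show ?case by (simp add: jacobi_P_def)
next
  case (Suc k)
  let ?P = "jacobi_P (Suc k) \<alpha> \<alpha>" and ?Q = "jacobi_P k (\<alpha> + 1) (\<alpha> + 1)"
  let ?F = "\<lambda>y. poly f y * (omega (\<alpha> + 1) y * ?Q y)"
  have "(\<integral>y. (1 - y\<^sup>2) * (poly (pderiv f) y * ?Q y) - 2 * (real k + 1) * (poly f y * ?P y) \<partial>weight_measure \<alpha>)
      = ?F 1 - ?F (-1)"
  proof (rule integral_weight_FTC_full[OF Suc.prems])
    fix x :: real assume x: "-1 < x" "x < 1"
    have "(?F has_real_derivative poly (pderiv f) x * (omega (\<alpha> + 1) x * ?Q x)
        + (- 2 * (real k + 1) * ?P x * omega \<alpha> x) * poly f x) (at x)"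
      by (rule DERIV_mult poly_DERIV has_real_derivative_omega_jacobi_P x)+
    then show "(?F has_real_derivative ((1 - x\<^sup>2) * (poly (pderiv f) x * ?Q x)
        - 2 * (real k + 1) * (poly f x * ?P x)) * omega \<alpha> x) (at x)"
      by (rule DERIV_cong) (use x in \<open>simp add: omega_Suc, simp add: algebra_simps\<close>)
  qed (use Suc.prems in \<open>auto intro!: continuous_intros continuous_on_omega_Suc\<close>)
  then have "(\<integral>y. (1 - y\<^sup>2) * (poly (pderiv f) y * ?Q y) \<partial>weight_measure \<alpha>)
      - 2 * (real k + 1) * (\<integral>y. poly f y * ?P y \<partial>weight_measure \<alpha>) = 0"
    by (subst (asm) Bochner_Integration.integral_diff)
       (use Suc.prems in \<open>auto intro!: integrable_weight continuous_intros\<close>)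
  moreover have "(\<integral>y. (1 - y\<^sup>2) * (poly (pderiv f) y * ?Q y) \<partial>weight_measure \<alpha>) =
      (\<integral>y. poly (pderiv f) y * ?Q y \<partial>weight_measure (\<alpha> + 1))"
    using Suc.prems by (intro integral_weight_Suc[symmetric] continuous_intros) auto
  moreover have "\<dots> = (\<integral>y. poly ((pderiv ^^ k) (pderiv f)) y \<partial>weight_measure (\<alpha> + 1 + real k)) / (2 ^ k * fact k)"
    using Suc.prems by (intro Suc.IH) auto
  ultimately have *: "2 * (real k + 1) * (\<integral>y. poly f y * ?P y \<partial>weight_measure \<alpha>) =
      (\<integral>y. poly ((pderiv ^^ k) (pderiv f)) y \<partial>weight_measure (\<alpha> + 1 + real k)) / (2 ^ k * fact k)"
    by linarith
  have "(\<integral>y. poly f y * ?P y \<partial>weight_measure \<alpha>) =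
      2 * (real k + 1) * (\<integral>y. poly f y * ?P y \<partial>weight_measure \<alpha>) / (2 * (real k + 1))"
    by simp
  also have "\<dots> = (\<integral>y. poly ((pderiv ^^ Suc k) f) y \<partial>weight_measure (\<alpha> + real (Suc k))) / (2 ^ Suc k * fact (Suc k))"
    unfolding * by (simp add: funpow_Suc_right add_ac mult_ac del: funpow.simps)
  finally show ?case .
qed

lemma higher_pderiv_eq_0: "degree p < k \<Longrightarrow> (pderiv ^^ k) p = 0" for p :: "real poly"
proof (induction k arbitrary: p)
  case (Suc k)
  show ?case
  proof (cases "degree p = 0")
    case True
    then have "pderiv p = 0" by (simp add: pderiv_eq_0_iff)
    moreover have "(pderiv ^^ j) (0 :: real poly) = 0" for j by (induction j) auto
    ultimately show ?thesis by (simp add: funpow_Suc_right del: funpow.simps)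
  next
    case False
    then have "degree (pderiv p) < k" using Suc.prems by (simp add: degree_pderiv)
    then show ?thesis using Suc.IH by (simp add: funpow_Suc_right del: funpow.simps)
  qed
qed simp

lemma jacobi_P_orthogonal:
  assumes "\<alpha> > -1" "degree f < k"
  shows "(\<integral>y. poly f y * jacobi_P k \<alpha> \<alpha> y \<partial>weight_measure \<alpha>) = 0"
  using assms by (simp add: integral_poly_jacobi_P higher_pderiv_eq_0)

lemma higher_pderiv_monom:
  "k \<le> m \<Longrightarrow> (pderiv ^^ k) (monom 1 m) = monom (fact m / fact (m - k) :: real) (m - k)"
proof (induction k)
  case (Suc k)
  then obtain d where d: "m - k = Suc d" "m - Suc k = d" by (metis Suc_diff_Suc Suc_le_eq)
  have "(pderiv ^^ Suc k) (monom 1 m) = monom (real (Suc d) * (fact m / fact (Suc d))) d"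
    using Suc by (simp add: d pderiv_monom)
  also have "real (Suc d) * (fact m / fact (Suc d)) = fact m / fact d"
    by (simp add: field_simps del: of_nat_Suc)
  finally show ?case by (simp add: d)
qed simp

text \<open>The k-th derivative of y^m is a multiple of y^(m-k), so the coefficient is a moment for
  the exponent \<alpha> + k. In particular it is never negative, and it vanishes when m - k is
  odd.\<close>

lemma integral_power_jacobi_P:
  assumes "\<alpha> > -1"
  shows "(\<integral>y. y ^ m * jacobi_P k \<alpha> \<alpha> y \<partial>weight_measure \<alpha>) =
    (if k \<le> m then real (m choose k) / 2 ^ k * moment (\<alpha> + real k) (m - k) else 0)"
proof (cases "k \<le> m")
  case True
  have "(\<integral>y. y ^ m * jacobi_P k \<alpha> \<alpha> y \<partial>weight_measure \<alpha>) =
      (\<integral>y. fact m / fact (m - k) * y ^ (m - k) \<partial>weight_measure (\<alpha> + real k)) / (2 ^ k * fact k)"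
    using integral_poly_jacobi_P[OF assms, of "monom 1 m" k] True
    by (simp add: higher_pderiv_monom poly_monom)
  then show ?thesis using True by (simp add: moment_def binomial_fact)
next
  case False
  then show ?thesis
    using jacobi_P_orthogonal[OF assms, of "monom 1 m" k] by (simp add: degree_monom_eq poly_monom)
qed

lemma jacobi_h_eq:
  assumes "\<alpha> > -1"
  shows "jacobi_h \<alpha> k = (\<integral>y. (jacobi_P k \<alpha> \<alpha> y)\<^sup>2 \<partial>weight_measure \<alpha>)"
  unfolding jacobi_h_def
  by (subst integral_weight) (auto intro!: continuous_intros simp: mult.commute)

text \<open>The value at 1 is positive, and continuity keeps the polynomial positive on an interval
  next to 1.\<close>

lemma jacobi_h_pos:
  assumes "\<alpha> > -1"
  shows "0 < jacobi_h \<alpha> k"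
proof -
  have "isCont (jacobi_P k \<alpha> \<alpha>) 1"
    using continuous_on_jacobi_P[of UNIV] by (simp add: continuous_on_eq_continuous_at)
  then have "\<forall>\<^sub>F y in at 1. 0 < jacobi_P k \<alpha> \<alpha> y"
    using jacobi_P_at_1_pos[OF assms] by (intro order_tendstoD) (auto simp: isCont_def)
  then obtain d where d: "d > 0" "\<And>y. y \<noteq> 1 \<Longrightarrow> dist y 1 < d \<Longrightarrow> 0 < jacobi_P k \<alpha> \<alpha> y"
    by (auto simp: eventually_at)
  show ?thesis
    unfolding jacobi_h_eq[OF assms]
  proof (rule integral_weight_pos)
    show "max (-1) (1 - d) < (1::real)" using d by auto
    fix y assume "max (-1) (1 - d) < y" "y < 1"
    then show "0 < (jacobi_P k \<alpha> \<alpha> y)\<^sup>2" using d(2)[of y] by (auto simp: dist_real_def)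
  qed (use assms in \<open>auto intro!: integrable_weight continuous_intros\<close>)
qed

text \<open>Induction on the degree: subtracting the multiple of
  \<open>jacobi_poly \<alpha> (Suc N)\<close> that cancels the top coefficient leaves degree at most
  N, and orthogonality identifies this multiple as the top Jacobi coefficient of q.\<close>

lemma jacobi_expansion:
  assumes \<alpha>: "\<alpha> > -1" and "degree q \<le> N"
  shows "poly q x = (\<Sum>k\<le>N. (\<integral>y. poly q y * jacobi_P k \<alpha> \<alpha> y \<partial>weight_measure \<alpha>) / jacobi_h \<alpha> k * jacobi_P k \<alpha> \<alpha> x)"
  using assms(2)
proof (induction N arbitrary: q)
  case 0
  then obtain a where q: "q = [:a:]" by (metis degree_0_id le_zero_eq)
  show ?case using jacobi_h_pos[OF \<alpha>, of 0]
    by (simp add: q jacobi_P_def jacobi_h_eq[OF \<alpha>])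
next
  case (Suc N)
  let ?I = "\<lambda>q k. \<integral>y. poly q y * jacobi_P k \<alpha> \<alpha> y \<partial>weight_measure \<alpha>"
  let ?J = "jacobi_poly \<alpha> (Suc N)"
  define t where "t = coeff q (Suc N) / coeff ?J (Suc N)"
  define r where "r = q - smult t ?J"
  have deg: "degree r \<le> N"
  proof (rule degree_le, safe)
    fix i assume "N < i"
    consider "i = Suc N" | "i > Suc N" using \<open>N < i\<close> by linarith
    then show "coeff r i = 0"
    proof cases
      case 1
      then show ?thesis using coeff_jacobi_poly_pos[OF \<alpha>, of "Suc N"] by (simp add: r_def t_def)
    next
      case 2
      then show ?thesis
        using Suc.prems degree_jacobi_poly[of \<alpha> "Suc N"] by (simp add: r_def coeff_eq_0)
    qed
  qed
  have I: "?I q k = ?I r k + t * ?I ?J k" for k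
  proof -
    have "?I q k = (\<integral>y. poly r y * jacobi_P k \<alpha> \<alpha> y + t * (poly ?J y * jacobi_P k \<alpha> \<alpha> y) \<partial>weight_measure \<alpha>)"
      by (intro Bochner_Integration.integral_cong) (simp_all add: r_def algebra_simps)
    also have "\<dots> = ?I r k + t * ?I ?J k"
      by (subst Bochner_Integration.integral_add)
         (auto intro!: integrable_weight continuous_intros \<alpha>)
    finally show ?thesis .
  qed
  have J: "?I ?J k = (if k = Suc N then jacobi_h \<alpha> (Suc N) else 0)" if "k \<le> Suc N" for k
  proof (cases "k = Suc N")
    case True
    then show ?thesis by (simp add: poly_jacobi_poly jacobi_h_eq[OF \<alpha>] power2_eq_square)
  next
    case False
    then have "degree (jacobi_poly \<alpha> k) < Suc N" using degree_jacobi_poly[of \<alpha> k] that by simp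
    from jacobi_P_orthogonal[OF \<alpha> this] show ?thesis
      using False by (simp add: poly_jacobi_poly mult.commute)
  qed
  have "?I r (Suc N) = 0" using deg by (intro jacobi_P_orthogonal \<alpha>) simp
  then have top: "?I q (Suc N) / jacobi_h \<alpha> (Suc N) = t"
    using I[of "Suc N"] J[of "Suc N"] jacobi_h_pos[OF \<alpha>, of "Suc N"] by simp
  have low: "?I q k = ?I r k" if "k \<le> N" for k
    using I[of k] J[of k] that by simp
  have "poly q x = poly r x + t * jacobi_P (Suc N) \<alpha> \<alpha> x"
    by (simp add: r_def poly_jacobi_poly)
  also have "poly r x = (\<Sum>k\<le>N. ?I q k / jacobi_h \<alpha> k * jacobi_P k \<alpha> \<alpha> x)"
    unfolding Suc.IH[OF deg] by (intro sum.cong) (auto simp: low)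
  finally show ?case by (simp only: sum.atMost_Suc top)
qed

section \<open>Fourier integrals and Bessel functions\<close>

text \<open>Row m has at most m + 1 nonzero entries, each bounded by C, so all its partial sums are
  at most C (m + 1); this explains the weight in the first hypothesis. With that majorant Tannery's
  theorem passes to the limit in the number of columns.\<close>

lemma sums_double_triangular:
  fixes e :: "nat \<Rightarrow> complex" and t :: "nat \<Rightarrow> nat \<Rightarrow> real"
  assumes e: "summable (\<lambda>m. norm (e m) * (real m + 1))"
    and zero: "\<And>m k. m < k \<Longrightarrow> t m k = 0" and bound: "\<And>m k. \<bar>t m k\<bar> \<le> C"
  shows "(\<lambda>k. \<Sum>m. e m * of_real (t m k)) sums (\<Sum>m. e m * of_real (\<Sum>k\<le>m. t m k))"
proof -
  have C: "0 \<le> C" using bound[of 0 0] by linarith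
  have sum_bound: "\<bar>\<Sum>k<N. t m k\<bar> \<le> C * (real m + 1)" for m N
  proof -
    have "(\<Sum>k<N. \<bar>t m k\<bar>) = (\<Sum>k\<in>{..<N} \<inter> {..m}. \<bar>t m k\<bar>)"
      using zero by (intro sum.mono_neutral_right) (auto, meson not_le)
    also have "\<dots> \<le> of_nat (card ({..<N} \<inter> {..m})) * C"
      by (rule sum_bounded_above) (use bound in auto)
    also have "\<dots> \<le> (real m + 1) * C"
      using card_mono[of "{..m}" "{..<N} \<inter> {..m}"] C by (intro mult_right_mono) auto
    finally have "(\<Sum>k<N. \<bar>t m k\<bar>) \<le> C * (real m + 1)" by (simp add: mult.commute)
    then show ?thesis by (rule order.trans[OF sum_abs])
  qed
  have summ: "summable (\<lambda>m. e m * of_real (t m k))" for k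
  proof (rule summable_comparison_test)
    show "\<exists>N. \<forall>n\<ge>N. norm (e n * of_real (t n k)) \<le> C * (norm (e n) * (real n + 1))"
    proof (intro exI allI impI)
      fix n
      have "norm (e n * of_real (t n k)) \<le> norm (e n) * C"
        using bound by (simp add: norm_mult mult_left_mono)
      also have "\<dots> \<le> C * (norm (e n) * (real n + 1))"
        using C by (simp add: mult.left_commute mult_left_mono algebra_simps)
      finally show "norm (e n * of_real (t n k)) \<le> C * (norm (e n) * (real n + 1))" .
    qed
  qed (intro summable_mult e)
  have "(\<lambda>N. \<Sum>m. e m * of_real (\<Sum>k<N. t m k)) \<longlonglongrightarrow> (\<Sum>m. e m * of_real (\<Sum>k\<le>m. t m k))"
  proof (rule tannerys_theorem[THEN conjunct2, THEN conjunct2])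
    show "(\<lambda>N. e m * of_real (\<Sum>k<N. t m k)) \<longlonglongrightarrow> e m * of_real (\<Sum>k\<le>m. t m k)" for m
    proof (rule tendsto_eventually, rule eventually_mono[OF eventually_gt_at_top[of m]])
      fix N assume "m < N"
      then have "(\<Sum>k<N. t m k) = (\<Sum>k\<le>m. t m k)"
        by (intro sum.mono_neutral_right) (auto simp: zero)
      then show "e m * of_real (\<Sum>k<N. t m k) = e m * of_real (\<Sum>k\<le>m. t m k)" by simp
    qed
    show "summable (\<lambda>m. C * (norm (e m) * (real m + 1)))" by (intro summable_mult e)
    have "norm (e m * of_real (\<Sum>k<N. t m k)) \<le> C * (norm (e m) * (real m + 1))" for m N
      using mult_left_mono[OF sum_bound[of m N], of "norm (e m)"]
      by (simp add: norm_mult mult_ac del: of_real_sum)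
    then show "\<forall>\<^sub>F (m, N) in sequentially \<times>\<^sub>F sequentially.
        norm (e m * of_real (\<Sum>k<N. t m k)) \<le> C * (norm (e m) * (real m + 1))"
      by (intro always_eventually) auto
  qed auto
  moreover have "(\<Sum>m. e m * of_real (\<Sum>k<N. t m k)) = (\<Sum>k<N. \<Sum>m. e m * of_real (t m k))" for N
    by (subst suminf_sum[symmetric]) (auto intro: summ simp: sum_distrib_left)
  ultimately show ?thesis unfolding sums_def by simp
qed

text \<open>The factor m + 1 demanded by the triangular interchange is absorbed by 2^m, that is, by
  doubling w.\<close>

lemma summable_exp_linear: "summable (\<lambda>m. norm (w ^ m / fact m) * (real m + 1))" for w :: complex
proof -
  have "summable (\<lambda>m. inverse (fact m) * (2 * norm w) ^ m)" by (rule summable_exp)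
  then show ?thesis
  proof (rule summable_comparison_test[rotated], intro exI allI impI)
    fix m
    have "real m + 1 \<le> 2 ^ m"
      using less_exp[of m] by (metis Suc_leI of_nat_Suc of_nat_le_iff of_nat_numeral of_nat_power add.commute)
    then have "norm w ^ m / fact m * (real m + 1) \<le> norm w ^ m / fact m * 2 ^ m"
      by (intro mult_left_mono) auto
    then show "norm (norm (w ^ m / fact m) * (real m + 1)) \<le> inverse (fact m) * (2 * norm w) ^ m"
      by (simp add: norm_divide norm_mult norm_power power_mult_distrib divide_inverse norm_inverse norm_fact mult_ac)
  qed
qed

lemma summable_exp_norm: "summable (\<lambda>m. norm (w ^ m / fact m))" for w :: complex
  using summable_norm_exp[of w] by (simp add: divide_inverse scaleR_conv_of_real norm_mult mult.commute)

lemma exp_sums: "(\<lambda>m. w ^ m / fact m) sums exp w" for w :: complex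
  using exp_converges[of w] by (simp add: divide_inverse scaleR_conv_of_real mult.commute)

text \<open>Dominated interchange, since |y^m| \<le> 1 on [-1,1]. The coefficients are arbitrary
  because the lemma serves both the exponential series and the power series of \<psi>
  itself.\<close>

lemma power_series_integral_weight:
  fixes e :: "nat \<Rightarrow> complex" and \<phi> :: "real \<Rightarrow> complex"
  assumes \<alpha>: "\<alpha> > -1" and e: "summable (\<lambda>m. norm (e m))"
    and \<phi>: "\<phi> \<in> borel_measurable (weight_measure \<alpha>)" "\<And>y. y \<in> {-1..1} \<Longrightarrow> norm (\<phi> y) \<le> B"
  shows "(\<lambda>m. e m * (\<integral>y. of_real y ^ m * \<phi> y \<partial>weight_measure \<alpha>)) sums
    (\<integral>y. (\<Sum>m. e m * of_real y ^ m) * \<phi> y \<partial>weight_measure \<alpha>)"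
proof -
  interpret finite_measure "weight_measure \<alpha>" by (rule finite_measure_weight[OF \<alpha>])
  have B: "0 \<le> B" using order.trans[OF norm_ge_zero \<phi>(2)[of 0]] by simp
  have pow: "\<bar>y\<bar> ^ m \<le> 1" if "y \<in> {-1..1}" for y :: real and m
    using that by (intro power_le_one) auto
  have bnd: "norm (e m * of_real y ^ m * \<phi> y) \<le> norm (e m) * B" if "y \<in> {-1..1}" for m y
  proof -
    have "norm (e m * of_real y ^ m * \<phi> y) = norm (e m) * (\<bar>y\<bar> ^ m * norm (\<phi> y))"
      by (simp add: norm_mult norm_power)
    also have "\<dots> \<le> norm (e m) * (1 * B)"
      by (intro mult_left_mono mult_mono pow \<phi> that) auto
    finally show ?thesis by simp
  qed
  have meas: "(\<lambda>y. e m * of_real y ^ m * \<phi> y) \<in> borel_measurable (weight_measure \<alpha>)" for m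
    by (intro borel_measurable_times \<phi> borel_measurable_weight continuous_intros)
  have "(\<lambda>m. \<integral>y. e m * of_real y ^ m * \<phi> y \<partial>weight_measure \<alpha>) sums
      (\<integral>y. (\<Sum>m. e m * of_real y ^ m * \<phi> y) \<partial>weight_measure \<alpha>)"
  proof (rule sums_integral)
    show "integrable (weight_measure \<alpha>) (\<lambda>y. e m * of_real y ^ m * \<phi> y)" for m
      by (rule integrable_weight_bounded[OF \<alpha> meas bnd])
    show "AE y in weight_measure \<alpha>. summable (\<lambda>m. norm (e m * of_real y ^ m * \<phi> y))"
    proof (rule AE_I2)
      fix y assume "y \<in> space (weight_measure \<alpha>)"
      then have "\<And>m. norm (e m * of_real y ^ m * \<phi> y) \<le> norm (e m) * B" by (intro bnd) simp
      then show "summable (\<lambda>m. norm (e m * of_real y ^ m * \<phi> y))"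
        by (intro summable_comparison_test'[OF summable_mult2[OF e, of B], of 0]) simp
    qed
    have le: "(\<integral>y. norm (e m * of_real y ^ m * \<phi> y) \<partial>weight_measure \<alpha>) \<le>
        norm (e m) * (B * measure (weight_measure \<alpha>) {-1..1})" for m
    proof -
      have "(\<integral>y. norm (e m * of_real y ^ m * \<phi> y) \<partial>weight_measure \<alpha>) \<le>
          (\<integral>y. norm (e m) * B \<partial>weight_measure \<alpha>)"
        by (intro integral_mono integrable_norm integrable_weight_bounded[OF \<alpha> meas bnd] bnd) auto
      then show ?thesis by (simp add: mult_ac)
    qed
    show "summable (\<lambda>m. \<integral>y. norm (e m * of_real y ^ m * \<phi> y) \<partial>weight_measure \<alpha>)"
      by (rule summable_comparison_test'[OF summable_mult2[OF e], of 0]) (use le in auto)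
  qed
  moreover have "(\<integral>y. e m * of_real y ^ m * \<phi> y \<partial>weight_measure \<alpha>) =
      e m * (\<integral>y. of_real y ^ m * \<phi> y \<partial>weight_measure \<alpha>)" for m
    by (simp add: mult.assoc)
  moreover have "(\<integral>y. (\<Sum>m. e m * of_real y ^ m * \<phi> y) \<partial>weight_measure \<alpha>) =
      (\<integral>y. (\<Sum>m. e m * of_real y ^ m) * \<phi> y \<partial>weight_measure \<alpha>)"
  proof (rule Bochner_Integration.integral_cong[OF refl])
    fix y assume "y \<in> space (weight_measure \<alpha>)"
    then have "norm (e m * of_real y ^ m) \<le> norm (e m) * 1" for m
      unfolding norm_mult norm_power norm_of_real by (intro mult_left_mono pow) auto
    then have "summable (\<lambda>m. e m * of_real y ^ m)"
      by (intro summable_comparison_test'[OF e, of 0]) auto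
    then show "(\<Sum>m. e m * of_real y ^ m * \<phi> y) = (\<Sum>m. e m * of_real y ^ m) * \<phi> y"
      by (rule suminf_mult2[symmetric])
  qed
  ultimately show ?thesis by simp
qed

lemma exp_integral_weight_sums:
  fixes \<phi> :: "real \<Rightarrow> complex"
  assumes "\<alpha> > -1"
    and "\<phi> \<in> borel_measurable (weight_measure \<alpha>)" "\<And>y. y \<in> {-1..1} \<Longrightarrow> norm (\<phi> y) \<le> B"
  shows "(\<lambda>m. w ^ m / fact m * (\<integral>y. of_real y ^ m * \<phi> y \<partial>weight_measure \<alpha>)) sums
    (\<integral>y. exp (w * of_real y) * \<phi> y \<partial>weight_measure \<alpha>)"
proof -
  have "(\<Sum>m. w ^ m / fact m * of_real y ^ m) = exp (w * of_real y)" for y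
    using sums_unique[OF exp_sums[of "w * of_real y"]] by (simp add: power_mult_distrib mult_ac)
  then show ?thesis
    using power_series_integral_weight[OF assms(1) summable_exp_norm[of w] assms(2,3)] by simp
qed

text \<open>In the exponential series only the powers m = k + 2j survive: smaller m by
  orthogonality, the others by the vanishing of odd moments. The Gamma quotient in the even moments
  then produces the Bessel coefficients; \<open>2 powr (\<alpha> + 1/2)\<close> in
  \<open>\<kappa>\<close> compensates for its counterpart in their denominators.\<close>

lemma integral_exp_jacobi_P_sums:
  fixes z :: real and k :: nat
  assumes \<alpha>: "\<alpha> > -1"
  defines "\<kappa> \<equiv> \<i> ^ k * complex_of_real (sqrt pi * 2 powr (\<alpha> + 1/2) * (Gamma (real k + \<alpha> + 1) / fact k))"
    and "b \<equiv> (\<lambda>j. (-1) ^ j / (fact j * Gamma (real j + real k + \<alpha> + 3/2)) *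
        (z ^ (2 * j + k) / 2 powr (2 * real j + real k + \<alpha> + 1/2)))"
  shows "(\<lambda>j. \<kappa> * complex_of_real (b j)) sums
    (\<integral>y. exp (\<i> * of_real z * of_real y) * of_real (jacobi_P k \<alpha> \<alpha> y) \<partial>weight_measure \<alpha>)"
proof -
  let ?P = "jacobi_P k \<alpha> \<alpha>"
  let ?a = "\<lambda>m. (\<i> * of_real z) ^ m / fact m * (\<integral>y. of_real y ^ m * complex_of_real (?P y) \<partial>weight_measure \<alpha>)"
  have "bounded (?P ` {-1..1})"
    by (intro compact_imp_bounded compact_continuous_image continuous_intros) auto
  then obtain B where "\<forall>y\<in>{-1..1}. \<bar>?P y\<bar> \<le> B" by (auto simp: bounded_iff)
  then have "?a sums (\<integral>y. exp (\<i> * of_real z * of_real y) * of_real (?P y) \<partial>weight_measure \<alpha>)"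
    by (intro exp_integral_weight_sums[where B = B] \<alpha> borel_measurable_weight continuous_intros) auto
  moreover have a: "?a m = (\<i> * of_real z) ^ m / fact m *
      of_real (if k \<le> m then real (m choose k) / 2 ^ k * moment (\<alpha> + real k) (m - k) else 0)" for m
  proof -
    have "(\<integral>y. of_real y ^ m * complex_of_real (?P y) \<partial>weight_measure \<alpha>) =
        (\<integral>y. complex_of_real (y ^ m * ?P y) \<partial>weight_measure \<alpha>)" by simp
    also have "\<dots> = of_real (\<integral>y. y ^ m * ?P y \<partial>weight_measure \<alpha>)"
      by (rule integral_complex_of_real)
    finally show ?thesis by (simp only: integral_power_jacobi_P[OF \<alpha>])
  qed
  moreover have "strict_mono (\<lambda>j. k + 2 * j :: nat)" by (simp add: strict_mono_def)
  moreover have "?a m = 0" if "m \<notin> range (\<lambda>j. k + 2 * j)" for m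
  proof (cases "k \<le> m")
    case True
    then obtain d where d: "m = k + d" using le_Suc_ex by blast
    with that have "odd d" by (auto elim!: evenE)
    then obtain j where "d = 2 * j + 1" by (auto elim: oddE)
    then show ?thesis unfolding a using moment_odd[of "\<alpha> + real k" j] \<alpha> d by simp
  next
    case False
    then show ?thesis unfolding a by simp
  qed
  ultimately have "(\<lambda>j. ?a (k + 2 * j)) sums
      (\<integral>y. exp (\<i> * of_real z * of_real y) * of_real (?P y) \<partial>weight_measure \<alpha>)"
    by (subst sums_mono_reindex) auto
  moreover have "?a (k + 2 * j) = \<kappa> * complex_of_real (b j)" for j
  proof -
    define p G where "p = 2 powr (\<alpha> + 1/2)" and "G = Gamma (real j + real k + \<alpha> + 3/2)"
    have pos: "p > 0" "G > 0" unfolding p_def G_def using \<alpha> by (auto intro!: Gamma_real_pos)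
    have ch: "real ((k + 2 * j) choose k) = fact (k + 2 * j) / (fact k * fact (2 * j))"
      by (subst binomial_fact) auto
    have mo: "moment (\<alpha> + real k) (2 * j) =
        fact (2 * j) / (4 ^ j * fact j) * sqrt pi * Gamma (real k + \<alpha> + 1) / G"
      unfolding G_def using \<alpha> by (subst moment_even) (auto simp: add_ac)
    have pw: "2 powr (2 * real j + real k + \<alpha> + 1/2) = 4 ^ j * 2 ^ k * p"
    proof -
      have "2 powr (2 * real j + real k + \<alpha> + 1/2) = 2 powr (real (2 * j + k) + (\<alpha> + 1/2))"
        by (simp add: add_ac)
      also have "\<dots> = 2 ^ (2 * j + k) * p"
        unfolding powr_add p_def by (simp only: powr_realpow)
      finally show ?thesis by (simp add: power_add power_mult)
    qed
    have zz: "z ^ (2 * j + k) = z ^ (k + 2 * j)" by (simp add: add.commute)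
    have R: "(-1) ^ j * z ^ (k + 2 * j) / fact (k + 2 * j) *
        (real ((k + 2 * j) choose k) / 2 ^ k * moment (\<alpha> + real k) (2 * j)) =
        sqrt pi * p * (Gamma (real k + \<alpha> + 1) / fact k) * b j"
      unfolding b_def G_def[symmetric] ch mo pw zz using pos by (simp add: mult_ac)
    have "(\<i> * of_real z) ^ (k + 2 * j) = \<i> ^ k * complex_of_real ((-1) ^ j * z ^ (k + 2 * j))"
    proof -
      have "\<i> ^ (k + 2 * j) = \<i> ^ k * complex_of_real ((-1) ^ j)"
        by (simp add: power_add power_mult)
      then show ?thesis by (simp only: power_mult_distrib of_real_mult of_real_power mult.assoc)
    qed
    then have "?a (k + 2 * j) = \<i> ^ k * of_real ((-1) ^ j * z ^ (k + 2 * j) / fact (k + 2 * j) *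
        (real ((k + 2 * j) choose k) / 2 ^ k * moment (\<alpha> + real k) (2 * j)))"
      unfolding a by simp
    also have "\<dots> = \<kappa> * of_real (b j)"
      unfolding R \<kappa>_def p_def by (simp only: of_real_mult mult.assoc)
    finally show ?thesis .
  qed
  ultimately show ?thesis by simp
qed

text \<open>Convergence of the Bessel series is not shown separately: dividing the convergent
  expansion of the integral by the nonzero constant \<open>\<kappa>\<close> gives both the sum and
  the summability.\<close>

lemma integral_exp_jacobi_P:
  fixes z :: real
  assumes \<alpha>: "\<alpha> > -1"
  shows "(\<integral>y. exp (\<i> * of_real z * of_real y) * of_real (jacobi_P k \<alpha> \<alpha> y) \<partial>weight_measure \<alpha>) =
    \<i> ^ k * of_real (sqrt pi * 2 powr (\<alpha> + 1/2) * (Gamma (real k + \<alpha> + 1) / fact k) * bessel_J_quot \<alpha> k z)"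
    (is "?I = _")
  and summable_bessel_J_quot: "summable (\<lambda>m. (-1) ^ m / (fact m * Gamma (real m + real k + \<alpha> + 3/2)) *
        (z ^ (2 * m + k) / 2 powr (2 * real m + real k + \<alpha> + 1/2)))" (is "summable ?b")
proof -
  define \<kappa> where "\<kappa> = \<i> ^ k * complex_of_real (sqrt pi * 2 powr (\<alpha> + 1/2) * (Gamma (real k + \<alpha> + 1) / fact k))"
  have "Gamma (real k + \<alpha> + 1) > 0" using \<alpha> by (intro Gamma_real_pos) auto
  then have \<kappa>: "\<kappa> \<noteq> 0" by (simp add: \<kappa>_def)
  have "(\<lambda>j. \<kappa> * complex_of_real (?b j)) sums ?I"
    unfolding \<kappa>_def by (rule integral_exp_jacobi_P_sums[OF \<alpha>])
  from sums_divide[OF this, of \<kappa>] have *: "(\<lambda>j. complex_of_real (?b j)) sums (?I / \<kappa>)"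
    using \<kappa> by simp
  from sums_Re[OF this] have b: "?b sums Re (?I / \<kappa>)" by (simp only: Re_complex_of_real)
  then show "summable ?b" by (rule sums_summable)
  from sums_of_real[OF b, where 'a = complex] * have "?I / \<kappa> = of_real (Re (?I / \<kappa>))"
    by (rule sums_unique2[symmetric])
  moreover have "Re (?I / \<kappa>) = bessel_J_quot \<alpha> k z"
    unfolding bessel_J_quot_def by (rule sums_unique[OF b])
  ultimately have "?I / \<kappa> = of_real (bessel_J_quot \<alpha> k z)" by (simp only:)
  moreover have "?I = ?I / \<kappa> * \<kappa>"
    using \<kappa> by (rule nonzero_mult_div_cancel_right[of \<kappa> ?I, unfolded times_divide_eq_left[symmetric], symmetric])
  ultimately have "?I = of_real (bessel_J_quot \<alpha> k z) * \<kappa>" by (simp only:)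
  then show "?I = \<i> ^ k * of_real (sqrt pi * 2 powr (\<alpha> + 1/2) * (Gamma (real k + \<alpha> + 1) / fact k) * bessel_J_quot \<alpha> k z)"
    unfolding \<kappa>_def by (simp only: of_real_mult mult_ac)
qed

lemma bessel_J_eq_quot:
  assumes \<alpha>: "\<alpha> > -1" and z: "z > 0"
  shows "bessel_J (real k + \<alpha> + 1/2) z = z powr (\<alpha> + 1/2) * bessel_J_quot \<alpha> k z"
proof -
  have "(-1) ^ m / fact m * rGamma (real m + (real k + \<alpha> + 1/2) + 1) * (z / 2) powr (2 * real m + (real k + \<alpha> + 1/2)) =
      z powr (\<alpha> + 1/2) * ((-1) ^ m / (fact m * Gamma (real m + real k + \<alpha> + 3/2)) *
        (z ^ (2 * m + k) / 2 powr (2 * real m + real k + \<alpha> + 1/2)))" for m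
  proof -
    have "z powr (2 * real m + (real k + \<alpha> + 1/2)) = z powr (real (2 * m + k) + (\<alpha> + 1/2))"
      by (simp add: add_ac)
    also have "\<dots> = z ^ (2 * m + k) * z powr (\<alpha> + 1/2)"
      unfolding powr_add using z by (simp only: powr_realpow)
    finally have "(z / 2) powr (2 * real m + (real k + \<alpha> + 1/2)) =
        z ^ (2 * m + k) * z powr (\<alpha> + 1/2) / 2 powr (2 * real m + real k + \<alpha> + 1/2)"
      using z by (simp add: powr_divide add.assoc)
    moreover have "rGamma (real m + (real k + \<alpha> + 1/2) + 1) = 1 / Gamma (real m + real k + \<alpha> + 3/2)"
      by (simp add: rGamma_inverse_Gamma inverse_eq_divide add_ac)
    ultimately show ?thesis by simp
  qed
  then have "bessel_J (real k + \<alpha> + 1/2) z = (\<Sum>m. z powr (\<alpha> + 1/2) * ((-1) ^ m / (fact m * Gamma (real m + real k + \<alpha> + 3/2)) *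
        (z ^ (2 * m + k) / 2 powr (2 * real m + real k + \<alpha> + 1/2))))"
    unfolding bessel_J_def by (intro suminf_cong)
  also have "\<dots> = z powr (\<alpha> + 1/2) * bessel_J_quot \<alpha> k z"
    unfolding bessel_J_quot_def by (rule suminf_mult[OF summable_bessel_J_quot[OF \<alpha>]])
  finally show ?thesis .
qed

lemma continuous_on_jacobi_normalized [continuous_intros]: "continuous_on S (jacobi_normalized \<alpha> k)"
  unfolding jacobi_normalized_def[abs_def] divide_inverse by (intro continuous_intros)

lemma jacobi_coeff_eq:
  assumes "continuous_on {-1..1} \<psi>"
  shows "jacobi_coeff \<alpha> \<psi> k = (\<integral>y. jacobi_normalized \<alpha> k y * \<psi> y \<partial>weight_measure \<alpha>)"
  unfolding jacobi_coeff_def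
  by (subst integral_weight) (use assms in \<open>auto intro!: borel_measurable_weight continuous_intros simp: mult_ac\<close>)

lemma integral_jacobi_normalized_square:
  assumes "\<alpha> > -1"
  shows "(\<integral>y. (jacobi_normalized \<alpha> k y)\<^sup>2 \<partial>weight_measure \<alpha>) = 1"
  using jacobi_h_pos[OF assms, of k]
  by (simp add: jacobi_normalized_def power_divide jacobi_h_eq[OF assms, of k, symmetric])

text \<open>The elementary |P| \<le> (1 + P^2) / 2 and the normalization of P suffice; what matters
  is that the bound does not depend on k.\<close>

lemma jacobi_coeff_bound:
  assumes \<alpha>: "\<alpha> > -1" and \<psi>: "continuous_on {-1..1} \<psi>" "\<And>y. y \<in> {-1..1} \<Longrightarrow> \<bar>\<psi> y\<bar> \<le> B"
  shows "\<bar>jacobi_coeff \<alpha> \<psi> k\<bar> \<le> B * (1 + moment \<alpha> 0) / 2"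
proof -
  let ?P = "jacobi_normalized \<alpha> k"
  have B: "0 \<le> B" using \<psi>(2)[of 0] abs_ge_zero[of "\<psi> 0"] by simp
  have *: "\<bar>?P y * \<psi> y\<bar> \<le> B / 2 * (1 + (?P y)\<^sup>2)" if "y \<in> {-1..1}" for y
  proof -
    have "0 \<le> (\<bar>?P y\<bar> - 1)\<^sup>2" by simp
    then have "\<bar>?P y\<bar> \<le> (1 + (?P y)\<^sup>2) / 2" by (simp add: power2_diff)
    then have "\<bar>?P y\<bar> * \<bar>\<psi> y\<bar> \<le> (1 + (?P y)\<^sup>2) / 2 * B"
      using \<psi>(2)[OF that] by (intro mult_mono) auto
    then show ?thesis by (simp add: abs_mult mult_ac)
  qed
  have "\<bar>jacobi_coeff \<alpha> \<psi> k\<bar> \<le> (\<integral>y. \<bar>?P y * \<psi> y\<bar> \<partial>weight_measure \<alpha>)"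
    unfolding jacobi_coeff_eq[OF \<psi>(1)] by (rule integral_abs_bound)
  also have "\<dots> \<le> (\<integral>y. B / 2 * (1 + (?P y)\<^sup>2) \<partial>weight_measure \<alpha>)"
    by (rule integral_mono) (use \<alpha> \<psi>(1) * in \<open>auto intro!: integrable_weight continuous_intros\<close>)
  also have "\<dots> = B / 2 * (moment \<alpha> 0 + 1)"
  proof -
    have "(\<integral>y. 1 + (?P y)\<^sup>2 \<partial>weight_measure \<alpha>) = moment \<alpha> 0 + 1"
      by (subst Bochner_Integration.integral_add)
         (use \<alpha> integral_jacobi_normalized_square[OF \<alpha>, of k] in
           \<open>auto intro!: integrable_weight continuous_intros simp: moment_def\<close>)
    then show ?thesis by (simp only: integral_mult_right_zero)
  qed
  finally show ?thesis by (simp add: add_ac)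
qed

abbreviation monomial_coeff :: "real \<Rightarrow> nat \<Rightarrow> nat \<Rightarrow> real" where
  "monomial_coeff \<alpha> m k \<equiv> jacobi_coeff \<alpha> (\<lambda>y. y ^ m) k"

lemma monomial_coeff_eq:
  assumes "\<alpha> > -1"
  shows "monomial_coeff \<alpha> m k =
    (if k \<le> m then real (m choose k) / 2 ^ k * moment (\<alpha> + real k) (m - k) else 0) / sqrt (jacobi_h \<alpha> k)"
  unfolding integral_power_jacobi_P[OF assms, symmetric]
  by (subst jacobi_coeff_eq) (auto intro!: continuous_intros simp: jacobi_normalized_def mult_ac)

lemma power_jacobi_expansion:
  assumes \<alpha>: "\<alpha> > -1"
  shows "x ^ m = (\<Sum>k\<le>m. monomial_coeff \<alpha> m k * jacobi_normalized \<alpha> k x)"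
proof -
  have "x ^ m = (\<Sum>k\<le>m. (\<integral>y. y ^ m * jacobi_P k \<alpha> \<alpha> y \<partial>weight_measure \<alpha>) / jacobi_h \<alpha> k * jacobi_P k \<alpha> \<alpha> x)"
    using jacobi_expansion[OF \<alpha>, of "monom 1 m" m x] by (simp add: poly_monom degree_monom_le)
  also have "\<dots> = (\<Sum>k\<le>m. monomial_coeff \<alpha> m k * jacobi_normalized \<alpha> k x)"
  proof (rule sum.cong[OF refl])
    fix k
    have "sqrt (jacobi_h \<alpha> k) * sqrt (jacobi_h \<alpha> k) = jacobi_h \<alpha> k"
      using jacobi_h_pos[OF \<alpha>, of k] by simp
    then show "(\<integral>y. y ^ m * jacobi_P k \<alpha> \<alpha> y \<partial>weight_measure \<alpha>) / jacobi_h \<alpha> k * jacobi_P k \<alpha> \<alpha> x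
        = monomial_coeff \<alpha> m k * jacobi_normalized \<alpha> k x"
      unfolding monomial_coeff_eq[OF \<alpha>] integral_power_jacobi_P[OF \<alpha>] jacobi_normalized_def by simp
  qed
  finally show ?thesis .
qed

lemma jacobi_normalized_at_1:
  assumes "\<alpha> > -1"
  shows "jacobi_normalized \<alpha> k 1 = Gamma (real k + \<alpha> + 1) / (fact k * Gamma (\<alpha> + 1)) / sqrt (jacobi_h \<alpha> k)"
    and "0 \<le> jacobi_normalized \<alpha> k 1"
proof -
  have "real k + \<alpha> + 1 \<notin> \<int>\<^sub>\<le>\<^sub>0" using assms by (auto elim!: nonpos_Ints_cases)
  then have "((real k + \<alpha>) gchoose k) = Gamma (real k + \<alpha> + 1) / (fact k * Gamma (\<alpha> + 1))"
    by (subst gbinomial_Gamma) (auto simp: add_ac)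
  then show "jacobi_normalized \<alpha> k 1 = Gamma (real k + \<alpha> + 1) / (fact k * Gamma (\<alpha> + 1)) / sqrt (jacobi_h \<alpha> k)"
    by (simp add: jacobi_normalized_def jacobi_P_at_1)
  show "0 \<le> jacobi_normalized \<alpha> k 1"
    using jacobi_P_at_1_pos[OF assms, of k \<alpha>] jacobi_h_pos[OF assms, of k] by (simp add: jacobi_normalized_def)
qed

text \<open>A bound on the coefficients alone would not do here, since the normalized values P_k(1)
  can grow with k; the product has to be estimated as a whole.\<close>

lemma monomial_coeff_at_1_bound:
  assumes \<alpha>: "\<alpha> > -1"
  shows "\<bar>monomial_coeff \<alpha> m k * jacobi_normalized \<alpha> k 1\<bar> \<le> 1"
proof -
  have nn: "0 \<le> monomial_coeff \<alpha> m k * jacobi_normalized \<alpha> k 1" for k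
    using \<alpha> moment_nonneg[of "\<alpha> + real k" "m - k"] jacobi_h_pos[OF \<alpha>, of k]
    by (intro mult_nonneg_nonneg jacobi_normalized_at_1) (auto simp: monomial_coeff_eq)
  show ?thesis
  proof (cases "k \<le> m")
    case True
    then have "monomial_coeff \<alpha> m k * jacobi_normalized \<alpha> k 1 \<le>
        (\<Sum>k\<le>m. monomial_coeff \<alpha> m k * jacobi_normalized \<alpha> k 1)"
      by (intro member_le_sum nn) auto
    also have "\<dots> = 1" using power_jacobi_expansion[OF \<alpha>, of 1 m] by simp
    finally show ?thesis using nn[of k] by simp
  qed (simp add: monomial_coeff_eq[OF \<alpha>])
qed

definition moment_of :: "real \<Rightarrow> (real \<Rightarrow> real) \<Rightarrow> nat \<Rightarrow> real" where
  "moment_of \<alpha> \<psi> m = (\<integral>y. y ^ m * \<psi> y \<partial>weight_measure \<alpha>)"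

text \<open>The sum is finite because y^m is itself a finite Jacobi sum. This makes the double sums
  below triangular.\<close>

lemma moment_of_eq_sum:
  assumes \<alpha>: "\<alpha> > -1" and \<psi>: "continuous_on {-1..1} \<psi>"
  shows "moment_of \<alpha> \<psi> m = (\<Sum>k\<le>m. monomial_coeff \<alpha> m k * jacobi_coeff \<alpha> \<psi> k)"
proof -
  have "moment_of \<alpha> \<psi> m = (\<integral>y. (\<Sum>k\<le>m. monomial_coeff \<alpha> m k * (jacobi_normalized \<alpha> k y * \<psi> y)) \<partial>weight_measure \<alpha>)"
    unfolding moment_of_def
  proof (rule Bochner_Integration.integral_cong[OF refl])
    fix y
    have "y ^ m * \<psi> y = (\<Sum>k\<le>m. monomial_coeff \<alpha> m k * jacobi_normalized \<alpha> k y) * \<psi> y"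
      using power_jacobi_expansion[OF \<alpha>, of y m] by (rule arg_cong)
    then show "y ^ m * \<psi> y = (\<Sum>k\<le>m. monomial_coeff \<alpha> m k * (jacobi_normalized \<alpha> k y * \<psi> y))"
      by (simp only: sum_distrib_right mult.assoc)
  qed
  also have "\<dots> = (\<Sum>k\<le>m. monomial_coeff \<alpha> m k * (\<integral>y. jacobi_normalized \<alpha> k y * \<psi> y \<partial>weight_measure \<alpha>))"
    by (subst Bochner_Integration.integral_sum)
       (use \<alpha> \<psi> in \<open>auto intro!: integrable_weight continuous_intros\<close>)
  finally show ?thesis by (simp add: jacobi_coeff_eq[OF \<psi>])
qed

lemma continuous_on_bounded_I:
  fixes \<psi> :: "real \<Rightarrow> real"
  assumes "continuous_on {-1..1} \<psi>"
  obtains B where "\<And>y. y \<in> {-1..1} \<Longrightarrow> \<bar>\<psi> y\<bar> \<le> B"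
proof -
  have "bounded (\<psi> ` {-1..1})"
    by (intro compact_imp_bounded compact_continuous_image assms) auto
  then obtain B where "\<forall>y\<in>{-1..1}. \<bar>\<psi> y\<bar> \<le> B" by (auto simp: bounded_iff)
  then show ?thesis using that by blast
qed

lemma moment_of_bound:
  assumes \<alpha>: "\<alpha> > -1" and \<psi>: "continuous_on {-1..1} \<psi>" "\<And>y. y \<in> {-1..1} \<Longrightarrow> \<bar>\<psi> y\<bar> \<le> B"
  shows "\<bar>moment_of \<alpha> \<psi> m\<bar> \<le> B * moment \<alpha> 0"
proof -
  have "\<bar>moment_of \<alpha> \<psi> m\<bar> \<le> (\<integral>y. \<bar>y ^ m * \<psi> y\<bar> \<partial>weight_measure \<alpha>)"
    unfolding moment_of_def by (rule integral_abs_bound)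
  also have "\<dots> \<le> (\<integral>y. B * y ^ 0 \<partial>weight_measure \<alpha>)"
  proof (rule integral_mono)
    fix y assume "y \<in> space (weight_measure \<alpha>)"
    then have "\<bar>y\<bar> ^ m * \<bar>\<psi> y\<bar> \<le> 1 * B"
      using \<psi>(2)[of y] by (intro mult_mono power_le_one) auto
    then show "\<bar>y ^ m * \<psi> y\<bar> \<le> B * y ^ 0" by (simp add: abs_mult power_abs)
  qed (use \<alpha> \<psi> in \<open>auto intro!: integrable_weight continuous_intros\<close>)
  finally show ?thesis by (simp add: moment_def mult.commute)
qed

lemma moment_of_complex:
  "(\<integral>y. of_real y ^ m * complex_of_real (\<psi> y) \<partial>weight_measure \<alpha>) = of_real (moment_of \<alpha> \<psi> m)"
  unfolding moment_of_def integral_complex_of_real[symmetric] by simp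

text \<open>The array is t(m,k) = <y^m, P_k> <\<psi>, P_k>. Its rows sum to the moments of \<psi>,
  which give the Fourier integral of \<psi>; its columns give the Fourier integrals of the P_k, that
  is, Bessel functions.\<close>

lemma fourier_jacobi_series:
  fixes z :: real
  assumes \<alpha>: "\<alpha> > -1" and \<psi>: "continuous_on {-1..1} \<psi>"
  shows "(\<lambda>k. \<i> ^ k * of_real (jacobi_coeff \<alpha> \<psi> k * (Gamma (real k + \<alpha> + 1) / (sqrt (jacobi_h \<alpha> k) * fact k)))
      * of_real (bessel_J_quot \<alpha> k z) * of_real (sqrt pi * 2 powr (\<alpha> + 1/2))) sums
    (\<integral>y. exp (\<i> * of_real z * of_real y) * of_real (\<psi> y) \<partial>weight_measure \<alpha>)"
proof -
  let ?M = "weight_measure \<alpha>"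
  let ?e = "\<lambda>m. (\<i> * of_real z) ^ m / fact m"
  let ?t = "\<lambda>m k. monomial_coeff \<alpha> m k * jacobi_coeff \<alpha> \<psi> k"
  obtain B where B: "\<And>y. y \<in> {-1..1} \<Longrightarrow> \<bar>\<psi> y\<bar> \<le> B"
    using continuous_on_bounded_I[OF \<psi>] by blast
  \<comment> \<open>Both factors are bounded uniformly in m and k; for the first one the sup bound
    of y^m on [-1,1] is 1.\<close>
  have "\<bar>?t m k\<bar> \<le> (1 * (1 + moment \<alpha> 0) / 2) * (B * (1 + moment \<alpha> 0) / 2)" for m k
    unfolding abs_mult using moment_nonneg[OF \<alpha>, of 0]
    by (intro mult_mono jacobi_coeff_bound \<alpha> \<psi> B continuous_intros)
       (auto simp: power_abs intro!: power_le_one)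
  moreover have "?t m k = 0" if "m < k" for m k
    using that by (simp add: monomial_coeff_eq[OF \<alpha>])
  ultimately have "(\<lambda>k. \<Sum>m. ?e m * of_real (?t m k)) sums (\<Sum>m. ?e m * of_real (\<Sum>k\<le>m. ?t m k))"
    by (intro sums_double_triangular summable_exp_linear)
  moreover have "(\<Sum>m. ?e m * of_real (\<Sum>k\<le>m. ?t m k)) =
      (\<integral>y. exp (\<i> * of_real z * of_real y) * of_real (\<psi> y) \<partial>?M)"
    unfolding moment_of_eq_sum[OF \<alpha> \<psi>, symmetric] moment_of_complex[symmetric]
    by (rule sums_unique[symmetric], rule exp_integral_weight_sums[OF \<alpha>, where B = B])
       (use \<psi> B in \<open>auto intro!: borel_measurable_weight continuous_intros\<close>)
  moreover have "(\<Sum>m. ?e m * of_real (?t m k)) =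
      \<i> ^ k * of_real (jacobi_coeff \<alpha> \<psi> k * (Gamma (real k + \<alpha> + 1) / (sqrt (jacobi_h \<alpha> k) * fact k)))
      * of_real (bessel_J_quot \<alpha> k z) * of_real (sqrt pi * 2 powr (\<alpha> + 1/2))" for k
  proof -
    let ?P = "jacobi_normalized \<alpha> k"
    obtain C where C: "\<And>y. y \<in> {-1..1} \<Longrightarrow> \<bar>?P y\<bar> \<le> C"
      using continuous_on_bounded_I[OF continuous_on_jacobi_normalized] by blast
    \<comment> \<open>The same number is the k-th Jacobi coefficient of y^m and the m-th moment of
      P_k. Read in the second way, the column sum is an exponential integral.\<close>
    have T: "monomial_coeff \<alpha> m k = moment_of \<alpha> ?P m" for m
      unfolding moment_of_def by (subst jacobi_coeff_eq) (auto intro!: continuous_intros simp: mult.commute)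
    have "(\<lambda>m. ?e m * of_real (moment_of \<alpha> ?P m)) sums
        (\<integral>y. exp (\<i> * of_real z * of_real y) * of_real (?P y) \<partial>?M)"
      unfolding moment_of_complex[symmetric]
      by (rule exp_integral_weight_sums[OF \<alpha>, where B = C])
         (use C in \<open>auto intro!: borel_measurable_weight continuous_intros\<close>)
    from sums_unique[OF sums_mult2[OF this, of "of_real (jacobi_coeff \<alpha> \<psi> k)"]]
    have "(\<Sum>m. ?e m * of_real (?t m k)) =
        (\<integral>y. exp (\<i> * of_real z * of_real y) * of_real (?P y) \<partial>?M) * of_real (jacobi_coeff \<alpha> \<psi> k)"
      by (simp add: T mult.assoc)
    also have "(\<integral>y. exp (\<i> * of_real z * of_real y) * of_real (?P y) \<partial>?M) =
        (\<integral>y. exp (\<i> * of_real z * of_real y) * of_real (jacobi_P k \<alpha> \<alpha> y) \<partial>?M) / of_real (sqrt (jacobi_h \<alpha> k))"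
      unfolding jacobi_normalized_def by simp
    finally show ?thesis
      unfolding integral_exp_jacobi_P[OF \<alpha>] by (simp add: mult_ac)
  qed
  ultimately show ?thesis by simp
qed

text \<open>The same array with P_k(1) in place of <\<psi>, P_k>: its rows sum to 1^m = 1, so the
  row side is the power series of \<psi> at 1, and its columns integrate that power series against
  P_k.\<close>

lemma jacobi_series_at_1:
  fixes e :: "nat \<Rightarrow> complex"
  assumes \<alpha>: "\<alpha> > -1" and e: "summable (\<lambda>m. norm (e m) * (real m + 1))"
    and \<psi>: "continuous_on {-1..1} \<psi>"
    and eq: "\<And>x. x \<in> {-1..1} \<Longrightarrow> (\<lambda>m. e m * of_real x ^ m) sums (of_real (\<psi> x))"
  shows "(\<lambda>k. jacobi_coeff \<alpha> \<psi> k * jacobi_normalized \<alpha> k 1) sums \<psi> 1"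
proof -
  let ?t = "\<lambda>m k. monomial_coeff \<alpha> m k * jacobi_normalized \<alpha> k 1"
  have e': "summable (\<lambda>m. norm (e m))"
    by (rule summable_comparison_test'[OF e, of 0]) (simp add: algebra_simps)
  have "(\<lambda>k. \<Sum>m. e m * of_real (?t m k)) sums (\<Sum>m. e m * of_real (\<Sum>k\<le>m. ?t m k))"
    by (intro sums_double_triangular[where C = 1] e monomial_coeff_at_1_bound \<alpha>)
       (simp add: monomial_coeff_eq[OF \<alpha>])
  moreover have "(\<Sum>m. e m * of_real (\<Sum>k\<le>m. ?t m k)) = of_real (\<psi> 1)"
    using eq[of 1] by (subst power_jacobi_expansion[OF \<alpha>, symmetric]) (simp add: sums_iff)
  moreover have "(\<Sum>m. e m * of_real (?t m k)) =
      of_real (jacobi_coeff \<alpha> \<psi> k * jacobi_normalized \<alpha> k 1)" for k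
  proof -
    let ?P = "jacobi_normalized \<alpha> k"
    obtain C where C: "\<And>y. y \<in> {-1..1} \<Longrightarrow> \<bar>?P y\<bar> \<le> C"
      using continuous_on_bounded_I[OF continuous_on_jacobi_normalized] by blast
    have T: "monomial_coeff \<alpha> m k = moment_of \<alpha> ?P m" for m
      unfolding moment_of_def by (subst jacobi_coeff_eq) (auto intro!: continuous_intros simp: mult.commute)
    have "(\<lambda>m. e m * of_real (moment_of \<alpha> ?P m)) sums
        (\<integral>y. (\<Sum>m. e m * of_real y ^ m) * of_real (?P y) \<partial>weight_measure \<alpha>)"
      unfolding moment_of_complex[symmetric]
      by (rule power_series_integral_weight[OF \<alpha> e', where B = C])
         (use C in \<open>auto intro!: borel_measurable_weight continuous_intros\<close>)
    also have "(\<integral>y. (\<Sum>m. e m * of_real y ^ m) * of_real (?P y) \<partial>weight_measure \<alpha>) =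
        (\<integral>y. complex_of_real (?P y * \<psi> y) \<partial>weight_measure \<alpha>)"
      using eq by (intro Bochner_Integration.integral_cong) (auto simp: sums_iff)
    also have "\<dots> = of_real (jacobi_coeff \<alpha> \<psi> k)"
      unfolding integral_complex_of_real jacobi_coeff_eq[OF \<psi>] ..
    finally have "(\<lambda>m. e m * of_real (moment_of \<alpha> ?P m)) sums of_real (jacobi_coeff \<alpha> \<psi> k)" .
    from sums_unique[OF sums_mult2[OF this, of "of_real (?P 1)"]]
    show ?thesis by (simp add: T mult.assoc)
  qed
  ultimately have "(\<lambda>k. complex_of_real (jacobi_coeff \<alpha> \<psi> k * jacobi_normalized \<alpha> k 1)) sums of_real (\<psi> 1)"
    by simp
  then show ?thesis by (simp only: sums_of_real_iff)
qed

section \<open>The differential equation\<close>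

text \<open>The second derivative is eliminated, so that nothing is claimed about it at the singular point 1.\<close>
definition sl_solution :: "real \<Rightarrow> real \<Rightarrow> real \<Rightarrow> (real \<Rightarrow> real) \<Rightarrow> (real \<Rightarrow> real) \<Rightarrow> bool" where
  "sl_solution c \<alpha> l f f1 \<longleftrightarrow>
     (\<forall>x\<in>{0..1}. (f has_real_derivative f1 x) (at x within {0..1})) \<and> continuous_on {0..1} f1 \<and>
     (\<forall>x\<in>{0<..<1}. (f1 has_real_derivative
        ((2 * \<alpha> + 2) * x * f1 x + (c\<^sup>2 * x\<^sup>2 - l) * f x) / (1 - x\<^sup>2)) (at x))"

lemma sl_solution_cont:
  assumes "sl_solution c \<alpha> l f f1"
  shows "continuous_on {0..1} f" "continuous_on {0..1} f1"
  using assms unfolding sl_solution_def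
  by (auto intro: DERIV_continuous_on)

lemma sl_solution_deriv:
  assumes "sl_solution c \<alpha> l f f1" "0 < x" "x < 1"
  shows "(f has_real_derivative f1 x) (at x)"
    and "(f1 has_real_derivative ((2 * \<alpha> + 2) * x * f1 x + (c\<^sup>2 * x\<^sup>2 - l) * f x) / (1 - x\<^sup>2)) (at x)"
proof -
  have "(f has_real_derivative f1 x) (at x within {0..1})"
    using assms by (simp add: sl_solution_def)
  then show "(f has_real_derivative f1 x) (at x)"
    using assms(2,3) by (simp add: at_within_Icc_at)
qed (use assms in \<open>simp add: sl_solution_def\<close>)

lemma sl_solution_linear:
  assumes "sl_solution c \<alpha> l f f1" "sl_solution c \<alpha> l g g1"
  shows "sl_solution c \<alpha> l (\<lambda>x. f x - a * g x) (\<lambda>x. f1 x - a * g1 x)"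
  unfolding sl_solution_def
proof (intro conjI ballI)
  fix x :: real assume x: "x \<in> {0<..<1}"
  have "((\<lambda>x. f1 x - a * g1 x) has_real_derivative
      ((2 * \<alpha> + 2) * x * f1 x + (c\<^sup>2 * x\<^sup>2 - l) * f x) / (1 - x\<^sup>2) -
      a * (((2 * \<alpha> + 2) * x * g1 x + (c\<^sup>2 * x\<^sup>2 - l) * g x) / (1 - x\<^sup>2))) (at x)"
    using sl_solution_deriv(2)[OF assms(1), of x] sl_solution_deriv(2)[OF assms(2), of x] x
    by (intro DERIV_diff DERIV_cmult) auto
  then show "((\<lambda>x. f1 x - a * g1 x) has_real_derivative
      ((2 * \<alpha> + 2) * x * (f1 x - a * g1 x) + (c\<^sup>2 * x\<^sup>2 - l) * (f x - a * g x)) / (1 - x\<^sup>2)) (at x)"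
    by (rule DERIV_cong) (simp add: diff_divide_distrib[symmetric] algebra_simps)
next
  fix x :: real assume "x \<in> {0..1}"
  then show "((\<lambda>x. f x - a * g x) has_real_derivative f1 x - a * g1 x) (at x within {0..1})"
    using assms unfolding sl_solution_def by (intro DERIV_diff DERIV_cmult) auto
qed (use assms in \<open>auto intro!: continuous_intros dest: sl_solution_cont\<close>)

text \<open>The self-adjoint form of the equation: the first-order term is absorbed by
  differentiating (1 - x^2)^(\<alpha>+1).\<close>

lemma sl_solution_flux_deriv:
  assumes "sl_solution c \<alpha> l f f1" and x: "0 < x" "x < 1"
  shows "((\<lambda>x. omega (\<alpha> + 1) x * f1 x) has_real_derivative (c\<^sup>2 * x\<^sup>2 - l) * f x * omega \<alpha> x) (at x)"
proof -
  let ?r = "((2 * \<alpha> + 2) * x * f1 x + (c\<^sup>2 * x\<^sup>2 - l) * f x) / (1 - x\<^sup>2)"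
  have "((\<lambda>x. omega (\<alpha> + 1) x * f1 x) has_real_derivative
      - 2 * (\<alpha> + 1) * x * omega \<alpha> x * f1 x + ?r * omega (\<alpha> + 1) x) (at x)"
    by (intro DERIV_mult has_real_derivative_omega_Suc sl_solution_deriv(2)[OF assms(1)]) (use x in auto)
  moreover have "1 - x\<^sup>2 \<noteq> 0"
    using x abs_square_less_1[of x] by simp
  then have "?r * omega (\<alpha> + 1) x = ((2 * \<alpha> + 2) * x * f1 x + (c\<^sup>2 * x\<^sup>2 - l) * f x) * omega \<alpha> x"
    using x by (simp add: omega_Suc)
  ultimately show ?thesis
    by (elim DERIV_cong) (simp add: algebra_simps)
qed

text \<open>Lagrange's identity. The leading coefficient (1 - x^2)^(\<alpha>+1) vanishes at 1, where
  f1 and g1 stay bounded, and equals 1 at 0; so only the Wronskian at 0 remains as boundary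
  term.\<close>

lemma sl_wronskian:
  assumes \<alpha>: "\<alpha> > -1" and f: "sl_solution c \<alpha> l f f1" and g: "sl_solution c \<alpha> k g g1"
  shows "f 0 * g1 0 - f1 0 * g 0 = (k - l) * (\<integral>x. indicator {0..1} x * (f x * g x) \<partial>weight_measure \<alpha>)"
proof -
  let ?p = "omega (\<alpha> + 1)"
  let ?F = "\<lambda>x. f x * (?p x * g1 x) - g x * (?p x * f1 x)"
  note cont = sl_solution_cont[OF f] sl_solution_cont[OF g] continuous_on_omega_Suc[OF \<alpha>, of "{0..1}"]
  have "(\<integral>x. indicator {0..1} x * ((l - k) * (f x * g x)) \<partial>weight_measure \<alpha>) = ?F 1 - ?F 0"
  proof (rule integral_weight_FTC[OF \<alpha>])
    fix x :: real assume x: "0 < x" "x < 1"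
    have "(?F has_real_derivative
        (f1 x * (?p x * g1 x) + (c\<^sup>2 * x\<^sup>2 - k) * g x * omega \<alpha> x * f x)
        - (g1 x * (?p x * f1 x) + (c\<^sup>2 * x\<^sup>2 - l) * f x * omega \<alpha> x * g x)) (at x)"
      by (intro DERIV_diff DERIV_mult sl_solution_flux_deriv[OF f] sl_solution_flux_deriv[OF g]
          sl_solution_deriv(1)[OF f] sl_solution_deriv(1)[OF g] x)
    then show "(?F has_real_derivative (l - k) * (f x * g x) * omega \<alpha> x) (at x)"
      by (rule DERIV_cong) (simp add: algebra_simps)
  qed (use cont in \<open>auto intro!: continuous_intros\<close>)
  also have "?F 1 - ?F 0 = - (f 0 * g1 0 - f1 0 * g 0)"
    by (simp add: omega_def)
  also have "(\<integral>x. indicator {0..1} x * ((l - k) * (f x * g x)) \<partial>weight_measure \<alpha>) =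
      (l - k) * (\<integral>x. indicator {0..1} x * (f x * g x) \<partial>weight_measure \<alpha>)"
    by (subst integral_mult_right_zero[symmetric]) (simp only: mult_ac)
  finally show ?thesis by (simp add: algebra_simps)
qed

text \<open>A Gronwall argument for E = f^2 + f1^2. It works on [0,b] for each b < 1, with a
  constant that blows up as b tends to the singular point 1; the value at 1 follows by
  continuity.\<close>

lemma sl_solution_unique:
  assumes f: "sl_solution c \<alpha> l f f1" and zero: "f 0 = 0" "f1 0 = 0" and x: "x \<in> {0..1}"
  shows "f x = 0"
proof -
  have *: "f b = 0" if b: "0 \<le> b" "b < 1" for b
  proof -
    \<comment> \<open>The summand 1 absorbs 2 f f1 \<le> E, the quotient absorbs 2 f1 f1'. On [0,b]
      the denominator 1 - x^2 of f1' is smallest at b.\<close>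
    define K where "K = 1 + (2 * \<bar>2 * \<alpha> + 2\<bar> + c\<^sup>2 + \<bar>l\<bar>) / (1 - b\<^sup>2)"
    define E where "E = (\<lambda>x. (f x)\<^sup>2 + (f1 x)\<^sup>2)"
    have b2: "0 < 1 - b\<^sup>2" using b by (simp add: abs_square_less_1)
    have sub: "{0..b} \<subseteq> {0..1}" using b by auto
    have "exp (- K * b) * E b \<le> exp (- K * 0) * E 0"
    proof (rule DERIV_nonpos_imp_decreasing_open[OF b(1)])
      show "continuous_on {0..b} (\<lambda>x. exp (- K * x) * E x)"
        unfolding E_def
        by (intro continuous_intros continuous_on_subset[OF _ sub] sl_solution_cont[OF f])
      fix x assume x: "0 < x" "x < b"
      define r where "r = ((2 * \<alpha> + 2) * x * f1 x + (c\<^sup>2 * x\<^sup>2 - l) * f x) / (1 - x\<^sup>2)"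
      have x1: "x < 1" using x b by simp
      have xb: "1 - b\<^sup>2 \<le> 1 - x\<^sup>2" using x b by (simp add: power_mono)
      have dE: "(E has_real_derivative 2 * f x * f1 x + 2 * f1 x * r) (at x)"
        unfolding E_def r_def
        by (rule derivative_eq_intros sl_solution_deriv[OF f] x x1 refl)+ simp
      have d: "((\<lambda>x. exp (- K * x) * E x) has_real_derivative
          exp (- K * x) * (2 * f x * f1 x + 2 * f1 x * r - K * E x)) (at x)"
        by (rule derivative_eq_intros dE refl)+ (simp add: algebra_simps)
      have "2 * f1 x * (r * (1 - x\<^sup>2)) \<le> (2 * \<bar>2 * \<alpha> + 2\<bar> + c\<^sup>2 + \<bar>l\<bar>) * E x"
      proof -
        have am: "2 * \<bar>f x\<bar> * \<bar>f1 x\<bar> \<le> E x"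
          unfolding E_def using sum_squares_bound[of "\<bar>f x\<bar>" "\<bar>f1 x\<bar>"] by simp
        have "\<bar>x\<bar> \<le> 1" "x\<^sup>2 \<le> 1" using x x1 by (auto simp: power_le_one)
        have "2 * f1 x * (r * (1 - x\<^sup>2)) = 2 * f1 x * ((2 * \<alpha> + 2) * x * f1 x + (c\<^sup>2 * x\<^sup>2 - l) * f x)"
          using b2 xb by (simp add: r_def)
        also have "\<dots> = 2 * (2 * \<alpha> + 2) * x * (f1 x)\<^sup>2 + (c\<^sup>2 * x\<^sup>2 - l) * (2 * f x * f1 x)"
          by (simp add: algebra_simps power2_eq_square)
        also have "2 * (2 * \<alpha> + 2) * x * (f1 x)\<^sup>2 \<le> 2 * \<bar>2 * \<alpha> + 2\<bar> * 1 * E x"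
        proof -
          have "(2 * \<alpha> + 2) * x \<le> \<bar>2 * \<alpha> + 2\<bar> * 1"
            using x x1 by (intro mult_mono) auto
          then have "(2 * \<alpha> + 2) * x * (f1 x)\<^sup>2 \<le> \<bar>2 * \<alpha> + 2\<bar> * 1 * E x"
            unfolding E_def by (rule mult_mono) auto
          then have "2 * ((2 * \<alpha> + 2) * x * (f1 x)\<^sup>2) \<le> 2 * (\<bar>2 * \<alpha> + 2\<bar> * 1 * E x)"
            by (rule mult_left_mono) simp
          then show ?thesis by (simp only: mult.assoc)
        qed
        also have "(c\<^sup>2 * x\<^sup>2 - l) * (2 * f x * f1 x) \<le> (c\<^sup>2 + \<bar>l\<bar>) * E x"
        proof -
          have "0 \<le> c\<^sup>2 * x\<^sup>2" by simp
          moreover have "c\<^sup>2 * x\<^sup>2 \<le> c\<^sup>2"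
            using \<open>x\<^sup>2 \<le> 1\<close> mult_left_mono[of "x\<^sup>2" 1 "c\<^sup>2"] by simp
          ultimately have "\<bar>c\<^sup>2 * x\<^sup>2 - l\<bar> \<le> c\<^sup>2 + \<bar>l\<bar>" by linarith
          then have "\<bar>c\<^sup>2 * x\<^sup>2 - l\<bar> * (2 * \<bar>f x\<bar> * \<bar>f1 x\<bar>) \<le> (c\<^sup>2 + \<bar>l\<bar>) * E x"
            by (intro mult_mono am) auto
          then show ?thesis using abs_ge_self[of "(c\<^sup>2 * x\<^sup>2 - l) * (2 * f x * f1 x)"]
            by (simp add: abs_mult)
        qed
        finally show ?thesis by (simp add: algebra_simps)
      qed
      then have "2 * f1 x * r \<le> (2 * \<bar>2 * \<alpha> + 2\<bar> + c\<^sup>2 + \<bar>l\<bar>) * E x / (1 - x\<^sup>2)"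
        using b2 xb by (simp add: pos_le_divide_eq mult.assoc)
      also have "\<dots> \<le> (2 * \<bar>2 * \<alpha> + 2\<bar> + c\<^sup>2 + \<bar>l\<bar>) * E x / (1 - b\<^sup>2)"
        by (rule divide_left_mono[OF xb]) (use b2 xb in \<open>auto simp: E_def\<close>)
      finally have "2 * f1 x * r \<le> (2 * \<bar>2 * \<alpha> + 2\<bar> + c\<^sup>2 + \<bar>l\<bar>) * E x / (1 - b\<^sup>2)" .
      moreover have "2 * f x * f1 x \<le> E x"
        unfolding E_def by (rule sum_squares_bound)
      ultimately have "2 * f x * f1 x + 2 * f1 x * r - K * E x \<le> 0"
        by (simp add: K_def algebra_simps)
      then show "\<exists>y. ((\<lambda>x. exp (- K * x) * E x) has_real_derivative y) (at x) \<and> y \<le> 0"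
        using d by (intro exI conjI) (auto simp: mult_le_0_iff)
    qed
    then have "E b \<le> 0" using zero by (simp add: E_def mult_le_0_iff)
    then show "f b = 0" by (simp add: E_def sum_power2_le_zero_iff)
  qed
  have "x \<in> closure {0..<1}" using x by simp
  then show ?thesis
    by (rule continuous_constant_on_closure[rotated -1])
       (use sl_solution_cont(1)[OF f] * in auto)
qed

text \<open>The power series in \<open>1 - x\<close> of the solution that is regular at 1.\<close>
fun frobenius_coeff :: "real \<Rightarrow> real \<Rightarrow> real \<Rightarrow> nat \<Rightarrow> real" where
  "frobenius_coeff c \<alpha> l 0 = 1"
| "frobenius_coeff c \<alpha> l (Suc j) =
     ((real j * (real j - 1) + (2 * \<alpha> + 2) * real j - l + c\<^sup>2) * frobenius_coeff c \<alpha> l j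
      - 2 * c\<^sup>2 * (if 1 \<le> j then frobenius_coeff c \<alpha> l (j - 1) else 0)
      + c\<^sup>2 * (if 2 \<le> j then frobenius_coeff c \<alpha> l (j - 2) else 0))
     / (2 * (real j + 1) * (real j + 1 + \<alpha>))"

lemma continuous_on_frobenius_coeff [continuous_intros]:
  "continuous_on S (\<lambda>l. frobenius_coeff c \<alpha> l j)"
proof (induction j rule: less_induct)
  case (less j)
  show ?case
  proof (cases j)
    case (Suc i)
    have "continuous_on S (\<lambda>l. if 1 \<le> i then frobenius_coeff c \<alpha> l (i - 1) else 0)"
      "continuous_on S (\<lambda>l. if 2 \<le> i then frobenius_coeff c \<alpha> l (i - 2) else 0)"
      "continuous_on S (\<lambda>l. frobenius_coeff c \<alpha> l i)"
      using less Suc by (cases "1 \<le> i"; cases "2 \<le> i"; auto)+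
    then show ?thesis unfolding Suc frobenius_coeff.simps(2) divide_inverse
      by (intro continuous_intros)
  qed simp
qed

text \<open>The leading terms of the recurrence have ratio 1/2, since the next singular point x = -1
  is at distance 2 from 1. Any rate strictly between 1/2 and 1 would serve: the radius of
  convergence must exceed 1 in order to reach beyond x = 0. Uniformity in l yields continuity in the
  spectral parameter.\<close>

lemma frobenius_coeff_bound:
  assumes \<alpha>: "\<alpha> > -1"
  obtains C where "\<And>j l. \<bar>l\<bar> \<le> L \<Longrightarrow> \<bar>frobenius_coeff c \<alpha> l j\<bar> \<le> C * (3/4) ^ j"
proof -
  let ?d = "frobenius_coeff c \<alpha>"
  \<comment> \<open>The lower-order terms: 4/3 and 16/9 are the cost of going back one and two
    indices at the rate 3/4.\<close>
  define K where "K = L + c\<^sup>2 + 2 * c\<^sup>2 * (4/3) + c\<^sup>2 * (16/9)"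
  \<comment> \<open>From J on, the surplus of 3/4 over 1/2 in the quadratic terms outweighs K, and
    the recurrence preserves the bound.\<close>
  obtain J where J0: "\<bar>\<alpha>\<bar> + 2 * \<bar>K\<bar> + 1 \<le> real J" by (rule real_arch_simple[THEN exE])
  have J: "real j * (real j - 1) + (2 * \<alpha> + 2) * real j + L + c\<^sup>2
      + 2 * c\<^sup>2 * (4/3) + c\<^sup>2 * (16/9) \<le> 3/4 * (2 * (real j + 1) * (real j + 1 + \<alpha>))" if "J \<le> j" for j
  proof -
    have j: "\<bar>\<alpha>\<bar> + 2 * \<bar>K\<bar> + 1 \<le> real j" using J0 that by linarith
    have "1 * (2 * \<bar>K\<bar> + 1) \<le> real j * (real j - \<alpha>)"
      using j by (intro mult_mono) auto
    then have R: "2 * \<bar>K\<bar> + 1 \<le> real j * (real j - \<alpha>)" by simp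
    have W: "0 \<le> 3/2 * (1 + \<alpha>)" using \<alpha> by simp
    have Q: "3/4 * (2 * (real j + 1) * (real j + 1 + \<alpha>)) - (real j * (real j - 1) + (2 * \<alpha> + 2) * real j + K)
        = real j * (real j - \<alpha>) / 2 + 2 * real j + 3/2 * (1 + \<alpha>) - K"
      by (simp add: algebra_simps add_divide_distrib diff_divide_distrib)
    have "P + K \<le> Q" if "2 * \<bar>K\<bar> + 1 \<le> R"
      "Q - (P + K) = R / 2 + 2 * real j + W - K" "0 \<le> W" for P Q R W
      using that of_nat_0_le_iff[of j, where 'a = real] by linarith
    from this[OF R Q W]
    have "real j * (real j - 1) + (2 * \<alpha> + 2) * real j + K
        \<le> 3/4 * (2 * (real j + 1) * (real j + 1 + \<alpha>))" .
    then show ?thesis unfolding K_def by (simp only: add.assoc)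
  qed
  have "\<exists>M. \<forall>l\<in>{-L..L}. \<bar>?d l j\<bar> \<le> M" for j
  proof -
    have "bounded ((\<lambda>l. ?d l j) ` {-L..L})"
      by (intro compact_imp_bounded compact_continuous_image continuous_intros) auto
    then show ?thesis by (auto simp: bounded_iff)
  qed
  then obtain M where M: "\<And>j l. l \<in> {-L..L} \<Longrightarrow> \<bar>?d l j\<bar> \<le> M j" by metis
  \<comment> \<open>The finitely many coefficients up to J are covered by brute force, rescaled by
    (4/3)^j.\<close>
  define C where "C = (\<Sum>j\<le>J. \<bar>M j\<bar> * (4/3) ^ j)"
  have C0: "0 \<le> C" unfolding C_def by (intro sum_nonneg) auto
  have "\<bar>?d l j\<bar> \<le> C * (3/4) ^ j" if l: "\<bar>l\<bar> \<le> L" for j l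
  proof (induction j rule: less_induct)
    case (less j)
    show ?case
    proof (cases "j \<le> J")
      case True
      have "\<bar>?d l j\<bar> \<le> \<bar>M j\<bar>" using M[of l j] l by (simp add: abs_le_iff)
      also have "\<dots> = \<bar>M j\<bar> * (4/3) ^ j * (3/4) ^ j"
        by (simp add: mult.assoc flip: power_mult_distrib)
      also have "\<dots> \<le> C * (3/4) ^ j"
        unfolding C_def using True by (intro mult_right_mono member_le_sum) auto
      finally show ?thesis .
    next
      case False
      then obtain i where i: "j = Suc i" "J \<le> i" by (cases j) auto
      define D where "D = C * (3/4) ^ i"
      have D0: "0 \<le> D" using C0 by (simp add: D_def)
      let ?q = "2 * (real i + 1) * (real i + 1 + \<alpha>)"
      have q: "0 < ?q" using \<alpha> by simp
      define a where "a = (if 1 \<le> i then ?d l (i - 1) else 0)"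
      define b where "b = (if 2 \<le> i then ?d l (i - 2) else 0)"
      have IH: "\<bar>?d l k\<bar> \<le> C * (3/4) ^ k" if "k \<le> i" for k
        using less[of k] that unfolding i(1) by simp
      have 0: "\<bar>?d l i\<bar> \<le> D" unfolding D_def by (rule IH) simp
      have 1: "\<bar>a\<bar> \<le> D * (4/3)"
      proof (cases i)
        case 0
        then show ?thesis using D0 by (simp add: a_def)
      next
        case (Suc k)
        then have "\<bar>a\<bar> \<le> C * (3/4) ^ k" using IH[of k] by (simp add: a_def)
        then show ?thesis unfolding D_def Suc by simp
      qed
      have 2: "\<bar>b\<bar> \<le> D * (16/9)"
      proof (cases "2 \<le> i")
        case True
        then obtain k where k: "i = Suc (Suc k)" by (metis add_2_eq_Suc le_Suc_ex)
        then have "\<bar>b\<bar> \<le> C * (3/4) ^ k" using IH[of k] by (simp add: b_def)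
        then show ?thesis unfolding D_def k by simp
      next
        case False
        then show ?thesis using D0 by (simp add: b_def)
      qed
      let ?p = "real i * (real i - 1) + (2 * \<alpha> + 2) * real i - l + c\<^sup>2"
      have "0 \<le> real i * (real i - 1)" by (cases i) auto
      moreover have "0 \<le> (2 * \<alpha> + 2) * real i" using \<alpha> by simp
      moreover have "0 \<le> c\<^sup>2" by simp
      ultimately have p: "\<bar>?p\<bar> \<le> real i * (real i - 1) + (2 * \<alpha> + 2) * real i + L + c\<^sup>2"
        using l by linarith
      have "\<bar>?p * ?d l i - 2 * c\<^sup>2 * a + c\<^sup>2 * b\<bar> \<le> \<bar>?p\<bar> * \<bar>?d l i\<bar> + 2 * c\<^sup>2 * \<bar>a\<bar> + c\<^sup>2 * \<bar>b\<bar>"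
      proof -
        have "\<bar>?p * ?d l i\<bar> = \<bar>?p\<bar> * \<bar>?d l i\<bar>" "\<bar>2 * c\<^sup>2 * a\<bar> = 2 * c\<^sup>2 * \<bar>a\<bar>" "\<bar>c\<^sup>2 * b\<bar> = c\<^sup>2 * \<bar>b\<bar>"
          unfolding abs_mult by simp_all
        then show ?thesis by linarith
      qed
      also have "\<dots> \<le> (real i * (real i - 1) + (2 * \<alpha> + 2) * real i + L + c\<^sup>2) * D
          + 2 * c\<^sup>2 * (D * (4/3)) + c\<^sup>2 * (D * (16/9))"
        using p by (intro add_mono mult_mono 0 1 2) auto
      also have "\<dots> = (real i * (real i - 1) + (2 * \<alpha> + 2) * real i + L + c\<^sup>2
          + 2 * c\<^sup>2 * (4/3) + c\<^sup>2 * (16/9)) * D"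
        by (simp add: algebra_simps)
      also have "\<dots> \<le> (3/4 * ?q) * D"
        by (rule mult_right_mono[OF J[OF i(2)] D0])
      also have "(3/4 * ?q) * D = (3/4 * D) * ?q" by simp
      finally have "\<bar>?p * ?d l i - 2 * c\<^sup>2 * a + c\<^sup>2 * b\<bar> / ?q \<le> 3/4 * D"
        using q by (simp only: pos_divide_le_eq)
      then have "\<bar>?d l j\<bar> \<le> 3/4 * D"
        unfolding i(1) frobenius_coeff.simps(2) abs_divide a_def[symmetric] b_def[symmetric] using q by (simp only: abs_of_pos)
      then show ?thesis by (simp add: D_def i)
    qed
  qed
  then show ?thesis using that by blast
qed

definition frobenius_fps :: "real \<Rightarrow> real \<Rightarrow> real \<Rightarrow> real fps" where
  "frobenius_fps c \<alpha> l = Abs_fps (frobenius_coeff c \<alpha> l)"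

lemma fps_conv_radius_frobenius:
  assumes "\<alpha> > -1"
  shows "ereal (4/3) \<le> fps_conv_radius (frobenius_fps c \<alpha> l)"
proof -
  obtain C where C: "\<And>j k. \<bar>k\<bar> \<le> \<bar>l\<bar> \<Longrightarrow> \<bar>frobenius_coeff c \<alpha> k j\<bar> \<le> C * (3/4) ^ j"
    using frobenius_coeff_bound[OF assms] by blast
  show ?thesis unfolding fps_conv_radius_def
  proof (rule conv_radius_geI_ex)
    fix r :: real assume r: "0 < r" "ereal r < ereal (4/3)"
    have "summable (\<lambda>n. C * (3/4 * r) ^ n)"
      using r by (intro summable_mult summable_geometric) auto
    then have "summable (\<lambda>n. frobenius_coeff c \<alpha> l n * r ^ n)"
    proof (rule summable_comparison_test'[where N = 0])
      fix n
      have "\<bar>frobenius_coeff c \<alpha> l n\<bar> * r ^ n \<le> C * (3/4) ^ n * r ^ n"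
        using r C[of l n] by (intro mult_right_mono) auto
      then show "norm (frobenius_coeff c \<alpha> l n * r ^ n) \<le> C * (3/4 * r) ^ n"
        using r by (simp only: power_mult_distrib) (simp add: abs_mult mult.assoc)
    qed
    then show "\<exists>z. norm z = r \<and> summable (\<lambda>n. fps_nth (frobenius_fps c \<alpha> l) n * z ^ n)"
      using r by (intro exI[of _ r]) (simp add: frobenius_fps_def)
  qed
qed

text \<open>The differential equation in the variable s = 1 - x, where 1 - x^2 = 2 s - s^2 and d/dx
  = - d/ds. Comparing coefficients of s^n gives the recurrence, whose denominator is nonzero for
  \<alpha> > -1.\<close>

lemma frobenius_fps_ode:
  fixes c \<alpha> l :: real
  assumes "\<alpha> > -1"
  defines "F \<equiv> frobenius_fps c \<alpha> l"
  shows "fps_const 2 * (fps_X * fps_deriv (fps_deriv F)) - fps_X * (fps_X * fps_deriv (fps_deriv F))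
    + fps_const (2 * \<alpha> + 2) * fps_deriv F - fps_const (2 * \<alpha> + 2) * (fps_X * fps_deriv F)
    + fps_const (l - c\<^sup>2) * F + fps_const (2 * c\<^sup>2) * (fps_X * F) - fps_const (c\<^sup>2) * (fps_X * (fps_X * F)) = 0"
    (is "?lhs = 0")
proof (rule fps_ext)
  fix n
  let ?d = "frobenius_coeff c \<alpha> l"
  let ?q = "2 * (real n + 1) * (real n + 1 + \<alpha>)"
  let ?a = "if 1 \<le> n then ?d (n - 1) else 0" and ?b = "if 2 \<le> n then ?d (n - 2) else 0"
  have q: "?q \<noteq> 0" using assms(1) by auto
  have rec: "?d (Suc n) * ?q = (real n * (real n - 1) + (2 * \<alpha> + 2) * real n - l + c\<^sup>2) * ?d n
      - 2 * c\<^sup>2 * ?a + c\<^sup>2 * ?b"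
    unfolding frobenius_coeff.simps(2) by (subst nonzero_eq_divide_eq[OF q, symmetric]) (rule refl)
  have F: "fps_nth F j = ?d j" for j by (simp add: F_def frobenius_fps_def)
  have n1: "fps_nth (fps_X * fps_deriv (fps_deriv F)) n = real n * (real n + 1) * ?d (Suc n)"
    by (cases n) (simp_all add: F mult_ac del: frobenius_coeff.simps)
  have n2: "fps_nth (fps_X * (fps_X * fps_deriv (fps_deriv F))) n = real n * (real n - 1) * ?d n"
  proof (cases n)
    case (Suc m)
    then show ?thesis by (cases m) (simp_all add: F mult_ac del: frobenius_coeff.simps)
  qed simp
  have n3: "fps_nth (fps_deriv F) n = (real n + 1) * ?d (Suc n)"
    by (simp add: F del: frobenius_coeff.simps)
  have n4: "fps_nth (fps_X * fps_deriv F) n = real n * ?d n"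
    by (cases n) (simp_all add: F del: frobenius_coeff.simps)
  have n5: "fps_nth (fps_X * F) n = ?a"
    by (cases n) (simp_all add: F del: frobenius_coeff.simps)
  have n6: "fps_nth (fps_X * (fps_X * F)) n = ?b"
  proof (cases n)
    case (Suc m)
    then show ?thesis by (cases m) (simp_all add: F del: frobenius_coeff.simps)
  qed simp
  have "fps_nth ?lhs n = 2 * (real n * (real n + 1) * ?d (Suc n)) - real n * (real n - 1) * ?d n
      + (2 * \<alpha> + 2) * ((real n + 1) * ?d (Suc n)) - (2 * \<alpha> + 2) * (real n * ?d n)
      + (l - c\<^sup>2) * ?d n + 2 * c\<^sup>2 * ?a - c\<^sup>2 * ?b"
    by (simp only: fps_add_nth fps_sub_nth fps_mult_left_const_nth n1 n2 n3 n4 n5 n6 F)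
  also have "\<dots> = ?d (Suc n) * ?q - ((real n * (real n - 1) + (2 * \<alpha> + 2) * real n - l + c\<^sup>2) * ?d n
      - 2 * c\<^sup>2 * ?a + c\<^sup>2 * ?b)"
    by (simp only: algebra_simps)
  also have "\<dots> = 0" unfolding rec by simp
  finally show "fps_nth ?lhs n = fps_nth 0 n" by simp
qed

section \<open>The solution regular at 1 and its dependence on the spectral parameter\<close>

definition sl_u :: "real \<Rightarrow> real \<Rightarrow> real \<Rightarrow> real \<Rightarrow> real" where
  "sl_u c \<alpha> l x = eval_fps (frobenius_fps c \<alpha> l) (1 - x)"

definition sl_u1 :: "real \<Rightarrow> real \<Rightarrow> real \<Rightarrow> real \<Rightarrow> real" where
  "sl_u1 c \<alpha> l x = - eval_fps (fps_deriv (frobenius_fps c \<alpha> l)) (1 - x)"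

definition sl_u2 :: "real \<Rightarrow> real \<Rightarrow> real \<Rightarrow> real \<Rightarrow> real" where
  "sl_u2 c \<alpha> l x = eval_fps (fps_deriv (fps_deriv (frobenius_fps c \<alpha> l))) (1 - x)"

lemma less_conv_radius_deriv:
  "ereal r < fps_conv_radius f \<Longrightarrow> ereal r < fps_conv_radius (fps_deriv f)" for f :: "real fps"
  by (rule less_le_trans[OF _ fps_conv_radius_deriv])

lemma less_conv_radius_frobenius:
  fixes r :: real
  assumes "\<alpha> > -1" "\<bar>r\<bar> < 4/3"
  shows "ereal (norm r) < fps_conv_radius (frobenius_fps c \<alpha> l)"
  using assms(2) by (intro less_le_trans[OF _ fps_conv_radius_frobenius[OF assms(1)]]) simp

lemma sl_u_at_1 [simp]: "sl_u c \<alpha> l 1 = 1"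
  by (simp add: sl_u_def eval_fps_at_0 frobenius_fps_def)

text \<open>The range of x contains 0 and 1 in its interior, so the derivatives are two-sided at
  both; the reflected gluing at 0 relies on this.\<close>

lemma sl_u_deriv:
  assumes \<alpha>: "\<alpha> > -1" and x: "\<bar>1 - x\<bar> < 4/3"
  shows "(sl_u c \<alpha> l has_real_derivative sl_u1 c \<alpha> l x) (at x)"
    and "(sl_u1 c \<alpha> l has_real_derivative sl_u2 c \<alpha> l x) (at x)"
    and "isCont (sl_u2 c \<alpha> l) x"
proof -
  let ?F = "frobenius_fps c \<alpha> l"
  have r: "ereal (norm (1 - x)) < fps_conv_radius ?F" by (rule less_conv_radius_frobenius[OF \<alpha> x])
  note r1 = less_conv_radius_deriv[OF r] and r2 = less_conv_radius_deriv[OF less_conv_radius_deriv[OF r]]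
  have g: "((\<lambda>x. 1 - x) has_real_derivative -1) (at x)" by (auto intro!: derivative_eq_intros)
  show "(sl_u c \<alpha> l has_real_derivative sl_u1 c \<alpha> l x) (at x)"
    using DERIV_chain2[OF has_field_derivative_eval_fps[OF r] g] by (simp add: sl_u_def[abs_def] sl_u1_def)
  show "(sl_u1 c \<alpha> l has_real_derivative sl_u2 c \<alpha> l x) (at x)"
    using DERIV_minus[OF DERIV_chain2[OF has_field_derivative_eval_fps[OF r1] g]]
    by (simp add: sl_u1_def[abs_def] sl_u2_def)
  show "isCont (sl_u2 c \<alpha> l) x"
    using DERIV_isCont[OF DERIV_chain2[OF has_field_derivative_eval_fps[OF r2] g]]
    by (simp add: sl_u2_def[abs_def])
qed

lemma sl_u_ode:
  assumes \<alpha>: "\<alpha> > -1" and x: "\<bar>1 - x\<bar> < 4/3"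
  shows "(1 - x\<^sup>2) * sl_u2 c \<alpha> l x - (2 * \<alpha> + 2) * x * sl_u1 c \<alpha> l x + (l - c\<^sup>2 * x\<^sup>2) * sl_u c \<alpha> l x = 0"
proof -
  let ?F = "frobenius_fps c \<alpha> l" and ?s = "1 - x"
  have r: "ereal (norm ?s) < fps_conv_radius ?F" by (rule less_conv_radius_frobenius[OF \<alpha> x])
  note r1 = less_conv_radius_deriv[OF r]
  note r2 = less_conv_radius_deriv[OF r1]
  have X: "ereal (norm ?s) < fps_conv_radius (fps_X * f)" if "ereal (norm ?s) < fps_conv_radius f" for f :: "real fps"
    using that by (intro less_le_trans[OF _ fps_conv_radius_mult]) simp
  have C: "ereal (norm ?s) < fps_conv_radius (fps_const a * f)" if "ereal (norm ?s) < fps_conv_radius f" for f :: "real fps" and a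
    using that by (intro less_le_trans[OF _ fps_conv_radius_mult]) simp
  have A: "ereal (norm ?s) < fps_conv_radius (f + g)" if "ereal (norm ?s) < fps_conv_radius f" "ereal (norm ?s) < fps_conv_radius g" for f g :: "real fps"
    using that by (intro less_le_trans[OF _ fps_conv_radius_add]) simp
  have D: "ereal (norm ?s) < fps_conv_radius (f - g)" if "ereal (norm ?s) < fps_conv_radius f" "ereal (norm ?s) < fps_conv_radius g" for f g :: "real fps"
    using that by (intro less_le_trans[OF _ fps_conv_radius_diff]) simp
  have eX: "eval_fps (fps_X * f) ?s = ?s * eval_fps f ?s" if "ereal (norm ?s) < fps_conv_radius f" for f :: "real fps"
    using that by (subst eval_fps_mult) auto
  have eC: "eval_fps (fps_const a * f) ?s = a * eval_fps f ?s" if "ereal (norm ?s) < fps_conv_radius f" for f :: "real fps" and a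
    using that by (subst eval_fps_mult) auto
  have "eval_fps (fps_const 2 * (fps_X * fps_deriv (fps_deriv ?F)) - fps_X * (fps_X * fps_deriv (fps_deriv ?F))
    + fps_const (2 * \<alpha> + 2) * fps_deriv ?F - fps_const (2 * \<alpha> + 2) * (fps_X * fps_deriv ?F)
    + fps_const (l - c\<^sup>2) * ?F + fps_const (2 * c\<^sup>2) * (fps_X * ?F) - fps_const (c\<^sup>2) * (fps_X * (fps_X * ?F))) ?s = 0"
    unfolding frobenius_fps_ode[OF \<alpha>] by simp
  then have "2 * (?s * sl_u2 c \<alpha> l x) - ?s * (?s * sl_u2 c \<alpha> l x) + (2 * \<alpha> + 2) * - sl_u1 c \<alpha> l x
    - (2 * \<alpha> + 2) * (?s * - sl_u1 c \<alpha> l x) + (l - c\<^sup>2) * sl_u c \<alpha> l x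
    + 2 * c\<^sup>2 * (?s * sl_u c \<alpha> l x) - c\<^sup>2 * (?s * (?s * sl_u c \<alpha> l x)) = 0"
    by (simp only: eval_fps_add eval_fps_diff A C D X r r1 r2 eX eC sl_u_def sl_u1_def sl_u2_def minus_minus)
  then show ?thesis by (simp only: power2_eq_square algebra_simps)
qed

lemma sl_solution_u:
  assumes \<alpha>: "\<alpha> > -1"
  shows "sl_solution c \<alpha> l (sl_u c \<alpha> l) (sl_u1 c \<alpha> l)"
  unfolding sl_solution_def
proof (intro conjI ballI)
  fix x :: real assume x: "x \<in> {0<..<1}"
  then have "1 - x\<^sup>2 \<noteq> 0" using abs_square_less_1[of x] by simp
  then have "sl_u2 c \<alpha> l x = ((2 * \<alpha> + 2) * x * sl_u1 c \<alpha> l x + (c\<^sup>2 * x\<^sup>2 - l) * sl_u c \<alpha> l x) / (1 - x\<^sup>2)"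
    using sl_u_ode[OF \<alpha>, of x c l] x
    by (subst nonzero_eq_divide_eq) (auto simp: algebra_simps)
  then show "(sl_u1 c \<alpha> l has_real_derivative
      ((2 * \<alpha> + 2) * x * sl_u1 c \<alpha> l x + (c\<^sup>2 * x\<^sup>2 - l) * sl_u c \<alpha> l x) / (1 - x\<^sup>2)) (at x)"
    using sl_u_deriv(2)[OF \<alpha>, of x c l] x by simp
next
  fix x :: real assume "x \<in> {0..1}"
  then show "(sl_u c \<alpha> l has_real_derivative sl_u1 c \<alpha> l x) (at x within {0..1})"
    by (intro has_field_derivative_at_within[OF sl_u_deriv(1)[OF \<alpha>]]) auto
next
  show "continuous_on {0..1} (sl_u1 c \<alpha> l)"
    by (intro DERIV_continuous_on[where D = "sl_u2 c \<alpha> l"] has_field_derivative_at_within[OF sl_u_deriv(2)[OF \<alpha>]]) auto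
qed

lemma continuous_on_suminf_bounded:
  fixes f :: "nat \<Rightarrow> real \<Rightarrow> real"
  assumes "\<And>n. continuous_on S (f n)" "\<And>n x. x \<in> S \<Longrightarrow> \<bar>f n x\<bar> \<le> M n" "summable M"
  shows "continuous_on S (\<lambda>x. \<Sum>n. f n x)"
proof (rule uniform_limit_theorem)
  show "uniform_limit S (\<lambda>n x. \<Sum>i<n. f i x) (\<lambda>x. \<Sum>n. f n x) sequentially"
    by (rule Weierstrass_m_test[OF _ assms(3)]) (use assms(2) in auto)
  show "\<forall>\<^sub>F n in sequentially. continuous_on S (\<lambda>x. \<Sum>i<n. f i x)"
    by (intro always_eventually allI continuous_intros assms(1))
qed simp

lemma sl_u_bound:
  assumes \<alpha>: "\<alpha> > -1"
  obtains K where "\<And>l x. \<bar>l\<bar> \<le> L \<Longrightarrow> x \<in> {0..1} \<Longrightarrow> \<bar>sl_u c \<alpha> l x\<bar> \<le> K"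
proof -
  obtain C where C: "\<And>j l. \<bar>l\<bar> \<le> L \<Longrightarrow> \<bar>frobenius_coeff c \<alpha> l j\<bar> \<le> C * (3/4) ^ j"
    using frobenius_coeff_bound[OF \<alpha>] by blast
  have summ: "summable (\<lambda>j. C * (3/4) ^ j)" by (intro summable_mult summable_geometric) simp
  have "\<bar>sl_u c \<alpha> l x\<bar> \<le> (\<Sum>j. C * (3/4) ^ j)" if l: "\<bar>l\<bar> \<le> L" and x: "x \<in> {0..1}" for l x
  proof -
    have le: "norm (frobenius_coeff c \<alpha> l j * (1 - x) ^ j) \<le> C * (3/4) ^ j" for j
    proof -
      have "\<bar>frobenius_coeff c \<alpha> l j\<bar> * (1 - x) ^ j \<le> C * (3/4) ^ j * 1"
        using C[OF l, of j] x order.trans[OF abs_ge_zero C[OF l, of j]]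
        by (intro mult_mono power_le_one) auto
      then show ?thesis using x by (simp add: abs_mult)
    qed
    then have "norm (\<Sum>j. frobenius_coeff c \<alpha> l j * (1 - x) ^ j) \<le> (\<Sum>j. C * (3/4) ^ j)"
      by (rule norm_suminf_le) fact
    then show ?thesis by (simp add: sl_u_def eval_fps_def frobenius_fps_def)
  qed
  then show ?thesis using that by blast
qed

lemma continuous_sl_u:
  assumes \<alpha>: "\<alpha> > -1" and x: "x \<in> {0..1}"
  shows "continuous_on UNIV (\<lambda>l. sl_u c \<alpha> l x)"
    and "continuous_on UNIV (\<lambda>l. sl_u1 c \<alpha> l x)"
proof -
  have *: "continuous_on UNIV f" if "\<And>L. continuous_on {-L..L} f" for f :: "real \<Rightarrow> real"
  proof -
    have "isCont f l" for l
      by (rule continuous_on_interior[OF that[of "\<bar>l\<bar> + 1"]]) auto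
    then show ?thesis by (simp add: continuous_at_imp_continuous_on)
  qed
  have pw: "(1 - x) ^ j \<le> 1" "0 \<le> (1 - x) ^ j" for j using x by (auto intro!: power_le_one)
  show "continuous_on UNIV (\<lambda>l. sl_u c \<alpha> l x)"
  proof (rule *)
    fix L
    obtain C where C: "\<And>j l. \<bar>l\<bar> \<le> L \<Longrightarrow> \<bar>frobenius_coeff c \<alpha> l j\<bar> \<le> C * (3/4) ^ j"
      using frobenius_coeff_bound[OF \<alpha>] by blast
    have "continuous_on {-L..L} (\<lambda>l. \<Sum>j. frobenius_coeff c \<alpha> l j * (1 - x) ^ j)"
    proof (rule continuous_on_suminf_bounded)
      show "summable (\<lambda>j. C * (3/4) ^ j)" by (intro summable_mult summable_geometric) simp
      fix j l assume "l \<in> {-L..L}"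
      then have "\<bar>l\<bar> \<le> L" by auto
      then have "\<bar>frobenius_coeff c \<alpha> l j\<bar> * (1 - x) ^ j \<le> C * (3/4) ^ j * 1"
        using C[of l j] pw order.trans[OF abs_ge_zero C[of l j]] by (intro mult_mono) auto
      then show "\<bar>frobenius_coeff c \<alpha> l j * (1 - x) ^ j\<bar> \<le> C * (3/4) ^ j"
        using pw(2)[of j] by (simp only: abs_mult abs_of_nonneg mult_1_right)
    qed (intro continuous_intros)
    then show "continuous_on {-L..L} (\<lambda>l. sl_u c \<alpha> l x)"
      by (simp add: sl_u_def eval_fps_def frobenius_fps_def)
  qed
  show "continuous_on UNIV (\<lambda>l. sl_u1 c \<alpha> l x)"
  proof (rule *)
    fix L
    obtain C where C: "\<And>j l. \<bar>l\<bar> \<le> L \<Longrightarrow> \<bar>frobenius_coeff c \<alpha> l j\<bar> \<le> C * (3/4) ^ j"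
      using frobenius_coeff_bound[OF \<alpha>] by blast
    have "continuous_on {-L..L} (\<lambda>l. \<Sum>j. real (Suc j) * frobenius_coeff c \<alpha> l (Suc j) * (1 - x) ^ j)"
    proof (rule continuous_on_suminf_bounded)
      \<comment> \<open>\<open>diffs (\<lambda>_. 1) j\<close> is j + 1, so this is the termwise
        derivative of a geometric series.\<close>
      have "summable (\<lambda>j. diffs (\<lambda>_. 1) j * (3/4::real) ^ j)"
        by (rule termdiff_converges[where K = 1]) (auto intro: summable_geometric)
      then show "summable (\<lambda>j. C * (3/4) * (diffs (\<lambda>_. 1) j * (3/4::real) ^ j))"
        by (rule summable_mult)
      fix j l assume "l \<in> {-L..L}"
      then have l: "\<bar>l\<bar> \<le> L" by auto
      have "\<bar>frobenius_coeff c \<alpha> l (Suc j)\<bar> * (1 - x) ^ j \<le> C * (3/4) ^ Suc j * 1"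
        using C[OF l, of "Suc j"] pw order.trans[OF abs_ge_zero C[OF l, of "Suc j"]] by (intro mult_mono) auto
      then have "real (Suc j) * (\<bar>frobenius_coeff c \<alpha> l (Suc j)\<bar> * (1 - x) ^ j) \<le> real (Suc j) * (C * (3/4) ^ Suc j * 1)"
        by (rule mult_left_mono) simp
      also have "\<dots> = C * (3/4) * (diffs (\<lambda>_. 1) j * (3/4::real) ^ j)" by (simp add: diffs_def)
      finally show "\<bar>real (Suc j) * frobenius_coeff c \<alpha> l (Suc j) * (1 - x) ^ j\<bar> \<le> C * (3/4) * (diffs (\<lambda>_. 1) j * (3/4::real) ^ j)"
        using pw(2)[of j] by (simp only: abs_mult abs_of_nonneg abs_of_nat mult.assoc)
    qed (intro continuous_intros)
    then show "continuous_on {-L..L} (\<lambda>l. sl_u1 c \<alpha> l x)"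
      by (auto simp: sl_u1_def eval_fps_def frobenius_fps_def intro!: continuous_intros
          simp del: frobenius_coeff.simps of_nat_Suc)
  qed
qed

lemma sl_u_wronskian:
  assumes "\<alpha> > -1"
  shows "sl_u c \<alpha> l 0 * sl_u1 c \<alpha> k 0 - sl_u1 c \<alpha> l 0 * sl_u c \<alpha> k 0 =
    (k - l) * (\<integral>x. indicator {0..1} x * (sl_u c \<alpha> l x * sl_u c \<alpha> k x) \<partial>weight_measure \<alpha>)"
  by (rule sl_wronskian[where c = c]) (intro sl_solution_u assms)+

text \<open>At k = l the integrand is a square that is positive near x = 1, and dominated
  convergence makes the integral continuous in k. Together with the Wronskian identity this fixes
  the local sense of rotation.\<close>

lemma sl_u_overlap_pos:
  assumes \<alpha>: "\<alpha> > -1"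
  shows "\<forall>\<^sub>F k in at l. 0 < (\<integral>x. indicator {0..1} x * (sl_u c \<alpha> l x * sl_u c \<alpha> k x) \<partial>weight_measure \<alpha>)"
proof -
  let ?M = "weight_measure \<alpha>"
  let ?g = "\<lambda>k x. indicator {0..1} x * (sl_u c \<alpha> l x * sl_u c \<alpha> k x)"
  obtain K where K: "\<And>k x. \<bar>k\<bar> \<le> \<bar>l\<bar> + 1 \<Longrightarrow> x \<in> {0..1} \<Longrightarrow> \<bar>sl_u c \<alpha> k x\<bar> \<le> K"
    using sl_u_bound[OF \<alpha>] by blast
  note contu = sl_solution_cont(1)[OF sl_solution_u[OF \<alpha>]]
  have meas: "?g k \<in> borel_measurable ?M" for k
  proof -
    have "(\<lambda>x. indicator {0..1} x *\<^sub>R (sl_u c \<alpha> l x * sl_u c \<alpha> k x)) \<in> borel_measurable borel"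
      by (rule borel_measurable_continuous_on_indicator) (auto intro!: continuous_intros contu)
    then show ?thesis
      unfolding borel_measurable_weight_iff by (intro measurable_restrict_space1) simp
  qed
  have bnd: "norm (?g k x) \<le> K * K" if "\<bar>k\<bar> \<le> \<bar>l\<bar> + 1" for k x
  proof (cases "x \<in> {0..1}")
    case True
    have "\<bar>sl_u c \<alpha> l x\<bar> * \<bar>sl_u c \<alpha> k x\<bar> \<le> K * K"
      using K[of l x] K[OF that True] True order.trans[OF abs_ge_zero K[OF that True]] by (intro mult_mono) auto
    then show ?thesis using True by (simp add: abs_mult)
  qed (simp add: zero_le_square)
  have int: "integrable ?M (?g k)" if "\<bar>k\<bar> \<le> \<bar>l\<bar> + 1" for k
    by (rule integrable_weight_bounded[OF \<alpha> meas bnd[OF that]])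
  have pos: "0 < integral\<^sup>L ?M (?g l)"
  proof -
    have "isCont (sl_u c \<alpha> l) 1"
      using sl_u_deriv(1)[OF \<alpha>, of 1] by (intro DERIV_isCont) auto
    then have "\<forall>\<^sub>F x in at 1. 0 < sl_u c \<alpha> l x"
      by (intro order_tendstoD) (auto simp: isCont_def)
    then obtain d where d: "d > 0" "\<And>y. y \<noteq> 1 \<Longrightarrow> dist y 1 < d \<Longrightarrow> 0 < sl_u c \<alpha> l y"
      by (auto simp: eventually_at)
    show ?thesis
    proof (rule integral_weight_pos[OF int])
      show "max 0 (1 - d) < (1::real)" using d by auto
      fix y assume y: "max 0 (1 - d) < y" "y < 1"
      then have "0 < sl_u c \<alpha> l y" using d(2)[of y] by (auto simp: dist_real_def)
      then show "0 < ?g l y" using y by auto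
    qed (auto simp: zero_le_square)
  qed
  have "isCont (\<lambda>k. integral\<^sup>L ?M (?g k)) l"
    unfolding continuous_at_sequentially
  proof (intro allI impI)
    fix s :: "nat \<Rightarrow> real" assume s: "s \<longlonglongrightarrow> l"
    then have "\<forall>\<^sub>F n in sequentially. dist (s n) l < 1" by (rule tendstoD) simp
    then obtain N where N: "\<And>n. N \<le> n \<Longrightarrow> dist (s n) l < 1"
      by (auto simp: eventually_at_top_linorder)
    have sN: "\<bar>s (n + N)\<bar> \<le> \<bar>l\<bar> + 1" for n using N[of "n + N"] by (auto simp: dist_real_def)
    interpret finite_measure ?M by (rule finite_measure_weight[OF \<alpha>])
    have "(\<lambda>n. integral\<^sup>L ?M (?g (s (n + N)))) \<longlonglongrightarrow> integral\<^sup>L ?M (?g l)"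
    proof (rule integral_dominated_convergence[where w = "\<lambda>_. K * K"])
      show "AE x in ?M. (\<lambda>n. ?g (s (n + N)) x) \<longlonglongrightarrow> ?g l x"
      proof (rule AE_I2)
        fix x
        show "(\<lambda>n. ?g (s (n + N)) x) \<longlonglongrightarrow> ?g l x"
        proof (cases "x \<in> {0..1}")
          case True
          have "(\<lambda>n. sl_u c \<alpha> (s (n + N)) x) \<longlonglongrightarrow> sl_u c \<alpha> l x"
            using continuous_on_tendsto_compose[OF continuous_sl_u(1)[OF \<alpha> True, of c] LIMSEQ_ignore_initial_segment[OF s, of N]]
            by simp
          then show ?thesis by (intro tendsto_intros)
        qed simp
      qed
    qed (use meas bnd sN in auto)
    then show "((\<lambda>k. integral\<^sup>L ?M (?g k)) \<circ> s) \<longlonglongrightarrow> integral\<^sup>L ?M (?g l)"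
      unfolding o_def by (rule LIMSEQ_offset)
  qed
  then show ?thesis
    using pos by (intro order_tendstoD) (auto simp: isCont_def)
qed

text \<open>For l \<le> 0 the product \<open>?Q\<close> of flux and solution is nondecreasing and
  vanishes at 1, so u u' \<le> 0. Hence u^2 decreases to its value 1 at x = 1, and u cannot have a
  zero in [0,1].\<close>

lemma sl_u_nonpos:
  assumes \<alpha>: "\<alpha> > -1" and c: "c > 0" and l: "l \<le> 0"
  shows "0 < sl_u c \<alpha> l 0" "sl_u1 c \<alpha> l 0 < 0"
proof -
  let ?u = "sl_u c \<alpha> l" and ?u1 = "sl_u1 c \<alpha> l" and ?p = "omega (\<alpha> + 1)"
  note sol = sl_solution_u[OF \<alpha>, of c l]
  note cont = sl_solution_cont[OF sol]
  let ?Q = "\<lambda>x. ?p x * ?u1 x * ?u x"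
  let ?Q' = "\<lambda>x. (c\<^sup>2 * x\<^sup>2 - l) * ?u x * omega \<alpha> x * ?u x + ?u1 x * (?p x * ?u1 x)"
  have Q: "(?Q has_real_derivative ?Q' x) (at x)" if "0 < x" "x < 1" for x
    by (intro DERIV_mult sl_solution_flux_deriv[OF sol] sl_solution_deriv(1)[OF sol] that)
  have Q': "?Q' x = (c\<^sup>2 * x\<^sup>2 - l) * ((?u x)\<^sup>2 * omega \<alpha> x) + (?u1 x)\<^sup>2 * ?p x" for x
    by (simp add: power2_eq_square algebra_simps)
  have Q'0: "0 \<le> ?Q' x" for x
    unfolding Q' using l by (intro add_nonneg_nonneg mult_nonneg_nonneg omega_nonneg) (auto intro: order.trans)
  have contQ: "continuous_on {0..1} ?Q"
    by (intro continuous_intros cont continuous_on_omega_Suc[OF \<alpha>]) auto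
  have mono: "?Q x \<le> ?Q y" if "0 \<le> x" "x \<le> y" "y \<le> 1" for x y
  proof (rule DERIV_nonneg_imp_increasing_open[OF that(2)])
    show "continuous_on {x..y} ?Q" using that by (intro continuous_on_subset[OF contQ]) auto
    fix z assume "x < z" "z < y"
    then show "\<exists>d. (?Q has_real_derivative d) (at z) \<and> 0 \<le> d"
      using Q[of z] Q'0[of z] that by auto
  qed
  have Q1: "?Q x \<le> 0" if "0 \<le> x" "x \<le> 1" for x
    using mono[of x 1] that by simp
  have uu: "?u1 x * ?u x \<le> 0" if "0 \<le> x" "x < 1" for x
    using Q1[of x] that omega_pos[of x "\<alpha> + 1"] by (simp add: mult.assoc mult_le_0_iff)
  have sq: "1 \<le> (?u x)\<^sup>2" if x: "0 \<le> x" "x \<le> 1" for x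
  proof -
    have "(?u 1)\<^sup>2 \<le> (?u x)\<^sup>2"
    proof (rule DERIV_nonpos_imp_decreasing_open[OF x(2)])
      show "continuous_on {x..1} (\<lambda>x. (?u x)\<^sup>2)"
        using x by (intro continuous_intros continuous_on_subset[OF cont(1)]) auto
      fix z assume z: "x < z" "z < 1"
      have "((\<lambda>x. (?u x)\<^sup>2) has_real_derivative 2 * (?u1 z * ?u z)) (at z)"
        using z x by (auto intro!: derivative_eq_intros sl_solution_deriv(1)[OF sol])
      then show "\<exists>y. ((\<lambda>x. (?u x)\<^sup>2) has_real_derivative y) (at z) \<and> y \<le> 0"
        using uu[of z] z x by (intro exI[of _ "2 * (?u1 z * ?u z)"] conjI) (auto simp: mult.commute)
    qed
    then show ?thesis by simp
  qed
  show u0: "0 < ?u 0"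
  proof (rule ccontr)
    assume "\<not> 0 < ?u 0"
    then have "\<exists>x\<ge>0. x \<le> 1 \<and> ?u x = 0"
      by (intro IVT' cont) auto
    then show False using sq by force
  qed
  \<comment> \<open>Otherwise \<open>?Q\<close> would vanish on all of [0,1]. The point 1/2 is just
    an interior point: there c^2 x^2 > 0 makes the derivative of \<open>?Q\<close> positive even for
    l = 0.\<close>
  have "?Q 0 \<noteq> 0"
  proof
    assume Q0: "?Q 0 = 0"
    have zero: "?Q x = 0" if "0 \<le> x" "x \<le> 1" for x
      using mono[of 0 x] Q1[of x] Q0 that by simp
    have "(?Q has_real_derivative 0) (at (1/2))"
    proof (rule has_field_derivative_transform_within_open[OF DERIV_const])
      show "0 = ?Q x" if "x \<in> {0<..<1}" for x using zero[of x] that by auto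
    qed auto
    from DERIV_unique[OF this Q[of "1/2"]] have "?Q' (1/2) = 0" by simp
    moreover have "0 < c\<^sup>2 * (1/2)\<^sup>2" using c by simp
    then have "0 < c\<^sup>2 * (1/2)\<^sup>2 - l" using l by linarith
    then have "0 < (c\<^sup>2 * (1/2)\<^sup>2 - l) * ((?u (1/2))\<^sup>2 * omega \<alpha> (1/2))"
      using sq[of "1/2"] omega_pos[of "1/2" \<alpha>] by (intro mult_pos_pos) auto
    moreover have "0 \<le> (?u1 (1/2))\<^sup>2 * ?p (1/2)" by (simp add: omega_nonneg)
    ultimately show False unfolding Q' by linarith
  qed
  then show "?u1 0 < 0" using uu[of 0] u0 by (auto simp: mult_le_0_iff)
qed

section \<open>Eigenvalues as zeros of the product of the data at 0\<close>

lemma gpswf_eigenfunction_deriv: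
  assumes "gpswf_eigenfunction c \<alpha> l \<phi>" and x: "x \<in> {-1..1}"
  shows "(\<phi> has_real_derivative deriv_I \<phi> x) (at x within {-1..1})"
    and "(deriv_I \<phi> has_real_derivative deriv_I (deriv_I \<phi>) x) (at x within {-1..1})"
    and "(1 - x\<^sup>2) * deriv_I (deriv_I \<phi>) x - (2 * \<alpha> + 2) * x * deriv_I \<phi> x + (l - c\<^sup>2 * x\<^sup>2) * \<phi> x = 0"
proof -
  have *: "(f has_real_derivative deriv_I f x) (at x within {-1..1})"
    if "f differentiable_on {-1..1}" for f
    using that x unfolding deriv_I_def has_real_derivative_iff_has_vector_derivative
    by (simp add: differentiable_on_def vector_derivative_works)
  show "(\<phi> has_real_derivative deriv_I \<phi> x) (at x within {-1..1})"
    "(deriv_I \<phi> has_real_derivative deriv_I (deriv_I \<phi>) x) (at x within {-1..1})"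
    using assms by (auto intro!: * simp: gpswf_eigenfunction_def C2_I_def)
  have "- gpswf_operator c \<alpha> \<phi> x = l * \<phi> x"
    using assms by (auto simp: gpswf_eigenfunction_def)
  then show "(1 - x\<^sup>2) * deriv_I (deriv_I \<phi>) x - (2 * \<alpha> + 2) * x * deriv_I \<phi> x + (l - c\<^sup>2 * x\<^sup>2) * \<phi> x = 0"
    by (simp add: gpswf_operator_def algebra_simps)
qed

lemma gpswf_eigenfunction_deriv_interior:
  assumes "gpswf_eigenfunction c \<alpha> l \<phi>" and x: "-1 < x" "x < 1"
  shows "(\<phi> has_real_derivative deriv_I \<phi> x) (at x)"
    and "(deriv_I \<phi> has_real_derivative
      ((2 * \<alpha> + 2) * x * deriv_I \<phi> x + (c\<^sup>2 * x\<^sup>2 - l) * \<phi> x) / (1 - x\<^sup>2)) (at x)"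
proof -
  have I: "x \<in> {-1..1}" and at: "at x within {-1..1} = at x"
    using x by (auto simp: at_within_Icc_at)
  note d = gpswf_eigenfunction_deriv[OF assms(1) I]
  show "(\<phi> has_real_derivative deriv_I \<phi> x) (at x)" using d(1) at by simp
  have "1 - x\<^sup>2 \<noteq> 0" using x abs_square_less_1[of x] by auto
  then have "deriv_I (deriv_I \<phi>) x = ((2 * \<alpha> + 2) * x * deriv_I \<phi> x + (c\<^sup>2 * x\<^sup>2 - l) * \<phi> x) / (1 - x\<^sup>2)"
    using d(3) by (subst nonzero_eq_divide_eq) (auto simp: algebra_simps)
  then show "(deriv_I \<phi> has_real_derivative
      ((2 * \<alpha> + 2) * x * deriv_I \<phi> x + (c\<^sup>2 * x\<^sup>2 - l) * \<phi> x) / (1 - x\<^sup>2)) (at x)"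
    using d(2) at by simp
qed

lemma gpswf_eigenfunction_cont:
  assumes "gpswf_eigenfunction c \<alpha> l \<phi>"
  shows "continuous_on {-1..1} \<phi>" "continuous_on {-1..1} (deriv_I \<phi>)"
  by (rule DERIV_continuous_on gpswf_eigenfunction_deriv[OF assms] | assumption)+

text \<open>The operator is invariant under x \<mapsto> -x, so the half interval [-1,0] is covered
  by the reflected function on [0,1].\<close>

lemma sl_solution_eigenfunction:
  assumes "gpswf_eigenfunction c \<alpha> l \<phi>"
  shows "sl_solution c \<alpha> l \<phi> (deriv_I \<phi>)"
    and "sl_solution c \<alpha> l (\<lambda>x. \<phi> (- x)) (\<lambda>x. - deriv_I \<phi> (- x))"
proof -
  note d = gpswf_eigenfunction_deriv[OF assms] and di = gpswf_eigenfunction_deriv_interior[OF assms]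
  note cont = gpswf_eigenfunction_cont[OF assms]
  show "sl_solution c \<alpha> l \<phi> (deriv_I \<phi>)"
    unfolding sl_solution_def
  proof (intro conjI ballI)
    fix x :: real assume "x \<in> {0..1}"
    then show "(\<phi> has_real_derivative deriv_I \<phi> x) (at x within {0..1})"
      by (intro DERIV_subset[OF d(1)]) auto
  qed (use di(2) in \<open>auto intro: continuous_on_subset[OF cont(2)]\<close>)
  have neg: "uminus ` {0..1::real} \<subseteq> {-1..1}" by auto
  show "sl_solution c \<alpha> l (\<lambda>x. \<phi> (- x)) (\<lambda>x. - deriv_I \<phi> (- x))"
    unfolding sl_solution_def
  proof (intro conjI ballI)
    fix x :: real assume x: "x \<in> {0..1}"
    have "(\<phi> has_real_derivative deriv_I \<phi> (- x)) (at (- x) within uminus ` {0..1})"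
      by (rule DERIV_subset[OF d(1) neg]) (use x in auto)
    moreover have "(uminus has_real_derivative -1) (at x within {0..1})"
      by (auto intro!: derivative_eq_intros)
    ultimately have "(\<phi> \<circ> uminus has_real_derivative deriv_I \<phi> (- x) * -1) (at x within {0..1})"
      by (rule DERIV_image_chain)
    then show "((\<lambda>x. \<phi> (- x)) has_real_derivative - deriv_I \<phi> (- x)) (at x within {0..1})"
      by (simp add: o_def)
  next
    have "continuous_on (uminus ` {0..1}) (deriv_I \<phi>)"
      by (rule continuous_on_subset[OF cont(2) neg])
    then show "continuous_on {0..1} (\<lambda>x. - deriv_I \<phi> (- x))"
      by (intro continuous_intros continuous_on_compose2[of "uminus ` {0..1}" "deriv_I \<phi>" "{0..1}" uminus]) auto
  next
    fix x :: real assume x: "x \<in> {0<..<1}"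
    then have mx: "-1 < - x" "- x < 1" by auto
    have m: "(uminus has_real_derivative -1) (at x)" by (auto intro!: derivative_eq_intros)
    from DERIV_minus[OF DERIV_chain2[OF di(2)[OF mx] m]]
    show "((\<lambda>x. - deriv_I \<phi> (- x)) has_real_derivative
        ((2 * \<alpha> + 2) * x * - deriv_I \<phi> (- x) + (c\<^sup>2 * x\<^sup>2 - l) * \<phi> (- x)) / (1 - x\<^sup>2)) (at x)"
      by (rule DERIV_cong) simp
  qed
qed

text \<open>Both \<phi> and its reflection are regular at 1, so their Wronskians with u vanish:
  \<phi>(0) u'(0) = \<phi>'(0) u(0) and the same with opposite sign. Hence both products are zero,
  one of u(0), u'(0) is zero, and the data of \<phi> are a multiple of those of u; the factor is
  read off at x = 1.\<close>

lemma eigenfunction_at_0: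
  assumes \<alpha>: "\<alpha> > -1" and ef: "gpswf_eigenfunction c \<alpha> l \<phi>"
  shows "sl_u c \<alpha> l 0 * sl_u1 c \<alpha> l 0 = 0" "\<phi> 1 \<noteq> 0"
    "\<phi> 0 = \<phi> 1 * sl_u c \<alpha> l 0" "deriv_I \<phi> 0 = \<phi> 1 * sl_u1 c \<alpha> l 0"
proof -
  let ?A = "sl_u c \<alpha> l 0" and ?B = "sl_u1 c \<alpha> l 0" and ?p = "\<phi> 0" and ?q = "deriv_I \<phi> 0"
  note s1 = sl_solution_eigenfunction(1)[OF ef] and s2 = sl_solution_eigenfunction(2)[OF ef]
    and su = sl_solution_u[OF \<alpha>, of c l]
  have "?p * ?B - ?q * ?A = 0" "?p * ?B + ?q * ?A = 0"
    using sl_wronskian[OF \<alpha> s1 su] sl_wronskian[OF \<alpha> s2 su] by simp_all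
  then have pB: "?p * ?B = 0" and qA: "?q * ?A = 0" by linarith+
  have pq: "?p \<noteq> 0 \<or> ?q \<noteq> 0"
  proof (rule ccontr)
    assume "\<not> (?p \<noteq> 0 \<or> ?q \<noteq> 0)"
    then have "\<phi> x = 0" "\<phi> (- x) = 0" if "x \<in> {0..1}" for x
      using sl_solution_unique[OF s1 _ _ that] sl_solution_unique[OF s2 _ _ that] by auto
    then have "\<phi> x = 0" if "x \<in> {-1..1}" for x
      using that \<open>\<And>x. x \<in> {0..1} \<Longrightarrow> \<phi> (- x) = 0\<close>[of "- x"] by (cases "0 \<le> x") auto
    then show False using ef by (auto simp: gpswf_eigenfunction_def)
  qed
  \<comment> \<open>If both data vanished, uniqueness would give u(1) = 0, against the normalization
    u(1) = 1.\<close>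
  have AB: "?A \<noteq> 0 \<or> ?B \<noteq> 0"
    using sl_solution_unique[OF su, of 1] by auto
  show "?A * ?B = 0" using pB qA pq by auto
  obtain r where r: "?p = r * ?A" "?q = r * ?B"
  proof (cases "?A = 0")
    case True
    then have "?p = 0" using AB pB by simp
    then show ?thesis using that[of "?q / ?B"] True AB by simp
  next
    case False
    then have "?q = 0" using qA by simp
    then have "?B = 0" using pq pB by simp
    then show ?thesis using that[of "?p / ?A"] False \<open>?q = 0\<close> by simp
  qed
  have "\<phi> 1 - r * sl_u c \<alpha> l 1 = 0"
    by (rule sl_solution_unique[OF sl_solution_linear[OF s1 su, of r]]) (use r in auto)
  then have r1: "r = \<phi> 1" by simp
  show "?p = \<phi> 1 * ?A" "?q = \<phi> 1 * ?B" using r r1 by auto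
  then show "\<phi> 1 \<noteq> 0" using pq by auto
qed

lemma has_real_derivative_glue:
  fixes f g :: "real \<Rightarrow> real"
  assumes f: "\<And>x. x \<in> {0..1} \<Longrightarrow> (f has_real_derivative f' x) (at x)"
    and g: "\<And>x. x \<in> {-1..0} \<Longrightarrow> (g has_real_derivative g' x) (at x)"
    and eq: "f 0 = g 0" "f' 0 = g' 0" and x: "x \<in> {-1..1}"
  shows "((\<lambda>x. if 0 \<le> x then f x else g x) has_real_derivative (if 0 \<le> x then f' x else g' x)) (at x)"
    (is "(?h has_real_derivative _) _")
proof -
  consider "x > 0" | "x < 0" | "x = 0" by linarith
  then show ?thesis
  proof cases
    case 1
    have "(?h has_real_derivative f' x) (at x)"
      by (rule has_field_derivative_transform_within_open[where f = f and S = "{0<..}"])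
         (use 1 x f in auto)
    then show ?thesis using 1 by simp
  next
    case 2
    have "(?h has_real_derivative g' x) (at x)"
      by (rule has_field_derivative_transform_within_open[where f = g and S = "{..<0}"])
         (use 2 x g in auto)
    then show ?thesis using 2 by simp
  next
    case 3
    have "((\<lambda>y. (?h y - ?h 0) / (y - 0)) \<longlongrightarrow> f' 0) (at_right 0)"
    proof (rule Lim_transform_eventually)
      show "((\<lambda>y. (f y - f 0) / (y - 0)) \<longlongrightarrow> f' 0) (at_right 0)"
        using has_field_derivative_at_within[OF f[of 0], of "{0<..}"] by (simp add: has_field_derivative_iff)
      show "\<forall>\<^sub>F y in at_right 0. (f y - f 0) / (y - 0) = (?h y - ?h 0) / (y - 0)"
        by (auto simp: eventually_at_filter)
    qed
    moreover have "((\<lambda>y. (?h y - ?h 0) / (y - 0)) \<longlongrightarrow> f' 0) (at_left 0)"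
    proof (rule Lim_transform_eventually)
      show "((\<lambda>y. (g y - g 0) / (y - 0)) \<longlongrightarrow> f' 0) (at_left 0)"
        using has_field_derivative_at_within[OF g[of 0], of "{..<0}"] eq by (simp add: has_field_derivative_iff)
      show "\<forall>\<^sub>F y in at_left 0. (g y - g 0) / (y - 0) = (?h y - ?h 0) / (y - 0)"
        using eq by (auto simp: eventually_at_filter)
    qed
    ultimately show ?thesis unfolding 3 has_field_derivative_iff
      by (simp add: filterlim_split_at)
  qed
qed

lemma deriv_I_eq:
  assumes "\<And>x. x \<in> {-1..1} \<Longrightarrow> (f has_real_derivative f' x) (at x within {-1..1})" "x \<in> {-1..1}"
  shows "deriv_I f x = f' x"
  unfolding deriv_I_def
  by (rule vector_derivative_within_closed_interval)
     (use assms in \<open>auto simp flip: has_real_derivative_iff_has_vector_derivative\<close>)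

text \<open>The regular solution on [0,1] is continued evenly if u'(0) = 0 and oddly if u(0) = 0;
  \<open>\<sigma>\<close> is the sign of the reflection.\<close>

lemma eigenfunction_exists:
  assumes \<alpha>: "\<alpha> > -1" and AB: "sl_u c \<alpha> l 0 * sl_u1 c \<alpha> l 0 = 0"
  shows "\<exists>\<phi>. gpswf_eigenfunction c \<alpha> l \<phi>"
proof -
  define \<sigma> :: real where "\<sigma> = (if sl_u1 c \<alpha> l 0 = 0 then 1 else -1)"
  let ?u = "sl_u c \<alpha> l" and ?u1 = "sl_u1 c \<alpha> l" and ?u2 = "sl_u2 c \<alpha> l"
  define \<phi> where "\<phi> = (\<lambda>x. if 0 \<le> x then ?u x else \<sigma> * ?u (- x))"
  define \<phi>1 where "\<phi>1 = (\<lambda>x. if 0 \<le> x then ?u1 x else - (\<sigma> * ?u1 (- x)))"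
  define \<phi>2 where "\<phi>2 = (\<lambda>x. if 0 \<le> x then ?u2 x else \<sigma> * ?u2 (- x))"
  note du = sl_u_deriv[OF \<alpha>] and ode = sl_u_ode[OF \<alpha>]
  have m: "(uminus has_real_derivative -1) (at x)" for x :: real
    by (auto intro!: derivative_eq_intros)
  \<comment> \<open>The equation at 0 makes the second derivatives match as well: in the odd case
    u(0) = 0 forces u''(0) = 0.\<close>
  have u20: "?u2 0 = - l * ?u 0" using ode[of 0 c l] by simp
  have glue0: "?u 0 = \<sigma> * ?u (- 0)" "?u1 0 = - (\<sigma> * ?u1 (- 0))" "?u2 0 = \<sigma> * ?u2 (- 0)"
    using AB by (auto simp: \<sigma>_def u20)
  have d1: "(\<phi> has_real_derivative \<phi>1 x) (at x)" if "x \<in> {-1..1}" for x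
    unfolding \<phi>_def \<phi>1_def
  proof (rule has_real_derivative_glue[where f = ?u and f' = ?u1
        and g = "\<lambda>x. \<sigma> * ?u (- x)" and g' = "\<lambda>x. - (\<sigma> * ?u1 (- x))"])
    fix x :: real assume x: "x \<in> {-1..0}"
    have "((\<lambda>x. \<sigma> * ?u (- x)) has_real_derivative \<sigma> * (?u1 (- x) * -1)) (at x)"
      by (intro DERIV_cmult DERIV_chain2[OF du(1) m]) (use x in auto)
    then show "((\<lambda>x. \<sigma> * ?u (- x)) has_real_derivative - (\<sigma> * ?u1 (- x))) (at x)" by simp
  qed (use glue0 that in \<open>auto intro!: du\<close>)
  have d2: "(\<phi>1 has_real_derivative \<phi>2 x) (at x)" if "x \<in> {-1..1}" for x
    unfolding \<phi>1_def \<phi>2_def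
  proof (rule has_real_derivative_glue[where f = ?u1 and f' = ?u2
        and g = "\<lambda>x. - (\<sigma> * ?u1 (- x))" and g' = "\<lambda>x. \<sigma> * ?u2 (- x)"])
    fix x :: real assume x: "x \<in> {-1..0}"
    have "((\<lambda>x. - (\<sigma> * ?u1 (- x))) has_real_derivative - (\<sigma> * (?u2 (- x) * -1))) (at x)"
      by (intro DERIV_minus DERIV_cmult DERIV_chain2[OF du(2) m]) (use x in auto)
    then show "((\<lambda>x. - (\<sigma> * ?u1 (- x))) has_real_derivative \<sigma> * ?u2 (- x)) (at x)" by simp
  qed (use glue0 that in \<open>auto intro!: du\<close>)
  have e1: "deriv_I \<phi> x = \<phi>1 x" if "x \<in> {-1..1}" for x
    by (rule deriv_I_eq[OF _ that]) (rule has_field_derivative_at_within[OF d1])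
  have d2': "(deriv_I \<phi> has_real_derivative \<phi>2 x) (at x within {-1..1})" if "x \<in> {-1..1}" for x
    by (rule has_field_derivative_transform_within[OF has_field_derivative_at_within[OF d2[OF that]] zero_less_one that])
       (simp add: e1)
  have e2: "deriv_I (deriv_I \<phi>) x = \<phi>2 x" if "x \<in> {-1..1}" for x
    by (rule deriv_I_eq[OF d2' that])
  have "continuous_on ({0..1} \<union> {-1..0}) \<phi>2"
    unfolding \<phi>2_def
  proof (rule continuous_on_cases)
    show "continuous_on {0..1} ?u2"
      by (intro continuous_at_imp_continuous_on ballI du(3)) auto
    show "continuous_on {-1..0} (\<lambda>x. \<sigma> * ?u2 (- x))"
      by (intro continuous_intros continuous_on_compose2[of "{0..1}" ?u2 "{-1..0}" uminus]
          continuous_at_imp_continuous_on ballI du(3)) auto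
  qed (use glue0(3) in auto)
  also have "{0..1} \<union> {-1..0} = {-1..1::real}" by auto
  finally have c2: "continuous_on {-1..1} (deriv_I (deriv_I \<phi>))"
    by (rule continuous_on_eq) (simp add: e2)
  have "C2_I \<phi>"
    unfolding C2_I_def differentiable_on_def real_differentiable_def
    using d1 d2' c2 by (blast intro: has_field_derivative_at_within)
  moreover have "\<phi> 1 \<noteq> 0" by (simp add: \<phi>_def)
  moreover have "- gpswf_operator c \<alpha> \<phi> x = l * \<phi> x" if x: "x \<in> {-1..1}" for x
  proof -
    have "(1 - x\<^sup>2) * \<phi>2 x - (2 * \<alpha> + 2) * x * \<phi>1 x + (l - c\<^sup>2 * x\<^sup>2) * \<phi> x = 0"
    proof (cases "0 \<le> x")
      case True
      then show ?thesis using ode[of x c l] x by (simp add: \<phi>_def \<phi>1_def \<phi>2_def)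
    next
      case False
      then have "\<sigma> * ((1 - (- x)\<^sup>2) * ?u2 (- x) - (2 * \<alpha> + 2) * (- x) * ?u1 (- x) + (l - c\<^sup>2 * (- x)\<^sup>2) * ?u (- x)) = 0"
        using ode[of "- x" c l] x by simp
      then show ?thesis using False by (simp add: \<phi>_def \<phi>1_def \<phi>2_def algebra_simps)
    qed
    then show ?thesis by (simp add: gpswf_operator_def e1[OF x] e2[OF x] algebra_simps)
  qed
  ultimately show ?thesis unfolding gpswf_eigenfunction_def by force
qed

section \<open>Rotation of the initial data\<close>

text \<open>The plane curve \<open>(Q, - P)\<close> turns counterclockwise, so it can leave the quadrant \<open>P, Q > 0\<close>
  only through the half-axis \<open>P = 0, Q > 0\<close>.\<close>
lemma rotation_step:
  fixes P Q :: "real \<Rightarrow> real"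
  assumes cont: "continuous_on UNIV P" "continuous_on UNIV Q" and ab: "a < b"
    and start: "\<forall>\<^sub>F x in at_right a. 0 < P x \<and> 0 < Q x"
    and nz: "\<And>x. a < x \<Longrightarrow> x < b \<Longrightarrow> P x * Q x \<noteq> 0" and b: "P b * Q b = 0"
    and wr: "\<forall>\<^sub>F x in at b. 0 < (P b * Q x - Q b * P x) / (x - b)"
  shows "P b = 0" "0 < Q b" "\<forall>\<^sub>F x in at_right b. 0 < Q x \<and> 0 < - P x"
proof -
  have pos: "0 < f x" if "f = P \<or> f = Q" and x: "a < x" "x < b" for f x
  proof (rule ccontr)
    assume "\<not> 0 < f x"
    have "\<forall>\<^sub>F y in at_right a. y < x \<and> a < y \<and> 0 < f y"
      using start eventually_at_right_less[of a] eventually_at_right_real[OF x(1)]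
      by eventually_elim (use that(1) in auto)
    then obtain y where y: "y < x" "a < y" "0 < f y"
      using eventually_happens[of _ "at_right a"] by (auto simp: trivial_limit_at_right_real)
    have "\<exists>z. y \<le> z \<and> z \<le> x \<and> f z = 0"
      by (rule IVT2') (use y \<open>\<not> 0 < f x\<close> that(1) cont in \<open>auto intro: continuous_on_subset\<close>)
    then show False using nz y x that(1) by fastforce
  qed
  have lim: "(f \<longlongrightarrow> f b) (at_left b)" if "f = P \<or> f = Q" for f
    using that cont by (auto simp: continuous_on_def intro: tendsto_within_subset)
  have ev: "\<forall>\<^sub>F x in at_left b. 0 < P x \<and> 0 < Q x"
    using eventually_at_left_real[OF ab] by eventually_elim (use pos in auto)
  have nn: "0 \<le> P b" "0 \<le> Q b"
    by (rule tendsto_lowerbound[OF lim]; use ev in \<open>auto elim: eventually_mono\<close>)+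
  have wl: "\<forall>\<^sub>F x in at_left b. P b * Q x - Q b * P x < 0"
    using wr unfolding eventually_at_split
  proof (elim conjE)
    assume "\<forall>\<^sub>F x in at_left b. 0 < (P b * Q x - Q b * P x) / (x - b)"
    moreover have "\<forall>\<^sub>F x in at_left b. x < b" by (simp add: eventually_at_filter)
    ultimately show ?thesis by eventually_elim (auto simp: zero_less_divide_iff)
  qed
  \<comment> \<open>If Q b were 0, the numerator left of b would be P b * Q x \<ge> 0, which has the
    wrong sign. This also excludes a passage through the origin.\<close>
  show Qb: "0 < Q b"
  proof (rule ccontr)
    assume "\<not> 0 < Q b"
    then have "Q b = 0" using nn by simp
    have "\<forall>\<^sub>F x in at_left b. False"
      using wl ev by eventually_elim (use nn \<open>Q b = 0\<close> in \<open>auto simp: mult_less_0_iff\<close>)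
    then show False by (simp add: trivial_limit_at_left_real)
  qed
  then show Pb: "P b = 0" using b by simp
  have "(Q \<longlongrightarrow> Q b) (at_right b)"
    using cont(2) by (auto simp: continuous_on_def intro: tendsto_within_subset)
  then have "\<forall>\<^sub>F x in at_right b. 0 < Q x" using Qb by (rule order_tendstoD)
  moreover have "\<forall>\<^sub>F x in at_right b. 0 < (P b * Q x - Q b * P x) / (x - b)"
    using wr unfolding eventually_at_split by simp
  moreover have "\<forall>\<^sub>F x in at_right b. b < x" by (simp add: eventually_at_filter)
  ultimately show "\<forall>\<^sub>F x in at_right b. 0 < Q x \<and> 0 < - P x"
    by eventually_elim (use Pb Qb in \<open>auto simp: divide_less_0_iff mult_less_0_iff\<close>)
qed

text \<open>Multiplication by (-\<i>)^n turns the quadrant entered after n crossings back into the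
  fourth one, so one and the same step covers every n. The first step starts at 0, where
  \<open>init\<close> places the curve; after n steps the crossing lies on the positive real axis of
  the rotated frame.\<close>

lemma rotation_quadrants:
  fixes A B :: "real \<Rightarrow> real" and ev :: "nat \<Rightarrow> real"
  assumes cont: "continuous_on UNIV A" "continuous_on UNIV B"
    and ev: "strict_mono ev" "range ev = {x. A x * B x = 0}"
    and init: "\<And>x. x \<le> 0 \<Longrightarrow> 0 < A x \<and> B x < 0"
    and wr: "\<And>b. \<forall>\<^sub>F x in at b. 0 < (A b * B x - B b * A x) / (x - b)"
  shows "\<exists>r>0. Complex (A (ev n)) (B (ev n)) = of_real r * \<i> ^ n"
proof -
  define Z where "Z = (\<lambda>n x. Complex (A x) (B x) * (- \<i>) ^ n)"
  define P Q where "P = (\<lambda>n x. - Im (Z n x))" and "Q = (\<lambda>n x. Re (Z n x))"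
  have Z_Suc: "P (Suc n) x = Q n x" "Q (Suc n) x = - P n x" for n x
    by (simp_all add: P_def Q_def Z_def mult.assoc[symmetric] mult.commute[of "- \<i>"])
  have Z_0: "P 0 x = - B x" "Q 0 x = A x" for x
    by (simp_all add: P_def Q_def Z_def)
  have contPQ: "continuous_on UNIV (P n)" "continuous_on UNIV (Q n)" for n
  proof (induction n)
    case (Suc n)
    then show "continuous_on UNIV (P (Suc n))" "continuous_on UNIV (Q (Suc n))"
      using continuous_on_minus[of UNIV "P n"] by (simp_all add: Z_Suc[abs_def])
  qed (use cont in \<open>simp_all add: Z_0[abs_def] continuous_on_minus\<close>)
  \<comment> \<open>Zero set of the product and Wronskian are unchanged by quarter turns, so the
    hypotheses on A and B carry over to every rotated frame.\<close>
  have prod: "P n x * Q n x = 0 \<longleftrightarrow> A x * B x = 0" for n x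
    by (induction n) (auto simp: Z_Suc Z_0)
  have inv: "P n b * Q n x - Q n b * P n x = A b * B x - B b * A x" for n b x
    by (induction n) (simp_all add: Z_Suc Z_0 algebra_simps)
  have zero: "A (ev m) * B (ev m) = 0" for m using ev(2) by auto
  have nz: "A x * B x \<noteq> 0" if "\<And>m. x \<noteq> ev m" for x
    using that ev(2) by (metis (mono_tags, lifting) mem_Collect_eq rangeE)
  have b: "P n (ev n) * Q n (ev n) = 0" for n
    unfolding prod by (rule zero)
  have w: "\<forall>\<^sub>F x in at (ev n). 0 < (P n (ev n) * Q n x - Q n (ev n) * P n x) / (x - ev n)" for n
    unfolding inv by (rule wr)
  have main: "P n (ev n) = 0 \<and> 0 < Q n (ev n) \<and> (\<forall>\<^sub>F x in at_right (ev n). 0 < Q n x \<and> 0 < - P n x)" for n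
  proof (induction n)
    case 0
    have pos: "0 < ev 0"
    proof (rule ccontr)
      assume "\<not> 0 < ev 0"
      then show False using init[of "ev 0"] zero[of 0] by auto
    qed
    have "\<forall>\<^sub>F x in at_right 0. 0 < f x" if "continuous_on UNIV f" "0 < f 0" for f :: "real \<Rightarrow> real"
      using that by (intro order_tendstoD(1)[of f "f 0"]) (auto simp: continuous_on_def intro: tendsto_within_subset)
    from this[OF contPQ(1)[of 0]] this[OF contPQ(2)[of 0]]
    have start: "\<forall>\<^sub>F x in at_right 0. 0 < P 0 x \<and> 0 < Q 0 x"
      using init[of 0] by (auto simp: Z_0 eventually_conj_iff)
    have "P 0 x * Q 0 x \<noteq> 0" if "0 < x" "x < ev 0" for x
      unfolding prod
    proof (rule nz)
      fix m show "x \<noteq> ev m"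
        using that strict_mono_less_eq[OF ev(1), of 0 m] by auto
    qed
    from rotation_step[OF contPQ pos start this b w] show ?case by blast
  next
    case (Suc n)
    have less: "ev n < ev (Suc n)" using ev(1) by (simp add: strict_mono_less)
    have start: "\<forall>\<^sub>F x in at_right (ev n). 0 < P (Suc n) x \<and> 0 < Q (Suc n) x"
      using Suc by (simp add: Z_Suc)
    have "P (Suc n) x * Q (Suc n) x \<noteq> 0" if "ev n < x" "x < ev (Suc n)" for x
      unfolding prod
    proof (rule nz)
      fix m show "x \<noteq> ev m"
      proof
        assume "x = ev m"
        then have "n < m" "m < Suc n" using that ev(1) by (simp_all add: strict_mono_less)
        then show False by simp
      qed
    qed
    from rotation_step[OF contPQ less start this b w] show ?case by blast
  qed
  have "Z n (ev n) = of_real (Q n (ev n))"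
    using main[of n] by (auto simp: complex_eq_iff P_def Q_def)
  then have "Complex (A (ev n)) (B (ev n)) * ((- \<i>) ^ n * \<i> ^ n) = of_real (Q n (ev n)) * \<i> ^ n"
    by (simp add: Z_def mult.assoc[symmetric])
  then have "Complex (A (ev n)) (B (ev n)) = of_real (Q n (ev n)) * \<i> ^ n"
    by (simp flip: power_mult_distrib)
  then show ?thesis using main[of n] by auto
qed

text \<open>Here the numbering of the eigenvalues enters: n becomes a count of axis crossings and
  thereby a power of \<i>.\<close>

lemma is_gpswf_phase:
  assumes \<alpha>: "\<alpha> > -1" and c: "c > 0" and \<psi>: "is_gpswf c \<alpha> n \<psi>"
  obtains l r where "l > 0" "gpswf_eigenfunction c \<alpha> l \<psi>" "r > 0" "\<psi> 1 \<noteq> 0"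
    "Complex (\<psi> 0) (deriv_I \<psi> 0) = of_real (\<psi> 1 * r) * \<i> ^ n"
proof -
  obtain ev where ev: "strict_mono ev" "range ev = {l. \<exists>\<phi>. gpswf_eigenfunction c \<alpha> l \<phi>}"
    and ef: "gpswf_eigenfunction c \<alpha> (ev n) \<psi>"
    using \<psi> by (auto simp: is_gpswf_def)
  let ?A = "\<lambda>l. sl_u c \<alpha> l 0" and ?B = "\<lambda>l. sl_u1 c \<alpha> l 0"
  have range: "range ev = {l. ?A l * ?B l = 0}"
    unfolding ev(2) using eigenfunction_at_0(1)[OF \<alpha>] eigenfunction_exists[OF \<alpha>] by blast
  have wr: "\<forall>\<^sub>F x in at b. 0 < (?A b * ?B x - ?B b * ?A x) / (x - b)" for b
  proof -
    have "\<forall>\<^sub>F x in at b. x \<noteq> b" by (simp add: eventually_at_filter)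
    with sl_u_overlap_pos[OF \<alpha>, of c b] show ?thesis
      by eventually_elim (simp add: sl_u_wronskian[OF \<alpha>])
  qed
  have "\<exists>r>0. Complex (?A (ev n)) (?B (ev n)) = of_real r * \<i> ^ n"
    by (rule rotation_quadrants[OF _ _ ev(1) range _ wr])
       (use continuous_sl_u[OF \<alpha>] sl_u_nonpos[OF \<alpha> c] in auto)
  then obtain r where r: "r > 0" "Complex (?A (ev n)) (?B (ev n)) = of_real r * \<i> ^ n" by blast
  note e0 = eigenfunction_at_0[OF \<alpha> ef]
  have "Complex (\<psi> 0) (deriv_I \<psi> 0) = of_real (\<psi> 1) * Complex (?A (ev n)) (?B (ev n))"
    by (simp add: e0(3,4) complex_eq_iff)
  then have *: "Complex (\<psi> 0) (deriv_I \<psi> 0) = of_real (\<psi> 1 * r) * \<i> ^ n"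
    by (simp add: r(2))
  have "ev n > 0"
  proof (rule ccontr)
    assume "\<not> 0 < ev n"
    then show False using sl_u_nonpos[OF \<alpha> c, of "ev n"] e0(1) by auto
  qed
  then show ?thesis using that[OF _ ef r(1) e0(2) *] by blast
qed

section \<open>The phase of the eigenvalue\<close>

lemma gpswf_flux_deriv:
  assumes "gpswf_eigenfunction c \<alpha> l \<psi>" and x: "-1 < x" "x < 1"
  shows "((\<lambda>x. omega (\<alpha> + 1) x * deriv_I \<psi> x) has_real_derivative (c\<^sup>2 * x\<^sup>2 - l) * \<psi> x * omega \<alpha> x) (at x)"
proof -
  let ?r = "((2 * \<alpha> + 2) * x * deriv_I \<psi> x + (c\<^sup>2 * x\<^sup>2 - l) * \<psi> x) / (1 - x\<^sup>2)"
  have "((\<lambda>x. omega (\<alpha> + 1) x * deriv_I \<psi> x) has_real_derivative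
      - 2 * (\<alpha> + 1) * x * omega \<alpha> x * deriv_I \<psi> x + ?r * omega (\<alpha> + 1) x) (at x)"
    by (intro DERIV_mult has_real_derivative_omega_Suc gpswf_eigenfunction_deriv_interior(2)[OF assms(1)] x)
  moreover have "1 - x\<^sup>2 \<noteq> 0"
    using x abs_square_less_1[of x] by auto
  then have "?r * omega (\<alpha> + 1) x = ((2 * \<alpha> + 2) * x * deriv_I \<psi> x + (c\<^sup>2 * x\<^sup>2 - l) * \<psi> x) * omega \<alpha> x"
    using x by (simp add: omega_Suc)
  ultimately show ?thesis
    by (elim DERIV_cong) (simp add: algebra_simps)
qed

text \<open>Green's formula for \<psi> and x^k: the operator is symmetric for the weight and sends
  x^k to a combination of x^(k-2), x^k and x^(k+2). For k < 2 the truncated k - 2 is harmless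
  because of the factor k (k - 1).\<close>

lemma moment_of_recurrence:
  assumes \<alpha>: "\<alpha> > -1" and ef: "gpswf_eigenfunction c \<alpha> l \<psi>"
  shows "c\<^sup>2 * moment_of \<alpha> \<psi> (k + 2) = (l - real k * (real k + 2 * \<alpha> + 1)) * moment_of \<alpha> \<psi> k
    + real k * (real k - 1) * moment_of \<alpha> \<psi> (k - 2)"
proof -
  note cont = gpswf_eigenfunction_cont[OF ef]
  let ?p = "omega (\<alpha> + 1)" and ?M = "weight_measure \<alpha>"
  let ?F = "\<lambda>x. x ^ k * (?p x * deriv_I \<psi> x) - (?p x * (real k * x ^ (k - 1))) * \<psi> x"
  let ?f = "\<lambda>x. c\<^sup>2 * (x ^ (k + 2) * \<psi> x) - (l - real k * (real k + 2 * \<alpha> + 1)) * (x ^ k * \<psi> x)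
    - real k * (real k - 1) * (x ^ (k - 2) * \<psi> x)"
  have "(\<integral>x. ?f x \<partial>?M) = ?F 1 - ?F (-1)"
  proof (rule integral_weight_FTC_full[OF \<alpha>])
    fix x :: real assume x: "-1 < x" "x < 1"
    have p: "real k * (x * x ^ (k - 1)) = real k * x ^ k" by (cases k) auto
    have q: "real k * (real (k - 1) * (x\<^sup>2 * x ^ (k - 2))) = real k * (real (k - 1) * x ^ k)"
    proof (cases "k < 2")
      case False
      then have "x\<^sup>2 * x ^ (k - 2) = x ^ k" by (metis le_add_diff_inverse not_less power_add)
      then show ?thesis by simp
    qed (auto simp: less_2_cases_iff)
    have k1: "real k * real (k - 1) = real k * (real k - 1)" by (cases k) auto
    have "((\<lambda>x. real k * x ^ (k - 1)) has_real_derivative real k * (real (k - 1) * x ^ (k - 2))) (at x)"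
      by (rule derivative_eq_intros refl)+ (simp add: numeral_2_eq_2)
    then have dA: "((\<lambda>x. ?p x * (real k * x ^ (k - 1))) has_real_derivative
        (- 2 * (\<alpha> + 1) * x * omega \<alpha> x) * (real k * x ^ (k - 1)) + real k * (real (k - 1) * x ^ (k - 2)) * ?p x) (at x)"
      by (intro DERIV_mult has_real_derivative_omega_Suc x)
    have dB: "((\<lambda>x. x ^ k) has_real_derivative real k * x ^ (k - 1)) (at x)"
      by (rule derivative_eq_intros refl)+ simp
    have "(?F has_real_derivative
        (real k * x ^ (k - 1) * (?p x * deriv_I \<psi> x) + (c\<^sup>2 * x\<^sup>2 - l) * \<psi> x * omega \<alpha> x * x ^ k)
        - (((- 2 * (\<alpha> + 1) * x * omega \<alpha> x) * (real k * x ^ (k - 1)) + real k * (real (k - 1) * x ^ (k - 2)) * ?p x) * \<psi> x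
          + deriv_I \<psi> x * (?p x * (real k * x ^ (k - 1))))) (at x)" (is "(_ has_real_derivative ?D) _")
      by (rule DERIV_diff[OF DERIV_mult[OF dB gpswf_flux_deriv[OF ef x]]
          DERIV_mult[OF dA gpswf_eigenfunction_deriv_interior(1)[OF ef x]]])
    moreover have "?D = ?f x * omega \<alpha> x"
    proof -
      have "?D = (c\<^sup>2 * x\<^sup>2 - l) * \<psi> x * omega \<alpha> x * x ^ k
          + 2 * (\<alpha> + 1) * omega \<alpha> x * (real k * (x * x ^ (k - 1))) * \<psi> x
          - (real k * real (k - 1)) * x ^ (k - 2) * omega \<alpha> x * \<psi> x
          + real k * (real (k - 1) * (x\<^sup>2 * x ^ (k - 2))) * omega \<alpha> x * \<psi> x"
        using x by (simp only: omega_Suc less_imp_le) (simp only: algebra_simps)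
      also have "\<dots> = (c\<^sup>2 * x\<^sup>2 - l) * \<psi> x * omega \<alpha> x * x ^ k
          + 2 * (\<alpha> + 1) * omega \<alpha> x * (real k * x ^ k) * \<psi> x
          - (real k * (real k - 1)) * x ^ (k - 2) * omega \<alpha> x * \<psi> x
          + (real k * (real k - 1)) * x ^ k * omega \<alpha> x * \<psi> x"
        unfolding p q by (simp only: k1 mult.assoc[symmetric])
      also have "\<dots> = ?f x * omega \<alpha> x"
        by (simp add: algebra_simps power2_eq_square)
      finally show ?thesis .
    qed
    ultimately show "(?F has_real_derivative ?f x * omega \<alpha> x) (at x)" by simp
  qed (use cont \<alpha> in \<open>auto intro!: continuous_intros continuous_on_omega_Suc\<close>)
  also have "?F 1 - ?F (-1) = 0" by simp
  finally have "(\<integral>x. ?f x \<partial>?M) = 0" .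
  moreover have "(\<integral>x. ?f x \<partial>?M) = c\<^sup>2 * moment_of \<alpha> \<psi> (k + 2) - (l - real k * (real k + 2 * \<alpha> + 1)) * moment_of \<alpha> \<psi> k
    - real k * (real k - 1) * moment_of \<alpha> \<psi> (k - 2)"
  proof -
    have i: "integrable ?M (\<lambda>x. a * (x ^ j * \<psi> x))" for a j
      using cont \<alpha> by (auto intro!: integrable_weight continuous_intros)
    show ?thesis unfolding moment_of_def
      by (subst Bochner_Integration.integral_diff | intro Bochner_Integration.integrable_diff i | simp)+
  qed
  ultimately show ?thesis by simp
qed

text \<open>The recurrence moves in steps of two and can be solved for the highest moment as c > 0.
  For j < 2 its first instance has no lower term, so one vanishing moment annihilates its whole
  parity class.\<close>

lemma moment_of_vanish:
  assumes \<alpha>: "\<alpha> > -1" and c: "c > 0" and ef: "gpswf_eigenfunction c \<alpha> l \<psi>"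
    and zero: "moment_of \<alpha> \<psi> j = 0" "j < 2"
  shows "moment_of \<alpha> \<psi> (j + 2 * i) = 0"
proof (induction i rule: less_induct)
  case (less i)
  show ?case
  proof (cases i)
    case (Suc k)
    have "moment_of \<alpha> \<psi> (j + 2 * k) = 0" using less[of k] Suc by simp
    moreover have "real (j + 2 * k) * (real (j + 2 * k) - 1) * moment_of \<alpha> \<psi> (j + 2 * k - 2) = 0"
    proof (cases k)
      case 0
      then show ?thesis using zero(2) by (auto simp: less_2_cases_iff)
    next
      case (Suc k')
      then show ?thesis using less[of k'] \<open>i = Suc k\<close> by simp
    qed
    ultimately have "c\<^sup>2 * moment_of \<alpha> \<psi> (j + 2 * k + 2) = 0"
      unfolding moment_of_recurrence[OF \<alpha> ef] by simp
    then show ?thesis using c Suc by simp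
  qed (use zero in simp)
qed

text \<open>The Laplace transform of the weighted eigenfunction is the eigenfunction continued to the
  imaginary axis, up to the factor \<open>\<mu>\<close>; there its equation is no longer oscillatory.\<close>
definition laplace_fps :: "real \<Rightarrow> real \<Rightarrow> (real \<Rightarrow> real) \<Rightarrow> real fps" where
  "laplace_fps c \<alpha> \<psi> = Abs_fps (\<lambda>k. c ^ k * moment_of \<alpha> \<psi> k / fact k)"

lemma laplace_sums:
  assumes \<alpha>: "\<alpha> > -1" and \<psi>: "continuous_on {-1..1} \<psi>"
  shows "(\<lambda>k. fps_nth (laplace_fps c \<alpha> \<psi>) k * t ^ k) sums (\<integral>y. exp (c * t * y) * \<psi> y \<partial>weight_measure \<alpha>)"
proof -
  obtain B where B: "\<And>y. y \<in> {-1..1} \<Longrightarrow> \<bar>\<psi> y\<bar> \<le> B"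
    using continuous_on_bounded_I[OF \<psi>] by blast
  have "(\<lambda>m. of_real (c * t) ^ m / fact m * (\<integral>y. of_real y ^ m * complex_of_real (\<psi> y) \<partial>weight_measure \<alpha>)) sums
      (\<integral>y. exp (of_real (c * t) * of_real y) * complex_of_real (\<psi> y) \<partial>weight_measure \<alpha>)"
    by (rule exp_integral_weight_sums[OF \<alpha>, where B = B])
       (use \<psi> B in \<open>auto intro!: borel_measurable_weight continuous_intros\<close>)
  moreover have "of_real (c * t) ^ m / fact m * complex_of_real (moment_of \<alpha> \<psi> m) =
      of_real (fps_nth (laplace_fps c \<alpha> \<psi>) m * t ^ m)" for m
    by (simp add: laplace_fps_def power_mult_distrib mult_ac)
  moreover have "(\<integral>y. exp (of_real (c * t) * of_real y) * complex_of_real (\<psi> y) \<partial>weight_measure \<alpha>) =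
      of_real (\<integral>y. exp (c * t * y) * \<psi> y \<partial>weight_measure \<alpha>)"
    unfolding integral_complex_of_real[symmetric] by (simp flip: exp_of_real)
  ultimately show ?thesis
    unfolding moment_of_complex by (simp only: sums_of_real_iff)
qed

lemma fps_conv_radius_laplace:
  assumes "\<alpha> > -1" "continuous_on {-1..1} \<psi>"
  shows "fps_conv_radius (laplace_fps c \<alpha> \<psi>) = \<infinity>"
  unfolding fps_conv_radius_def
  by (rule conv_radius_inftyI'') (use laplace_sums[OF assms] in \<open>auto simp: sums_iff\<close>)

lemma eval_laplace_fps:
  assumes "\<alpha> > -1" "continuous_on {-1..1} \<psi>"
  shows "eval_fps (laplace_fps c \<alpha> \<psi>) t = (\<integral>y. exp (c * t * y) * \<psi> y \<partial>weight_measure \<alpha>)"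
  using laplace_sums[OF assms] by (simp add: eval_fps_def sums_iff)

text \<open>This is (1 + t^2) g'' + (2\<alpha> + 2) t g' = (l + c^2 t^2) g, the original equation at
  imaginary argument. It is obtained coefficientwise from the moment recurrence, because \<mu> might
  still be 0 and g then could not be compared with \<psi>.\<close>

lemma laplace_fps_ode:
  assumes \<alpha>: "\<alpha> > -1" and ef: "gpswf_eigenfunction c \<alpha> l \<psi>"
  defines "G \<equiv> laplace_fps c \<alpha> \<psi>"
  shows "fps_deriv (fps_deriv G) + fps_X * (fps_X * fps_deriv (fps_deriv G))
    + fps_const (2 * \<alpha> + 2) * (fps_X * fps_deriv G) - fps_const l * G - fps_const (c\<^sup>2) * (fps_X * (fps_X * G)) = 0"
    (is "?lhs = 0")
proof (rule fps_ext)
  fix n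
  let ?m = "moment_of \<alpha> \<psi>"
  let ?b = "if 2 \<le> n then c ^ (n - 2) * ?m (n - 2) / fact (n - 2) else 0"
  define a where "a = c ^ n * ?m n / fact n"
  have G: "fps_nth G j = c ^ j * ?m j / fact j" for j by (simp add: G_def laplace_fps_def)
  have n1: "fps_nth (fps_X * (fps_X * fps_deriv (fps_deriv G))) n = real n * (real n - 1) * a"
  proof (cases n)
    case (Suc m)
    then show ?thesis by (cases m) (simp_all add: G a_def mult_ac)
  qed (simp add: G)
  have n2: "fps_nth (fps_X * fps_deriv G) n = real n * a"
    by (cases n) (simp_all add: G a_def)
  have n3: "fps_nth (fps_X * (fps_X * G)) n = ?b"
  proof (cases n)
    case (Suc m)
    then show ?thesis by (cases m) (simp_all add: G)
  qed (simp add: G)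
  have n4: "fps_nth (fps_deriv (fps_deriv G)) n = c ^ n / fact n * (c\<^sup>2 * ?m (n + 2))"
  proof -
    have "fps_nth (fps_deriv (fps_deriv G)) n = real (Suc n) * (real (Suc (Suc n)) * (c ^ (Suc (Suc n)) * ?m (Suc (Suc n)) / fact (Suc (Suc n))))"
      by (simp add: G)
    also have "\<dots> = c ^ (Suc (Suc n)) * ?m (Suc (Suc n)) / fact n"
      by (simp add: fact_Suc field_simps del: of_nat_Suc)
    finally show ?thesis by (simp add: power2_eq_square mult_ac)
  qed
  have n5: "c ^ n / fact n * (real n * (real n - 1) * ?m (n - 2)) = c\<^sup>2 * ?b"
  proof (cases "2 \<le> n")
    case True
    then obtain k where k: "n = Suc (Suc k)" by (metis add_2_eq_Suc le_Suc_ex)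
    have "c ^ n / fact n * (real n * (real n - 1) * ?m (n - 2)) =
        c\<^sup>2 * c ^ k * ?m k * ((real (Suc (Suc k)) * real (Suc k)) / fact (Suc (Suc k)))"
      by (simp add: k power2_eq_square mult_ac)
    also have "(real (Suc (Suc k)) * real (Suc k)) / fact (Suc (Suc k)) = 1 / fact k"
      by (simp add: fact_Suc field_simps del: of_nat_Suc)
    finally show ?thesis by (simp add: k)
  next
    case False
    then show ?thesis by (auto simp: not_le less_2_cases_iff)
  qed
  have "fps_nth (fps_deriv (fps_deriv G)) n =
      (l - real n * (real n + 2 * \<alpha> + 1)) * a + c\<^sup>2 * ?b"
    unfolding n4 moment_of_recurrence[OF \<alpha> ef] n5[symmetric] a_def by (simp add: algebra_simps)
  then show "fps_nth ?lhs n = fps_nth 0 n"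
    by (simp only: fps_add_nth fps_sub_nth fps_mult_left_const_nth n1 n2 n3 G a_def[symmetric] fps_zero_nth)
       (simp add: algebra_simps)
qed

text \<open>\<open>(1 + x\<^sup>2) powr (\<alpha> + 1) * g' * g\<close> is nondecreasing by the equation for \<open>g\<close> and vanishes at 0.\<close>
lemma laplace_square_mono:
  assumes \<alpha>: "\<alpha> > -1" and l: "l > 0" and ef: "gpswf_eigenfunction c \<alpha> l \<psi>"
    and zero: "moment_of \<alpha> \<psi> 0 * moment_of \<alpha> \<psi> 1 = 0" and st: "0 \<le> s" "s \<le> t"
  defines "g \<equiv> eval_fps (laplace_fps c \<alpha> \<psi>)"
  shows "(g s)\<^sup>2 \<le> (g t)\<^sup>2"
proof -
  let ?G = "laplace_fps c \<alpha> \<psi>"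
  note \<psi> = gpswf_eigenfunction_cont(1)[OF ef]
  have R: "fps_conv_radius ?G = \<infinity>" by (rule fps_conv_radius_laplace[OF \<alpha> \<psi>])
  have R1: "fps_conv_radius (fps_deriv ?G) = \<infinity>" using fps_conv_radius_deriv[of ?G] R by simp
  have R2: "fps_conv_radius (fps_deriv (fps_deriv ?G)) = \<infinity>" using fps_conv_radius_deriv[of "fps_deriv ?G"] R1 by simp
  have RX: "fps_conv_radius (fps_X * f) = \<infinity>" if "fps_conv_radius f = \<infinity>" for f :: "real fps"
    using fps_conv_radius_mult[of fps_X f] that by simp
  have RC: "fps_conv_radius (fps_const a * f) = \<infinity>" if "fps_conv_radius f = \<infinity>" for f :: "real fps" and a
    using fps_conv_radius_mult[of "fps_const a" f] that by simp
  have RA: "fps_conv_radius (f + h) = \<infinity>" if "fps_conv_radius f = \<infinity>" "fps_conv_radius h = \<infinity>" for f h :: "real fps"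
    using fps_conv_radius_add[of f h] that by simp
  have RD: "fps_conv_radius (f - h) = \<infinity>" if "fps_conv_radius f = \<infinity>" "fps_conv_radius h = \<infinity>" for f h :: "real fps"
    using fps_conv_radius_diff[of f h] that by simp
  define g1 g2 where "g1 = eval_fps (fps_deriv ?G)" and "g2 = eval_fps (fps_deriv (fps_deriv ?G))"
  have d: "(g has_real_derivative g1 x) (at x)" "(g1 has_real_derivative g2 x) (at x)" for x
    unfolding g_def g1_def g2_def by (rule has_field_derivative_eval_fps; simp add: R R1)+
  have "eval_fps (fps_deriv (fps_deriv ?G) + fps_X * (fps_X * fps_deriv (fps_deriv ?G))
    + fps_const (2 * \<alpha> + 2) * (fps_X * fps_deriv ?G) - fps_const l * ?G - fps_const (c\<^sup>2) * (fps_X * (fps_X * ?G))) x = 0" for x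
    unfolding laplace_fps_ode[OF \<alpha> ef] by simp
  then have ode: "g2 x + x * (x * g2 x) + (2 * \<alpha> + 2) * (x * g1 x) - l * g x - c\<^sup>2 * (x * (x * g x)) = 0" for x
    by (simp add: eval_fps_add eval_fps_diff eval_fps_mult R R1 R2 RX RC RA RD g_def g1_def g2_def)
  define H where "H = (\<lambda>x. (1 + x\<^sup>2) powr (\<alpha> + 1) * g1 x * g x)"
  have pos: "0 < 1 + x\<^sup>2" for x :: real by (simp add: add_pos_nonneg)
  have dH: "(H has_real_derivative (1 + x\<^sup>2) powr \<alpha> * ((l + c\<^sup>2 * x\<^sup>2) * (g x)\<^sup>2 + (1 + x\<^sup>2) * (g1 x)\<^sup>2)) (at x)" for x
  proof -
    have "((\<lambda>x. (1 + x\<^sup>2) powr (\<alpha> + 1)) has_real_derivative (\<alpha> + 1) * (1 + x\<^sup>2) powr (\<alpha> + 1 - 1) * (2 * x)) (at x)"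
      by (intro DERIV_chain2[OF has_real_derivative_powr] pos) (auto intro!: derivative_eq_intros)
    then have "(H has_real_derivative ((\<alpha> + 1) * (1 + x\<^sup>2) powr (\<alpha> + 1 - 1) * (2 * x) * g1 x
        + g2 x * (1 + x\<^sup>2) powr (\<alpha> + 1)) * g x + g1 x * ((1 + x\<^sup>2) powr (\<alpha> + 1) * g1 x)) (at x)"
      unfolding H_def by (intro DERIV_mult d)
    moreover have "(1 + x\<^sup>2) powr (\<alpha> + 1) = (1 + x\<^sup>2) powr \<alpha> * (1 + x\<^sup>2)"
      using pos[of x] by (simp add: powr_add)
    ultimately have "(H has_real_derivative (1 + x\<^sup>2) powr \<alpha> *
        ((g2 x + x * (x * g2 x) + (2 * \<alpha> + 2) * (x * g1 x)) * g x + (1 + x\<^sup>2) * (g1 x)\<^sup>2)) (at x)"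
      by (elim DERIV_cong) (simp add: algebra_simps power2_eq_square)
    also have "g2 x + x * (x * g2 x) + (2 * \<alpha> + 2) * (x * g1 x) = (l + c\<^sup>2 * x\<^sup>2) * g x"
      using ode[of x] by (simp add: algebra_simps power2_eq_square)
    finally show ?thesis by (simp add: power2_eq_square mult.assoc)
  qed
  \<comment> \<open>g(0) and g'(0) are the moments of order 0 and c times that of order 1, so this
    is the hypothesis \<open>zero\<close>.\<close>
  have H0: "H 0 = 0"
    using zero by (auto simp: H_def g_def g1_def eval_fps_at_0 laplace_fps_def)
  have H: "0 \<le> H x" if "0 \<le> x" for x
  proof -
    have "H 0 \<le> H x"
    proof (rule DERIV_nonneg_imp_nondecreasing[OF that])
      fix y
      show "\<exists>z. (H has_real_derivative z) (at y) \<and> 0 \<le> z"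
        using dH[of y] l by (intro exI conjI) (auto intro!: mult_nonneg_nonneg add_nonneg_nonneg)
    qed
    then show ?thesis using H0 by simp
  qed
  show ?thesis
  proof (rule DERIV_nonneg_imp_nondecreasing[OF st(2)])
    fix x assume "s \<le> x"
    then have "0 \<le> (1 + x\<^sup>2) powr (\<alpha> + 1) * (g1 x * g x)"
      using H[of x] st by (simp add: H_def mult.assoc)
    then have "0 \<le> 2 * (g1 x * g x)"
      using pos[of x] by (simp add: zero_le_mult_iff)
    moreover have "((\<lambda>x. (g x)\<^sup>2) has_real_derivative 2 * (g1 x * g x)) (at x)"
      by (auto intro!: derivative_eq_intros d)
    ultimately show "\<exists>y. ((\<lambda>x. (g x)\<^sup>2) has_real_derivative y) (at x) \<and> 0 \<le> y" by blast
  qed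
qed

text \<open>For large \<open>t\<close> the mass of \<open>exp (c * t * y)\<close> concentrates at \<open>y = 1\<close>.\<close>
lemma laplace_sign_at_top:
  assumes \<alpha>: "\<alpha> > -1" and c: "c > 0" and \<psi>: "continuous_on {-1..1} \<psi>" and pos: "\<psi> 1 \<noteq> 0"
  obtains t where "t \<ge> t0" "0 < (\<integral>y. exp (c * t * y) * \<psi> y \<partial>weight_measure \<alpha>) * \<psi> 1"
proof -
  let ?M = "weight_measure \<alpha>"
  define f where "f = (\<lambda>y. \<psi> 1 * \<psi> y)"
  have f: "continuous_on {-1..1} f" unfolding f_def by (intro continuous_intros \<psi>)
  obtain B where B: "\<And>y. y \<in> {-1..1} \<Longrightarrow> \<bar>f y\<bar> \<le> B" using continuous_on_bounded_I[OF f] by blast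
  have B0: "0 \<le> B" using order.trans[OF abs_ge_zero B[of 1]] by simp
  define \<eta> where "\<eta> = f 1 / 2"
  have \<eta>: "0 < \<eta>" using pos by (simp add: \<eta>_def f_def power2_eq_square[symmetric])
  have "(f \<longlongrightarrow> f 1) (at 1 within {-1..1})" using f by (simp add: continuous_on_def)
  then have "\<forall>\<^sub>F y in at 1 within {-1..1}. \<eta> < f y"
    by (rule order_tendstoD) (use \<eta> in \<open>simp add: \<eta>_def\<close>)
  then obtain d where d: "d > 0" "\<And>y. y \<in> {-1..1} \<Longrightarrow> y \<noteq> 1 \<Longrightarrow> dist y 1 < d \<Longrightarrow> \<eta> < f y"
    by (auto simp: eventually_at)
  define \<delta> where "\<delta> = min (d / 2) 1"
  have \<delta>: "0 < \<delta>" "\<delta> \<le> 1" "\<delta> < d" using d by (auto simp: \<delta>_def)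
  have near: "\<eta> \<le> f y" if "1 - \<delta> \<le> y" "y \<le> 1" for y
  proof (cases "y = 1")
    case True
    then show ?thesis using \<eta> by (simp add: \<eta>_def)
  next
    case False
    then show ?thesis using d(2)[of y] that \<delta> by (auto simp: dist_real_def)
  qed
  let ?I = "indicator {1 - \<delta> / 2..1} :: real \<Rightarrow> real"
  have I: "integrable ?M ?I"
    by (rule integrable_weight_bounded[OF \<alpha>, of _ 1])
       (auto simp: borel_measurable_weight_iff intro!: measurable_restrict_space1 split: split_indicator)
  define w where "w = (\<integral>y. ?I y \<partial>?M)"
  have w: "0 < w"
    unfolding w_def by (rule integral_weight_pos[OF I, of "1 - \<delta> / 2" 1]) (use \<delta> in auto)
  define m where "m = moment \<alpha> 0"
  have m: "0 \<le> m" unfolding m_def by (rule moment_nonneg[OF \<alpha>])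
  \<comment> \<open>Chosen so that already c t \<delta> / 2, a lower bound of exp (c t \<delta> /
    2), exceeds B m / (\<eta> w). The remaining summands ensure t \<ge> t0 and t > 0.\<close>
  define t where "t = max t0 0 + 2 * B * m / (c * \<delta> * (\<eta> * w)) + 1"
  have cd: "0 < c * \<delta> * (\<eta> * w)" using c \<delta> \<eta> w by simp
  have t: "t0 \<le> t" "0 < t" "2 * B * m / (c * \<delta> * (\<eta> * w)) < t"
  proof -
    have "0 \<le> 2 * B * m / (c * \<delta> * (\<eta> * w))" using cd B0 m by (intro divide_nonneg_pos) auto
    then show "t0 \<le> t" "0 < t" unfolding t_def by linarith+
    show "2 * B * m / (c * \<delta> * (\<eta> * w)) < t" unfolding t_def by linarith
  qed
  have ex: "exp (c * t * a) \<le> exp (c * t * b)" if "a \<le> b" for a b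
    using that c t by simp
  \<comment> \<open>Left of 1 - \<delta> only the bound B is known, between the two radii f \<ge> 0
    is enough, and right of 1 - \<delta> / 2 the value is at least \<eta>. The gap between the radii
    supplies the factor exp (c t \<delta> / 2) that decides the comparison.\<close>
  have le: "exp (c * t * (1 - \<delta> / 2)) * \<eta> * ?I y - exp (c * t * (1 - \<delta>)) * B \<le> exp (c * t * y) * f y"
    if y: "y \<in> {-1..1}" for y
  proof -
    have E0: "0 \<le> exp (c * t * (1 - \<delta>)) * B" using B0 by simp
    consider "y < 1 - \<delta>" | "1 - \<delta> \<le> y" "y < 1 - \<delta> / 2" | "1 - \<delta> / 2 \<le> y" by linarith
    then show ?thesis
    proof cases
      case 1
      have "exp (c * t * y) * \<bar>f y\<bar> \<le> exp (c * t * (1 - \<delta>)) * B"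
        using 1 B[OF y] by (intro mult_mono ex) auto
      then have "- (exp (c * t * (1 - \<delta>)) * B) \<le> exp (c * t * y) * f y"
        using abs_ge_minus_self[of "exp (c * t * y) * f y"] by (simp add: abs_mult)
      then show ?thesis using 1 \<delta> by simp
    next
      case 2
      have "0 \<le> exp (c * t * y) * f y" using near[of y] 2 y \<eta> by simp
      then show ?thesis using 2 E0 by simp
    next
      case 3
      have "exp (c * t * (1 - \<delta> / 2)) * \<eta> \<le> exp (c * t * y) * f y"
        using 3 y \<eta> near[of y] \<delta> by (intro mult_mono ex) auto
      then show ?thesis using 3 y E0 by simp
    qed
  qed
  have "(\<integral>y. exp (c * t * (1 - \<delta> / 2)) * \<eta> * ?I y - exp (c * t * (1 - \<delta>)) * B * y ^ 0 \<partial>?M) \<le> (\<integral>y. exp (c * t * y) * f y \<partial>?M)"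
  proof (rule integral_mono)
    show "integrable ?M (\<lambda>y. exp (c * t * (1 - \<delta> / 2)) * \<eta> * ?I y - exp (c * t * (1 - \<delta>)) * B * y ^ 0)"
      using I by (intro Bochner_Integration.integrable_diff integrable_mult_right)
        (auto intro!: integrable_weight[OF \<alpha>] continuous_intros)
    show "integrable ?M (\<lambda>y. exp (c * t * y) * f y)"
      by (intro integrable_weight[OF \<alpha>] continuous_intros f)
  qed (use le in auto)
  also have "(\<integral>y. exp (c * t * (1 - \<delta> / 2)) * \<eta> * ?I y - exp (c * t * (1 - \<delta>)) * B * y ^ 0 \<partial>?M) =
      exp (c * t * (1 - \<delta> / 2)) * \<eta> * w - exp (c * t * (1 - \<delta>)) * B * m"
    unfolding w_def m_def moment_def integral_mult_right_zero[symmetric]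
    by (rule Bochner_Integration.integral_diff)
       (use I in \<open>auto intro!: integrable_weight[OF \<alpha>] continuous_intros\<close>)
  finally have le1: "exp (c * t * (1 - \<delta> / 2)) * \<eta> * w - exp (c * t * (1 - \<delta>)) * B * m \<le> (\<integral>y. exp (c * t * y) * f y \<partial>?M)" .
  have "0 < exp (c * t * (1 - \<delta>)) * (exp (c * t * \<delta> / 2) * (\<eta> * w) - B * m)"
  proof -
    have "2 * B * m < t * (c * \<delta> * (\<eta> * w))" using t(3) cd by (simp only: pos_divide_less_eq)
    then have "B * m < (c * t * \<delta> / 2) * (\<eta> * w)" by (simp add: mult_ac)
    also have "c * t * \<delta> / 2 \<le> exp (c * t * \<delta> / 2)"
      using exp_ge_add_one_self[of "c * t * \<delta> / 2"] by linarith
    then have "(c * t * \<delta> / 2) * (\<eta> * w) \<le> exp (c * t * \<delta> / 2) * (\<eta> * w)"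
      using \<eta> w by (intro mult_right_mono) auto
    finally show ?thesis by simp
  qed
  also have "\<dots> = exp (c * t * (1 - \<delta>) + c * t * \<delta> / 2) * (\<eta> * w) - exp (c * t * (1 - \<delta>)) * (B * m)"
    unfolding exp_add by (simp only: right_diff_distrib mult.assoc)
  also have "c * t * (1 - \<delta>) + c * t * \<delta> / 2 = c * t * (1 - \<delta> / 2)" by (simp add: algebra_simps)
  finally have "0 < (\<integral>y. exp (c * t * y) * f y \<partial>?M)" using le1 by (simp add: mult.assoc)
  also have "(\<integral>y. exp (c * t * y) * f y \<partial>?M) = (\<integral>y. exp (c * t * y) * \<psi> y \<partial>?M) * \<psi> 1"
    unfolding f_def by (subst integral_mult_left_zero[symmetric]) (simp only: mult_ac)
  finally show ?thesis using that[OF t(1)] by blast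
qed

text \<open>With the wrong sign at s, the transform would have a zero between s and a point t where
  its sign is that of \<psi>(1). But its square is nondecreasing and already positive at s.\<close>

lemma laplace_sign:
  assumes \<alpha>: "\<alpha> > -1" and c: "c > 0" and l: "l > 0" and ef: "gpswf_eigenfunction c \<alpha> l \<psi>"
    and zero: "moment_of \<alpha> \<psi> 0 * moment_of \<alpha> \<psi> 1 = 0" and \<psi>1: "\<psi> 1 \<noteq> 0"
    and s: "0 \<le> s" "eval_fps (laplace_fps c \<alpha> \<psi>) s \<noteq> 0"
  shows "0 < eval_fps (laplace_fps c \<alpha> \<psi>) s * \<psi> 1"
proof -
  let ?g = "eval_fps (laplace_fps c \<alpha> \<psi>)"
  note \<psi> = gpswf_eigenfunction_cont(1)[OF ef]
  obtain t where t: "s \<le> t" "0 < ?g t * \<psi> 1"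
    using laplace_sign_at_top[OF \<alpha> c \<psi> \<psi>1, of s] unfolding eval_laplace_fps[OF \<alpha> \<psi>] by blast
  show ?thesis
  proof (rule ccontr)
    assume "\<not> 0 < ?g s * \<psi> 1"
    then have "\<exists>x\<ge>s. x \<le> t \<and> ?g x * \<psi> 1 = 0"
      using t fps_conv_radius_laplace[OF \<alpha> \<psi>, of c]
      by (intro IVT') (auto intro!: continuous_intros)
    then obtain x where x: "s \<le> x" "?g x = 0" using \<psi>1 by auto
    have "(?g s)\<^sup>2 \<le> (?g x)\<^sup>2"
      by (rule laplace_square_mono[OF \<alpha> l ef zero s(1) x(1)])
    then show False using x(2) s(2) by simp
  qed
qed

section \<open>The eigenvalue equation at 0 and the argument of the eigenvalue\<close>

lemma weighted_Fourier_eq: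
  assumes "continuous_on {-1..1} \<psi>"
  shows "weighted_Fourier c \<alpha> (\<lambda>y. complex_of_real (\<psi> y)) x =
    (\<integral>y. exp (\<i> * of_real (c * x) * of_real y) * complex_of_real (\<psi> y) \<partial>weight_measure \<alpha>)"
  unfolding weighted_Fourier_def
  by (subst integral_weight)
     (use assms in \<open>auto intro!: borel_measurable_weight continuous_intros set_lebesgue_integral_cong
        simp: scaleR_conv_of_real mult_ac\<close>)

lemma fourier_sums:
  assumes \<alpha>: "\<alpha> > -1" and \<psi>: "continuous_on {-1..1} \<psi>"
  shows "(\<lambda>m. (\<i> * of_real z) ^ m / fact m * of_real (moment_of \<alpha> \<psi> m)) sums
    (\<integral>y. exp (\<i> * of_real z * of_real y) * complex_of_real (\<psi> y) \<partial>weight_measure \<alpha>)"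
proof -
  obtain B where B: "\<And>y. y \<in> {-1..1} \<Longrightarrow> \<bar>\<psi> y\<bar> \<le> B"
    using continuous_on_bounded_I[OF \<psi>] by blast
  show ?thesis
    unfolding moment_of_complex[symmetric]
    by (rule exp_integral_weight_sums[OF \<alpha>, where B = B])
       (use \<psi> B in \<open>auto intro!: borel_measurable_weight continuous_intros\<close>)
qed

text \<open>Value and first derivative of the eigenvalue equation at x = 0. The power series of the
  left side replaces differentiation under the integral.\<close>

lemma eigenvalue_at_0:
  assumes \<alpha>: "\<alpha> > -1" and ef: "gpswf_eigenfunction c \<alpha> l \<psi>"
    and \<mu>: "\<And>x. x \<in> {-1..1} \<Longrightarrow>
      (\<integral>y. exp (\<i> * of_real (c * x) * of_real y) * complex_of_real (\<psi> y) \<partial>weight_measure \<alpha>) = \<mu> * of_real (\<psi> x)"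
  shows "\<mu> * of_real (\<psi> 0) = of_real (moment_of \<alpha> \<psi> 0)"
    and "\<mu> * of_real (deriv_I \<psi> 0) = \<i> * of_real (c * moment_of \<alpha> \<psi> 1)"
proof -
  note \<psi> = gpswf_eigenfunction_cont(1)[OF ef]
  define F :: "complex fps" where "F = Abs_fps (\<lambda>m. (\<i> * of_real c) ^ m / fact m * of_real (moment_of \<alpha> \<psi> m))"
  have sums: "(\<lambda>m. fps_nth F m * of_real x ^ m) sums
      (\<integral>y. exp (\<i> * of_real (c * x) * of_real y) * complex_of_real (\<psi> y) \<partial>weight_measure \<alpha>)" for x
    using fourier_sums[OF \<alpha> \<psi>, of "c * x"] by (simp add: F_def power_mult_distrib mult_ac)
  have eq: "eval_fps F (of_real x) = \<mu> * of_real (\<psi> x)" if "x \<in> {-1..1}" for x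
    using sums[of x] \<mu>[OF that] by (simp add: eval_fps_def sums_iff)
  show "\<mu> * of_real (\<psi> 0) = of_real (moment_of \<alpha> \<psi> 0)"
    using eq[of 0] by (simp add: eval_fps_at_0 F_def)
  have "fps_conv_radius F = \<infinity>" unfolding fps_conv_radius_def
  proof (rule conv_radius_inftyI')
    fix r :: real assume "r > 0"
    then show "\<exists>z. norm z = r \<and> summable (\<lambda>m. fps_nth F m * z ^ m)"
      using sums_summable[OF sums[of r]] by (intro exI[of _ "of_real r"]) simp
  qed
  then have "(eval_fps F has_field_derivative eval_fps (fps_deriv F) 0) (at (of_real 0))"
    using has_field_derivative_eval_fps[of "0 :: complex" F] by simp
  then have "((\<lambda>x. eval_fps F (of_real x)) has_vector_derivative eval_fps (fps_deriv F) 0) (at 0)"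
    by (rule has_vector_derivative_real_field)
  then have "((\<lambda>x. \<mu> * of_real (\<psi> x)) has_vector_derivative eval_fps (fps_deriv F) 0) (at 0)"
    by (rule has_vector_derivative_transform_within_open[where S = "{-1<..<1}"]) (auto simp: eq)
  moreover have "((\<lambda>x. \<mu> * of_real (\<psi> x)) has_vector_derivative \<mu> * of_real (deriv_I \<psi> 0)) (at 0)"
    by (intro has_vector_derivative_mult_right has_vector_derivative_of_real)
       (use gpswf_eigenfunction_deriv_interior(1)[OF ef, of 0] in \<open>simp add: has_real_derivative_iff_has_vector_derivative\<close>)
  ultimately have "\<mu> * of_real (deriv_I \<psi> 0) = eval_fps (fps_deriv F) 0"
    by (rule vector_derivative_unique_at[rotated])
  then show "\<mu> * of_real (deriv_I \<psi> 0) = \<i> * of_real (c * moment_of \<alpha> \<psi> 1)"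
    by (simp add: eval_fps_at_0 F_def)
qed

lemma i_power_parity:
  shows "even n \<Longrightarrow> Im (\<i> ^ n) = 0" "odd n \<Longrightarrow> Re (\<i> ^ n) = 0"
  by (auto elim!: evenE oddE simp: power_mult minus_one_power_iff)

text \<open>For even n the equation \<mu> \<psi>(0) = m_0 decides, for odd n \<mu> \<psi>'(0) = \<i>
  c m_1. In both cases the data at 0 and the moment carry the sign of \<psi>(1), up to a power of
  \<i> in the data, so the quotient is a positive multiple of \<i>^n.\<close>

lemma eigenvalue_phase:
  assumes \<alpha>: "\<alpha> > -1" and c: "c > 0" and \<psi>: "is_gpswf c \<alpha> n \<psi>"
    and \<mu>: "\<And>x. x \<in> {-1..1} \<Longrightarrow>
      (\<integral>y. exp (\<i> * of_real (c * x) * of_real y) * complex_of_real (\<psi> y) \<partial>weight_measure \<alpha>) = \<mu> * of_real (\<psi> x)"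
  shows "\<exists>\<rho>>0. \<mu> = of_real \<rho> * \<i> ^ n" and "\<psi> 1 \<noteq> 0" and "continuous_on {-1..1} \<psi>"
    and "\<And>m. odd (m + n) \<Longrightarrow> moment_of \<alpha> \<psi> m = 0"
proof -
  obtain l r where l: "l > 0" and ef: "gpswf_eigenfunction c \<alpha> l \<psi>" and r: "r > 0" and \<psi>1: "\<psi> 1 \<noteq> 0"
    and Z: "Complex (\<psi> 0) (deriv_I \<psi> 0) = of_real (\<psi> 1 * r) * \<i> ^ n"
    using is_gpswf_phase[OF \<alpha> c \<psi>] by blast
  show "\<psi> 1 \<noteq> 0" "continuous_on {-1..1} \<psi>" by (fact \<psi>1 gpswf_eigenfunction_cont(1)[OF ef])+
  note cont = gpswf_eigenfunction_cont(1)[OF ef]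
  let ?m = "moment_of \<alpha> \<psi>" and ?g = "eval_fps (laplace_fps c \<alpha> \<psi>)"
  note e0 = eigenvalue_at_0[OF \<alpha> ef \<mu>]
  have even: "?m 1 = 0" if "even n"
  proof -
    have "deriv_I \<psi> 0 = 0" using arg_cong[OF Z, of Im] i_power_parity(1)[OF that] by simp
    then show ?thesis using e0(2) c by simp
  qed
  have odd: "?m 0 = 0" if "odd n"
  proof -
    have "\<psi> 0 = 0" using arg_cong[OF Z, of Re] i_power_parity(2)[OF that] by simp
    then show ?thesis using e0(1) by simp
  qed
  have zero: "?m 0 * ?m 1 = 0" using even odd by (cases "even n") auto
  \<comment> \<open>The parity of \<psi> in terms of moments; the theorem uses it to see that its
    extension is real on the whole line.\<close>
  show par: "?m m = 0" if "odd (m + n)" for m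
  proof (cases "even n")
    case True
    then obtain i where "m = 1 + 2 * i" using \<open>odd (m + n)\<close> by (auto elim: oddE)
    then show ?thesis using moment_of_vanish[OF \<alpha> c ef even[OF True], of i] by simp
  next
    case False
    then obtain i where "m = 0 + 2 * i" using \<open>odd (m + n)\<close> by (auto elim: evenE)
    then show ?thesis using moment_of_vanish[OF \<alpha> c ef odd[OF False], of i] by simp
  qed
  \<comment> \<open>If both were 0, all moments would vanish and the Laplace transform would be
    identically 0, contrary to its sign for large t. This is what excludes \<mu> = 0.\<close>
  have nz: "?m 0 \<noteq> 0 \<or> ?m 1 \<noteq> 0"
  proof (rule ccontr)
    assume "\<not> ?thesis"
    then have "?m (0 + 2 * i) = 0" "?m (1 + 2 * i) = 0" for i
      using moment_of_vanish[OF \<alpha> c ef, of 0 i] moment_of_vanish[OF \<alpha> c ef, of 1 i] by auto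
    then have "?m k = 0" for k by (cases "even k") (auto elim!: evenE oddE)
    then have "laplace_fps c \<alpha> \<psi> = 0" by (intro fps_ext) (simp add: laplace_fps_def)
    then have "?g t = 0" for t by simp
    moreover obtain t where "0 < ?g t * \<psi> 1"
      using laplace_sign_at_top[OF \<alpha> c cont \<psi>1, of 0] unfolding eval_laplace_fps[OF \<alpha> cont] by blast
    ultimately show False by simp
  qed
  have sign: "0 < ?g s * \<psi> 1" if "0 \<le> s" "?g s \<noteq> 0" for s
    by (rule laplace_sign[OF \<alpha> c l ef zero \<psi>1 that])
  have g0: "?g 0 = ?m 0" by (simp add: eval_fps_at_0 laplace_fps_def)
  show "\<exists>\<rho>>0. \<mu> = of_real \<rho> * \<i> ^ n"
  proof (cases "even n")
    case True
    have "0 < ?m 0 * \<psi> 1" using sign[of 0] nz even[OF True] g0 by auto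
    then have \<rho>: "0 < ?m 0 / (\<psi> 1 * r)" using r by (auto simp: zero_less_divide_iff zero_less_mult_iff mult_less_0_iff)
    have "Complex (\<psi> 0) (deriv_I \<psi> 0) = of_real (\<psi> 0)"
      using arg_cong[OF Z, of Im] i_power_parity(1)[OF True] by (simp add: complex_eq_iff)
    then have "\<mu> * (of_real (\<psi> 1 * r) * \<i> ^ n) = of_real (?m 0)" using e0(1) Z by simp
    then have "\<mu> * of_real (\<psi> 1 * r) * (\<i> ^ n * \<i> ^ n) = of_real (?m 0) * \<i> ^ n" by (simp add: mult_ac)
    moreover have "\<i> ^ n * \<i> ^ n = 1"
      using True by (auto elim!: evenE simp: power_mult simp flip: power_add power_mult_distrib)
    ultimately have "\<mu> = of_real (?m 0 / (\<psi> 1 * r)) * \<i> ^ n"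
      using \<psi>1 r by (simp add: field_simps)
    then show ?thesis using \<rho> by blast
  next
    case False
    have m0: "?m 0 = 0" and m1: "?m 1 \<noteq> 0" using odd[OF False] nz by auto
    \<comment> \<open>Now g(0) = 0, so the sign sits in g'(0) = c m_1: a negative g'(0) \<psi>(1)
      would give g(h) \<psi>(1) < 0 for small h > 0, against \<open>sign\<close>.\<close>
    have "0 < ?m 1 * \<psi> 1"
    proof -
      have "fps_conv_radius (laplace_fps c \<alpha> \<psi>) = \<infinity>" by (rule fps_conv_radius_laplace[OF \<alpha> cont])
      then have "(?g has_real_derivative eval_fps (fps_deriv (laplace_fps c \<alpha> \<psi>)) 0) (at 0)"
        by (intro has_field_derivative_eval_fps) simp
      from DERIV_cmult_right[OF this, of "\<psi> 1"]
      have d: "((\<lambda>t. ?g t * \<psi> 1) has_real_derivative c * (?m 1 * \<psi> 1)) (at 0)"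
        by (rule DERIV_cong) (simp add: eval_fps_at_0 laplace_fps_def)
      show ?thesis
      proof (rule ccontr)
        assume "\<not> 0 < ?m 1 * \<psi> 1"
        then have "?m 1 * \<psi> 1 < 0" using m1 \<psi>1 by (simp add: not_less less_le)
        then have "c * (?m 1 * \<psi> 1) < 0" using c by (simp add: mult_less_0_iff)
        from DERIV_neg_dec_right[OF d this]
        obtain e where e: "e > 0" "\<And>h. 0 < h \<Longrightarrow> h < e \<Longrightarrow> ?g h * \<psi> 1 < 0"
          using g0 m0 by auto
        then have "?g (e / 2) * \<psi> 1 < 0" by simp
        moreover from this have "?g (e / 2) \<noteq> 0" by auto
        ultimately show False using sign[of "e / 2"] e(1) by simp
      qed
    qed
    then have \<rho>: "0 < c * ?m 1 / (\<psi> 1 * r)" using r c by (auto simp: zero_less_divide_iff zero_less_mult_iff mult_less_0_iff)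
    have "Complex (\<psi> 0) (deriv_I \<psi> 0) = \<i> * of_real (deriv_I \<psi> 0)"
      using arg_cong[OF Z, of Re] i_power_parity(2)[OF False] by (simp add: complex_eq_iff)
    then have "\<mu> * (of_real (\<psi> 1 * r) * \<i> ^ n) = \<i> * (\<mu> * of_real (deriv_I \<psi> 0))" using Z by simp
    also have "\<dots> = \<i> * (\<i> * of_real (c * ?m 1))" by (rule arg_cong[OF e0(2)])
    also have "\<dots> = - of_real (c * ?m 1)" by simp
    finally have "\<mu> * (of_real (\<psi> 1 * r) * \<i> ^ n) * \<i> ^ n = - of_real (c * ?m 1) * \<i> ^ n"
      by (rule arg_cong)
    then have "\<mu> * of_real (\<psi> 1 * r) * (\<i> ^ n * \<i> ^ n) = - of_real (c * ?m 1) * \<i> ^ n"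
      by (simp only: mult.assoc)
    moreover have "\<i> ^ n * \<i> ^ n = -1"
      using False by (auto simp flip: power_mult_distrib)
    ultimately have "\<mu> = of_real (c * ?m 1 / (\<psi> 1 * r)) * \<i> ^ n"
      using \<psi>1 r by (simp add: field_simps)
    then show ?thesis using \<rho> by blast
  qed
qed

section \<open>Analytic extension and the two formulas\<close>

lemma has_fps_expansion_of_sums:
  fixes f :: "real \<Rightarrow> real"
  assumes "\<And>h. (\<lambda>m. a m * h ^ m) sums f h"
  shows "f has_fps_expansion Abs_fps a"
proof -
  have "fps_conv_radius (Abs_fps a) = \<infinity>"
    unfolding fps_conv_radius_def using assms by (intro conv_radius_inftyI'') (auto simp: sums_iff)
  moreover have "eval_fps (Abs_fps a) h = f h" for h
    using assms[of h] by (simp add: eval_fps_def sums_iff)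
  ultimately show ?thesis unfolding has_fps_expansion_def by simp
qed

lemma real_analytic_fourier:
  assumes \<alpha>: "\<alpha> > -1" and \<psi>: "continuous_on {-1..1} \<psi>"
  shows "real_analytic_on (\<lambda>x. Re (a *
    (\<integral>y. exp (\<i> * of_real (c * x) * of_real y) * complex_of_real (\<psi> y) \<partial>weight_measure \<alpha>))) UNIV"
  unfolding real_analytic_on_def
proof (intro ballI exI)
  fix x :: real
  \<comment> \<open>The centre x is moved into the integrand, so the expansion about x is again an
    exponential series, now in the increment h.\<close>
  let ?\<phi> = "\<lambda>y. exp (\<i> * of_real (c * x) * of_real y) * complex_of_real (\<psi> y)"
  obtain B where B: "\<And>y. y \<in> {-1..1} \<Longrightarrow> \<bar>\<psi> y\<bar> \<le> B"
    using continuous_on_bounded_I[OF \<psi>] by blast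
  have phi: "?\<phi> \<in> borel_measurable (weight_measure \<alpha>)" "norm (?\<phi> y) \<le> B" if "y \<in> {-1..1}" for y
    using \<psi> B[OF that] by (auto intro!: borel_measurable_weight continuous_intros simp: norm_mult)
  let ?d = "\<lambda>m. Re (a * ((\<i> * of_real c) ^ m / fact m * (\<integral>y. of_real y ^ m * ?\<phi> y \<partial>weight_measure \<alpha>)))"
  show "(\<lambda>h. Re (a * (\<integral>y. exp (\<i> * of_real (c * (x + h)) * of_real y) * complex_of_real (\<psi> y) \<partial>weight_measure \<alpha>)))
      has_fps_expansion Abs_fps ?d"
  proof (rule has_fps_expansion_of_sums)
    fix h :: real
    have "(\<lambda>m. (\<i> * of_real (c * h)) ^ m / fact m * (\<integral>y. of_real y ^ m * ?\<phi> y \<partial>weight_measure \<alpha>)) sums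
        (\<integral>y. exp (\<i> * of_real (c * h) * of_real y) * ?\<phi> y \<partial>weight_measure \<alpha>)"
      by (rule exp_integral_weight_sums[OF \<alpha> phi(1)[of 0], where B = B]) (use phi(2) in auto)
    from sums_Re[OF sums_mult[OF this, of a]]
    have "(\<lambda>m. Re (a * ((\<i> * of_real (c * h)) ^ m / fact m * (\<integral>y. of_real y ^ m * ?\<phi> y \<partial>weight_measure \<alpha>)))) sums
        Re (a * (\<integral>y. exp (\<i> * of_real (c * h) * of_real y) * ?\<phi> y \<partial>weight_measure \<alpha>))" .
    moreover have "Re (a * ((\<i> * of_real (c * h)) ^ m / fact m * I)) = Re (a * ((\<i> * of_real c) ^ m / fact m * I)) * h ^ m" for m I
    proof -
      have "a * ((\<i> * of_real (c * h)) ^ m / fact m * I) = of_real (h ^ m) * (a * ((\<i> * of_real c) ^ m / fact m * I))"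
        by (simp add: power_mult_distrib mult_ac)
      then show ?thesis by (simp only: scaleR_conv_of_real[symmetric] scaleR_complex.sel mult.commute)
    qed
    moreover have "exp (\<i> * of_real (c * h) * of_real y) * ?\<phi> y =
        exp (\<i> * of_real (c * (x + h)) * of_real y) * complex_of_real (\<psi> y)" for y
      by (simp add: exp_add[symmetric] mult.assoc[symmetric] ring_distribs add_ac)
    ultimately show "(\<lambda>m. ?d m * h ^ m) sums
        Re (a * (\<integral>y. exp (\<i> * of_real (c * (x + h)) * of_real y) * complex_of_real (\<psi> y) \<partial>weight_measure \<alpha>))"
      by (simp only:)
  qed
qed

theorem mainTheorem5:
  fixes c \<alpha> :: real and n :: nat and \<psi> :: "real \<Rightarrow> real" and \<mu> :: complex
  assumes "c > 0" and "\<alpha> > -1"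
    and "is_gpswf c \<alpha> n \<psi>"
    and "\<forall>x\<in>{-1..1}. weighted_Fourier c \<alpha> (\<lambda>y. complex_of_real (\<psi> y)) x = \<mu> * complex_of_real (\<psi> x)"
  shows "\<mu> \<noteq> 0 \<and>
    (\<exists>\<Psi> :: real \<Rightarrow> real. real_analytic_on \<Psi> UNIV \<and> (\<forall>x\<in>{-1..1}. \<Psi> x = \<psi> x) \<and>
       (\<forall>x. x \<noteq> 0 \<longrightarrow>
          summable (\<lambda>k. series_coeff \<alpha> n \<psi> k * complex_of_real (bessel_J_quot \<alpha> k (c * x))) \<and>
          complex_of_real (\<Psi> x) = complex_of_real (sqrt pi * 2 powr (\<alpha> + 1/2) / norm \<mu>) *
            (\<Sum>k. series_coeff \<alpha> n \<psi> k * complex_of_real (bessel_J_quot \<alpha> k (c * x))))) \<and>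
    summable (\<lambda>k. series_coeff \<alpha> n \<psi> k * complex_of_real (bessel_J (real k + \<alpha> + 1/2) c)) \<and>
    summable (\<lambda>k. jacobi_coeff \<alpha> \<psi> k / sqrt (jacobi_h \<alpha> k) *
                     (Gamma (real k + \<alpha> + 1) / (fact k * Gamma (\<alpha> + 1)))) \<and>
    (\<Sum>k. jacobi_coeff \<alpha> \<psi> k / sqrt (jacobi_h \<alpha> k) *
            (Gamma (real k + \<alpha> + 1) / (fact k * Gamma (\<alpha> + 1)))) \<noteq> 0 \<and>
    \<mu> = \<i> ^ n * complex_of_real (sqrt pi * (2 / c) powr (\<alpha> + 1/2)) *
        ((\<Sum>k. series_coeff \<alpha> n \<psi> k * complex_of_real (bessel_J (real k + \<alpha> + 1/2) c)) /
         complex_of_real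
           (\<Sum>k. jacobi_coeff \<alpha> \<psi> k / sqrt (jacobi_h \<alpha> k) *
                  (Gamma (real k + \<alpha> + 1) / (fact k * Gamma (\<alpha> + 1)))))"
proof -
  note c = assms(1) and \<alpha> = assms(2) and gp = assms(3)
  have cont: "continuous_on {-1..1} \<psi>"
    using gp gpswf_eigenfunction_cont(1) by (auto simp: is_gpswf_def)
  define I where "I = (\<lambda>x. \<integral>y. exp (\<i> * of_real (c * x) * of_real y) * complex_of_real (\<psi> y) \<partial>weight_measure \<alpha>)"
  have I: "I x = \<mu> * of_real (\<psi> x)" if "x \<in> {-1..1}" for x
    using assms(4) that unfolding I_def weighted_Fourier_eq[OF cont] by blast
  note phase = eigenvalue_phase[OF \<alpha> c gp I[unfolded I_def]]
  obtain \<rho> where \<rho>: "\<rho> > 0" "\<mu> = of_real \<rho> * \<i> ^ n" using phase(1) by blast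
  have \<mu>0: "\<mu> \<noteq> 0" using \<rho> by simp
  have norm: "norm \<mu> = \<rho>" using \<rho> by (simp add: norm_mult norm_power)
  define K where "K = sqrt pi * 2 powr (\<alpha> + 1/2)"
  have K0: "K > 0" by (simp add: K_def)
  have in0: "\<i> ^ n \<noteq> 0" by simp
  \<comment> \<open>Division by \<i>^n turns \<i>^k into the \<i>^(k-n) of
    \<open>series_coeff\<close>, and division by K removes the constant of the Fourier
    series.\<close>
  have S: "(\<lambda>k. series_coeff \<alpha> n \<psi> k * of_real (bessel_J_quot \<alpha> k (c * x))) sums (I x / (\<i> ^ n * of_real K))" for x
  proof -
    have "series_coeff \<alpha> n \<psi> k * of_real (bessel_J_quot \<alpha> k (c * x)) =
        \<i> ^ k * of_real (jacobi_coeff \<alpha> \<psi> k * (Gamma (real k + \<alpha> + 1) / (sqrt (jacobi_h \<alpha> k) * fact k)))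
        * of_real (bessel_J_quot \<alpha> k (c * x)) * of_real K / (\<i> ^ n * of_real K)" for k
      using K0 by (simp add: series_coeff_def power_int_diff mult_ac)
    then show ?thesis
      using sums_divide[OF fourier_jacobi_series[OF \<alpha> cont, of "c * x"], of "\<i> ^ n * of_real K"]
      unfolding I_def K_def by (simp only:)
  qed
  define \<Psi> where "\<Psi> = (\<lambda>x. Re (inverse \<mu> * I x))"
  \<comment> \<open>The quotient is real for every real x: moments with m + n odd vanish, and \<i>^m
    / \<i>^n is real when m + n is even.\<close>
  have \<Psi>: "of_real (\<Psi> x) = inverse \<mu> * I x" for x
  proof -
    have "(\<lambda>m. inverse \<mu> * ((\<i> * of_real (c * x)) ^ m / fact m * of_real (moment_of \<alpha> \<psi> m))) sums (inverse \<mu> * I x)"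
      unfolding I_def by (intro sums_mult fourier_sums[OF \<alpha> cont])
    from sums_Im[OF this]
    have "(\<lambda>m. Im (inverse \<mu> * ((\<i> * of_real (c * x)) ^ m / fact m * of_real (moment_of \<alpha> \<psi> m)))) sums Im (inverse \<mu> * I x)" .
    moreover have "Im (inverse \<mu> * ((\<i> * of_real (c * x)) ^ m / fact m * of_real (moment_of \<alpha> \<psi> m))) = 0" for m
    proof (cases "odd (m + n)")
      case False
      have "inverse (\<i> ^ n) = (-1) ^ n * \<i> ^ n"
        by (simp flip: power_inverse power_mult_distrib)
      then have "inverse \<mu> * ((\<i> * of_real (c * x)) ^ m / fact m * of_real (moment_of \<alpha> \<psi> m)) =
          of_real (inverse \<rho> * (-1) ^ n * ((c * x) ^ m / fact m * moment_of \<alpha> \<psi> m)) * \<i> ^ (m + n)"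
        by (simp add: \<rho>(2) inverse_mult_distrib power_mult_distrib power_add mult_ac)
      moreover have "Im (\<i> ^ (m + n)) = 0" using False by (intro i_power_parity(1)) simp
      ultimately show ?thesis
        by (simp only: scaleR_conv_of_real[symmetric] scaleR_complex.sel mult_zero_right)
    next
      case True
      then have "moment_of \<alpha> \<psi> m = 0" using phase(4)[of m] by blast
      then show ?thesis by simp
    qed
    ultimately have "Im (inverse \<mu> * I x) = 0" by (simp add: sums_iff)
    then show ?thesis by (simp add: \<Psi>_def complex_eq_iff)
  qed
  have analytic: "real_analytic_on \<Psi> UNIV"
    unfolding \<Psi>_def I_def by (rule real_analytic_fourier[OF \<alpha> cont])
  have agree: "\<Psi> x = \<psi> x" if "x \<in> {-1..1}" for x
  proof -
    have "inverse \<mu> * I x = of_real (\<psi> x)" using \<mu>0 by (simp add: I[OF that] mult.assoc[symmetric])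
    then show ?thesis by (simp only: \<Psi>_def Re_complex_of_real)
  qed
  \<comment> \<open>As \<mu> = |\<mu>| \<i>^n, multiplying the sum in \<open>S\<close> by K /
    |\<mu>| gives exactly I x / \<mu>.\<close>
  have formula: "of_real (\<Psi> x) = of_real (K / norm \<mu>) *
      (\<Sum>k. series_coeff \<alpha> n \<psi> k * of_real (bessel_J_quot \<alpha> k (c * x)))" for x
    unfolding sums_unique[OF S, symmetric] \<Psi> norm using \<rho>(1) K0 by (simp add: \<rho>(2) field_simps)
  have J: "bessel_J (real k + \<alpha> + 1/2) c = c powr (\<alpha> + 1/2) * bessel_J_quot \<alpha> k (c * 1)" for k
    using bessel_J_eq_quot[OF \<alpha> c, of k] by simp
  have SJ: "(\<lambda>k. series_coeff \<alpha> n \<psi> k * of_real (bessel_J (real k + \<alpha> + 1/2) c)) sums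
      (of_real (c powr (\<alpha> + 1/2)) * (I 1 / (\<i> ^ n * of_real K)))"
    using sums_mult[OF S[of 1], of "of_real (c powr (\<alpha> + 1/2))"] unfolding J
    by (simp add: mult_ac)
  have SE: "(\<lambda>k. jacobi_coeff \<alpha> \<psi> k / sqrt (jacobi_h \<alpha> k) *
      (Gamma (real k + \<alpha> + 1) / (fact k * Gamma (\<alpha> + 1)))) sums \<psi> 1"
  proof -
    \<comment> \<open>The power series coefficients of \<psi> at 0, read off from \<psi> = I /
      \<mu>. The moments are bounded, so the coefficients decay like those of an exponential
      series.\<close>
    let ?e = "\<lambda>m. (\<i> * of_real c) ^ m / fact m * (of_real (moment_of \<alpha> \<psi> m) / \<mu>)"
    obtain B where B: "\<And>y. y \<in> {-1..1} \<Longrightarrow> \<bar>\<psi> y\<bar> \<le> B"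
      using continuous_on_bounded_I[OF cont] by blast
    have "summable (\<lambda>m. norm (?e m) * (real m + 1))"
    proof (rule summable_comparison_test'[OF summable_mult[OF summable_exp_linear[of "\<i> * of_real c"], of "B * moment \<alpha> 0 / norm \<mu>"], of 0])
      fix m
      have "norm (?e m) = norm ((\<i> * of_real c) ^ m / fact m) * (\<bar>moment_of \<alpha> \<psi> m\<bar> / norm \<mu>)"
        by (simp only: norm_mult norm_divide norm_of_real)
      also have "\<dots> \<le> norm ((\<i> * of_real c) ^ m / fact m) * (B * moment \<alpha> 0 / norm \<mu>)"
        by (intro mult_left_mono divide_right_mono moment_of_bound[OF \<alpha> cont B]) auto
      finally have "norm (?e m) * (real m + 1) \<le> norm ((\<i> * of_real c) ^ m / fact m) * (B * moment \<alpha> 0 / norm \<mu>) * (real m + 1)"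
        by (rule mult_right_mono) simp
      then show "norm (norm (?e m) * (real m + 1)) \<le>
          B * moment \<alpha> 0 / norm \<mu> * (norm ((\<i> * of_real c) ^ m / fact m) * (real m + 1))"
        by (simp only: real_norm_def abs_mult abs_norm_cancel abs_of_nonneg of_nat_0_le_iff add_nonneg_nonneg zero_le_one mult_ac)
    qed
    then have "(\<lambda>k. jacobi_coeff \<alpha> \<psi> k * jacobi_normalized \<alpha> k 1) sums \<psi> 1"
    proof (rule jacobi_series_at_1[OF \<alpha> _ cont])
      fix x :: real assume x: "x \<in> {-1..1}"
      have "(\<lambda>m. (\<i> * of_real (c * x)) ^ m / fact m * of_real (moment_of \<alpha> \<psi> m) / \<mu>) sums (I x / \<mu>)"
        unfolding I_def by (intro sums_divide fourier_sums[OF \<alpha> cont])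
      then show "(\<lambda>m. ?e m * of_real x ^ m) sums of_real (\<psi> x)"
        using \<mu>0 by (simp add: I[OF x] power_mult_distrib mult_ac)
    qed
    then show ?thesis by (simp add: jacobi_normalized_at_1(1)[OF \<alpha>] mult_ac)
  qed
  \<comment> \<open>The powers of 2 / c and c combine to K, which cancels together with \<i>^n; what
    remains is I 1 = \<mu> \<psi>(1) divided by \<psi>(1).\<close>
  have eigenvalue: "\<mu> = \<i> ^ n * of_real (sqrt pi * (2 / c) powr (\<alpha> + 1/2)) *
      (of_real (c powr (\<alpha> + 1/2)) * (I 1 / (\<i> ^ n * of_real K)) / of_real (\<psi> 1))"
  proof -
    have "sqrt pi * (2 / c) powr (\<alpha> + 1/2) * c powr (\<alpha> + 1/2) = K"
      using c by (simp add: K_def powr_divide)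
    then have "of_real (sqrt pi * (2 / c) powr (\<alpha> + 1/2)) * complex_of_real (c powr (\<alpha> + 1/2)) = of_real K"
      by (simp only: of_real_mult[symmetric])
    then have "\<i> ^ n * of_real (sqrt pi * (2 / c) powr (\<alpha> + 1/2)) *
      (of_real (c powr (\<alpha> + 1/2)) * (I 1 / (\<i> ^ n * of_real K)) / of_real (\<psi> 1)) =
      \<i> ^ n * of_real K * (I 1 / (\<i> ^ n * of_real K)) / of_real (\<psi> 1)"
      by (simp only: mult.assoc times_divide_eq_right[symmetric] times_divide_eq_left[symmetric])
         (simp only: mult.assoc[symmetric])
    also have "\<dots> = I 1 / of_real (\<psi> 1)" using in0 K0 by simp
    also have "\<dots> = \<mu>" using phase(2) I[of 1] by simp
    finally show ?thesis by simp
  qed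
  have "\<psi> 1 \<noteq> 0" using phase(2) by blast
  then show ?thesis
    unfolding sums_unique[OF SJ, symmetric] sums_unique[OF SE, symmetric] K_def[symmetric]
    by (intro conjI exI[of _ \<Psi>] ballI allI impI \<mu>0 analytic agree formula eigenvalue
        sums_summable[OF S] sums_summable[OF SJ] sums_summable[OF SE])
qed

end
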